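(* Let $G_o$ be a unimodular lcsc group acting jointly continuously on Polish spaces $X_1,\dots,X_r$ with separated cross sections $Z_1,\dots,Z_r$ respectively, and for each $k$ let $\mu_k$ be a $G_o$-invariant Borel probability measure on $X_k$ with transverse measure $\nu_k$ on $Z_k$. If $Z_1,\dots,Z_r$ are commensurable, then for every convenient sequence $(G_t)$ of subsets of $G_o$ we have $$\underline{\mathrm{Dens}}_{(G_t)}\big((Z_1)_{z_1}\cap\dots\cap(Z_r)_{z_r}\big)>0$$ for $\nu_1\otimes\dots\otimes\nu_r$-almost all $(z_1,\dots,z_r)\in Z_1\times\dots\times Z_r$.
   Context: lcsc = locally compact second countable; $m_{G_o}$ is a fixed Haar measure on $G_o$. For a Borel action of an lcsc group $H$ on a standard Borel space $S$, a Borel set $T\subset S$ is a cross section if $H.T=S$; it is separated if $\{h\in H: h.T\cap T\ne\emptyset\}\cap U=\{e\}$ for some identity neighbourhood $U$ in $H$. For $s\in S$, $T_s:=\{h\in H:h.s\in T\}$; in particular $(Z_k)_{z}=\{g\in G_o:g.z\in Z_k\}$. If $T$ is a separated cross section and $\mu$ is a finite $H$-invariant Borel measure on $S$, the transverse measure of $\mu$ on $T$ is the unique Borel measure $\nu$ on $T$ such that for all bounded non-negative Borel $f$ on $H\times T$: $\int_S\sum_{h\in T_s}f(h^{-1},h.s)\,d\mu(s)=\int_H\int_T f(h,t)\,d\nu(t)\,dm_H(h)$. Put $X:=X_1\times\dots\times X_r$, with the product action of $G_o^r$, and $X^{[r]}:=\{(x_1,\dots,x_r)\in X:\exists g\in G_o:\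 g.x_1\in Z_1,\dots,g.x_r\in Z_r\}$, a Borel subset of $X$. For $k\in\{1,\dots,r\}$ let $N_k<G_o^r$ be the kernel of the $k$-th coordinate projection. $Z_1,\dots,Z_r$ are called commensurable if $X^{[r]}$ is a separated cross section for the $N_k$-action on $X$ for every $k\in\{1,\dots,r\}$. Convenient sequences. For a unimodular lcsc group $G$ with Haar measure $m_G$, an open identity neighbourhood $V$ and a pre-compact Borel set $B\subset G$ put $B_V^-:=\bigcap_{v\in V}v^{-1}B$, $B_V^+:=\bigcup_{v\in V}v^{-1}B$. A family $(G_t)$ (indexed by real $t>0$) of pre-compact Borel sets of positive Haar measure is called a convenient sequence if, for some decreasing sequence $(V_n)$ of open identity neighbourhoods: (a) there are sequences $(\delta_n),(\varepsilon_n),(t_n)$ of positive reals with $\delta_n,\varepsilon_n\to0$ such that for all $n$: $G_{t-\delta_n}\subset (G_t)^-_{V_n}\subset (G_t)^+_{V_n}\subset G_{t+\delta_n}$ for all $t>t_n$, and $1-\varepsilon_n\le\liminf_{t\to\infty}\frac{m_G(G_{t-\delta_n})}{m_G(G_t)}$ and $\limsup_{t\to\infty}\frac{m_G(G_{t+\delta_n})}{m_G(G_t)}\le1+\varepsilon_n$; (b) for every standard Borel space $X$ with Borel $G$-action and every bounded real Borel function $\varphi$ on $X$, the set $E_\varphi$ of $x\in X$ for which $\overline\varphi(x):=\lim_{t\to\infty}\frac1{m_G(G_t)}\int_{G_t}\varphi(g.x)\,dm_G(g)$ exists is Borel and is $\mu$-conull for every finite $G$-invariant Borel measure $\mu$ on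 $X$, the function $\overline\varphi:E_\varphi\to\mathbb R$ is Borel, and for every $G$-ergodic $G$-invariant Borel probability measure $\mu$ there is a $G$-invariant $\mu$-conull Borel set $E_\varphi(\mu)\subset E_\varphi$ with $\overline\varphi(x)=\int\varphi\,d\mu$ for all $x\in E_\varphi(\mu)$. Lower density: $\underline{\mathrm{Dens}}_{(G_t)}(A):=\liminf_{t\to\infty}\frac{|A\cap G_t|}{m_{G_o}(G_t)}$. *)

theory Defs
  imports
    "HOL-Probability.Probability"
    "HOL-Algebra.Group_Action"
    "HOL-Algebra.Product_Groups"
begin

section \<open>Topological groups, Borel structures and Haar measure\<close>

definition borel_of :: "'a topology \<Rightarrow> 'a measure" where
  "borel_of T = sigma (topspace T) {U. openin T U}"

definition polish_space :: "'a topology \<Rightarrow> bool" where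
  "polish_space T \<longleftrightarrow> completely_metrizable_space T \<and> second_countable T"

text \<open>Only the \<sigma>-algebra of \<open>M\<close> matters here; its measure is ignored.\<close>

definition standard_borel :: "'a measure \<Rightarrow> bool" where
  "standard_borel M \<longleftrightarrow> (\<exists>T. polish_space T \<and> sets M = sets (borel_of T))"

locale lcsc_group = group G for G :: "'g monoid" (structure) +
  fixes T :: "'g topology"
  assumes topspace_eq: "topspace T = carrier G"
    and continuous_mult: "continuous_map (prod_topology T T) T (\<lambda>(g, h). g \<otimes> h)"
    and continuous_inv: "continuous_map T T (\<lambda>g. inv g)"
    and Hausdorff: "Hausdorff_space T"
    and locally_compact: "locally_compact_space T"
    and second_countable: "second_countable T"

text \<open>Left Haar measures. On an lcsc group a Borel measure that is finite on compact sets is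
  automatically regular, so regularity is not listed.\<close>

definition haar_measure :: "'g monoid \<Rightarrow> 'g topology \<Rightarrow> 'g measure \<Rightarrow> bool" where
  "haar_measure G T m \<longleftrightarrow>
     sets m = sets (borel_of T) \<and>
     emeasure m (space m) \<noteq> 0 \<and>
     (\<forall>K. compactin T K \<longrightarrow> emeasure m K < \<infinity>) \<and>
     (\<forall>g\<in>carrier G. \<forall>A\<in>sets m. emeasure m (g <#\<^bsub>G\<^esub> A) = emeasure m A)"

definition unimodular :: "'g monoid \<Rightarrow> 'g topology \<Rightarrow> bool" where
  "unimodular G T \<longleftrightarrow>
     (\<forall>m. haar_measure G T m \<longrightarrow>
        (\<forall>g\<in>carrier G. \<forall>A\<in>sets m. emeasure m (A #>\<^bsub>G\<^esub> g) = emeasure m A))"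


section \<open>Actions\<close>

definition borel_action ::
    "'h monoid \<Rightarrow> 'h topology \<Rightarrow> 's measure \<Rightarrow> ('h \<Rightarrow> 's \<Rightarrow> 's) \<Rightarrow> bool" where
  "borel_action H T M \<alpha> \<longleftrightarrow>
     group_action H (space M) \<alpha> \<and> (\<lambda>(h, s). \<alpha> h s) \<in> borel_of T \<Otimes>\<^sub>M M \<rightarrow>\<^sub>M M"

definition jointly_continuous_action ::
    "'h monoid \<Rightarrow> 'h topology \<Rightarrow> 's topology \<Rightarrow> ('h \<Rightarrow> 's \<Rightarrow> 's) \<Rightarrow> bool" where
  "jointly_continuous_action H T S \<alpha> \<longleftrightarrow>
     group_action H (topspace S) \<alpha> \<and>
     continuous_map (prod_topology T S) S (\<lambda>(h, s). \<alpha> h s)"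

definition invariant_measure :: "'h monoid \<Rightarrow> ('h \<Rightarrow> 's \<Rightarrow> 's) \<Rightarrow> 's measure \<Rightarrow> bool" where
  "invariant_measure H \<alpha> \<mu> \<longleftrightarrow>
     (\<forall>h\<in>carrier H. \<alpha> h \<in> \<mu> \<rightarrow>\<^sub>M \<mu> \<and> distr \<mu> \<mu> (\<alpha> h) = \<mu>)"

definition invariant_set :: "'h monoid \<Rightarrow> ('h \<Rightarrow> 's \<Rightarrow> 's) \<Rightarrow> 's set \<Rightarrow> bool" where
  "invariant_set H \<alpha> A \<longleftrightarrow> (\<forall>h\<in>carrier H. \<alpha> h ` A = A)"

definition ergodic_measure :: "'h monoid \<Rightarrow> ('h \<Rightarrow> 's \<Rightarrow> 's) \<Rightarrow> 's measure \<Rightarrow> bool" where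
  "ergodic_measure H \<alpha> \<mu> \<longleftrightarrow>
     (\<forall>A\<in>sets \<mu>. invariant_set H \<alpha> A \<longrightarrow>
        emeasure \<mu> A = 0 \<or> emeasure \<mu> (space \<mu> - A) = 0)"


section \<open>Cross sections and transverse measures\<close>

definition cross_section ::
    "'h monoid \<Rightarrow> 's measure \<Rightarrow> ('h \<Rightarrow> 's \<Rightarrow> 's) \<Rightarrow> 's set \<Rightarrow> bool" where
  "cross_section H M \<alpha> C \<longleftrightarrow> C \<in> sets M \<and> (\<Union>h\<in>carrier H. \<alpha> h ` C) = space M"

definition separated_cross_section ::
    "'h monoid \<Rightarrow> 'h topology \<Rightarrow> 's measure \<Rightarrow> ('h \<Rightarrow> 's \<Rightarrow> 's) \<Rightarrow> 's set \<Rightarrow> bool" where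
  "separated_cross_section H T M \<alpha> C \<longleftrightarrow>
     cross_section H M \<alpha> C \<and>
     (\<exists>U. openin T U \<and> \<one>\<^bsub>H\<^esub> \<in> U \<and>
          {h \<in> carrier H. \<alpha> h ` C \<inter> C \<noteq> {}} \<inter> U = {\<one>\<^bsub>H\<^esub>})"

definition hitting_set :: "'h monoid \<Rightarrow> ('h \<Rightarrow> 's \<Rightarrow> 's) \<Rightarrow> 's set \<Rightarrow> 's \<Rightarrow> 'h set" where
  "hitting_set H \<alpha> C s = {h \<in> carrier H. \<alpha> h s \<in> C}"

text \<open>The sum over the hitting set is the integral against counting measure, with values in
  \<open>[0,\<infinity>]\<close>.\<close>

definition transverse_measure ::
    "'h monoid \<Rightarrow> 'h topology \<Rightarrow> 'h measure \<Rightarrow> ('h \<Rightarrow> 's \<Rightarrow> 's) \<Rightarrow> 's set \<Rightarrow>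
     's measure \<Rightarrow> 's measure \<Rightarrow> bool" where
  "transverse_measure H T m \<alpha> C \<mu> \<nu> \<longleftrightarrow>
     sets \<nu> = sets (restrict_space \<mu> C) \<and>
     (\<forall>f :: 'h \<times> 's \<Rightarrow> real.
        f \<in> borel_measurable (borel_of T \<Otimes>\<^sub>M \<nu>) \<longrightarrow>
        (\<exists>B. \<forall>p \<in> carrier H \<times> C. 0 \<le> f p \<and> f p \<le> B) \<longrightarrow>
        (\<integral>\<^sup>+ s. (\<integral>\<^sup>+ h. ennreal (f (inv\<^bsub>H\<^esub> h, \<alpha> h s)) \<partial>count_space (hitting_set H \<alpha> C s)) \<partial>\<mu>)
        = (\<integral>\<^sup>+ h. (\<integral>\<^sup>+ t. ennreal (f (h, t)) \<partial>\<nu>) \<partial>m))"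


section \<open>Commensurability\<close>

definition product_space :: "nat \<Rightarrow> (nat \<Rightarrow> 's topology) \<Rightarrow> (nat \<Rightarrow> 's) topology" where
  "product_space r X = product_topology X {1..r}"

definition power_group :: "nat \<Rightarrow> 'g monoid \<Rightarrow> (nat \<Rightarrow> 'g) monoid" where
  "power_group r G = product_group {1..r} (\<lambda>_. G)"

definition product_action ::
    "nat \<Rightarrow> (nat \<Rightarrow> 's topology) \<Rightarrow> (nat \<Rightarrow> 'g \<Rightarrow> 's \<Rightarrow> 's) \<Rightarrow> (nat \<Rightarrow> 'g) \<Rightarrow> (nat \<Rightarrow> 's) \<Rightarrow> (nat \<Rightarrow> 's)"
  where
  "product_action r X \<alpha> g = (\<lambda>x\<in>topspace (product_space r X). \<lambda>k\<in>{1..r}. \<alpha> k (g k) (x k))"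

definition coordinate_kernel :: "nat \<Rightarrow> 'g monoid \<Rightarrow> nat \<Rightarrow> (nat \<Rightarrow> 'g) set" where
  "coordinate_kernel r G k = kernel (power_group r G) G (\<lambda>g. g k)"

text \<open>The set \<open>X\<^sup>[\<^sup>r\<^sup>]\<close>: tuples some diagonal translate of which lies in the product of the \<open>Z k\<close>.\<close>

definition simultaneous_hitting ::
    "nat \<Rightarrow> 'g monoid \<Rightarrow> (nat \<Rightarrow> 's topology) \<Rightarrow> (nat \<Rightarrow> 'g \<Rightarrow> 's \<Rightarrow> 's) \<Rightarrow> (nat \<Rightarrow> 's set) \<Rightarrow>
     (nat \<Rightarrow> 's) set" where
  "simultaneous_hitting r G X \<alpha> Z =
     {x \<in> topspace (product_space r X). \<exists>g\<in>carrier G. \<forall>k\<in>{1..r}. \<alpha> k g (x k) \<in> Z k}"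

definition commensurable ::
    "nat \<Rightarrow> 'g monoid \<Rightarrow> 'g topology \<Rightarrow> (nat \<Rightarrow> 's topology) \<Rightarrow> (nat \<Rightarrow> 'g \<Rightarrow> 's \<Rightarrow> 's) \<Rightarrow>
     (nat \<Rightarrow> 's set) \<Rightarrow> bool" where
  "commensurable r G T X \<alpha> Z \<longleftrightarrow>
     (\<forall>k\<in>{1..r}.
        separated_cross_section
          ((power_group r G) \<lparr>carrier := coordinate_kernel r G k\<rparr>)
          (subtopology (product_topology (\<lambda>_. T) {1..r}) (coordinate_kernel r G k))
          (borel_of (product_space r X))
          (product_action r X \<alpha>)
          (simultaneous_hitting r G X \<alpha> Z))"


section \<open>Convenient sequences and lower density\<close>

definition inner_part :: "'g monoid \<Rightarrow> 'g set \<Rightarrow> 'g set \<Rightarrow> 'g set" where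
  "inner_part G V B = (\<Inter>v\<in>V. (inv\<^bsub>G\<^esub> v) <#\<^bsub>G\<^esub> B)"

definition outer_part :: "'g monoid \<Rightarrow> 'g set \<Rightarrow> 'g set \<Rightarrow> 'g set" where
  "outer_part G V B = (\<Union>v\<in>V. (inv\<^bsub>G\<^esub> v) <#\<^bsub>G\<^esub> B)"

text \<open>Families indexed by real \<open>t > 0\<close> are total functions on the reals whose values at
  \<open>t \<le> 0\<close> are unconstrained. Such values can occur in the inclusions below when
  \<open>t - \<delta> n \<le> 0\<close>, but they are irrelevant: every \<open>\<tau> n\<close> may be enlarged to exceed \<open>\<delta> n\<close>.\<close>

definition convenient_growth ::
    "'g monoid \<Rightarrow> 'g topology \<Rightarrow> 'g measure \<Rightarrow> (nat \<Rightarrow> 'g set) \<Rightarrow> (real \<Rightarrow> 'g set) \<Rightarrow> bool" where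
  "convenient_growth G T m V F \<longleftrightarrow>
     (\<exists>(\<delta> :: nat \<Rightarrow> real) (\<epsilon> :: nat \<Rightarrow> real) (\<tau> :: nat \<Rightarrow> real).
        (\<forall>n. 0 < \<delta> n \<and> 0 < \<epsilon> n \<and> 0 < \<tau> n) \<and>
        \<delta> \<longlonglongrightarrow> 0 \<and> \<epsilon> \<longlonglongrightarrow> 0 \<and>
        (\<forall>n.
          (\<forall>t > \<tau> n. F (t - \<delta> n) \<subseteq> inner_part G (V n) (F t) \<and>
                     inner_part G (V n) (F t) \<subseteq> outer_part G (V n) (F t) \<and>
                     outer_part G (V n) (F t) \<subseteq> F (t + \<delta> n)) \<and>
          ereal (1 - \<epsilon> n) \<le> Liminf at_top (\<lambda>t. ereal (measure m (F (t - \<delta> n)) / measure m (F t))) \<and>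
          Limsup at_top (\<lambda>t. ereal (measure m (F (t + \<delta> n)) / measure m (F t))) \<le> ereal (1 + \<epsilon> n)))"

definition ergodic_average ::
    "'g measure \<Rightarrow> (real \<Rightarrow> 'g set) \<Rightarrow> ('g \<Rightarrow> 's \<Rightarrow> 's) \<Rightarrow> ('s \<Rightarrow> real) \<Rightarrow> 's \<Rightarrow> real \<Rightarrow> real" where
  "ergodic_average m F \<alpha> f x t = (1 / measure m (F t)) * (LINT g:F t|m. f (\<alpha> g x))"

definition convergence_set ::
    "'s measure \<Rightarrow> 'g measure \<Rightarrow> (real \<Rightarrow> 'g set) \<Rightarrow> ('g \<Rightarrow> 's \<Rightarrow> 's) \<Rightarrow> ('s \<Rightarrow> real) \<Rightarrow> 's set" where
  "convergence_set M m F \<alpha> f =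
     {x \<in> space M. \<exists>l. (ergodic_average m F \<alpha> f x \<longlongrightarrow> l) at_top}"

definition limit_average ::
    "'g measure \<Rightarrow> (real \<Rightarrow> 'g set) \<Rightarrow> ('g \<Rightarrow> 's \<Rightarrow> 's) \<Rightarrow> ('s \<Rightarrow> real) \<Rightarrow> 's \<Rightarrow> real" where
  "limit_average m F \<alpha> f x = Lim at_top (ergodic_average m F \<alpha> f x)"

text \<open>Quantification over all standard Borel \<open>G\<close>-spaces cannot range over types. A standard Borel
  space has at most continuum many points, so up to isomorphism its underlying set is a subset
  of \<open>real\<close>; \<open>M\<close> below is an arbitrary such structure, unrelated to the usual topology and order
  of the real line.\<close>

definition convenient_ergodicity ::
    "'g monoid \<Rightarrow> 'g topology \<Rightarrow> 'g measure \<Rightarrow> (real \<Rightarrow> 'g set) \<Rightarrow> bool" where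
  "convenient_ergodicity G T m F \<longleftrightarrow>
     (\<forall>(M :: real measure) \<alpha> (f :: real \<Rightarrow> real).
        standard_borel M \<longrightarrow> borel_action G T M \<alpha> \<longrightarrow>
        f \<in> borel_measurable M \<longrightarrow> (\<exists>B. \<forall>x\<in>space M. \<bar>f x\<bar> \<le> B) \<longrightarrow>
          convergence_set M m F \<alpha> f \<in> sets M \<and>
          limit_average m F \<alpha> f \<in> borel_measurable (restrict_space M (convergence_set M m F \<alpha> f)) \<and>
          (\<forall>\<mu>. sets \<mu> = sets M \<longrightarrow> finite_measure \<mu> \<longrightarrow> invariant_measure G \<alpha> \<mu> \<longrightarrow>
               emeasure \<mu> (space M - convergence_set M m F \<alpha> f) = 0) \<and>
          (\<forall>\<mu>. sets \<mu> = sets M \<longrightarrow> prob_space \<mu> \<longrightarrow> invariant_measure G \<alpha> \<mu> \<longrightarrow>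
               ergodic_measure G \<alpha> \<mu> \<longrightarrow>
               (\<exists>E\<in>sets M. E \<subseteq> convergence_set M m F \<alpha> f \<and> invariant_set G \<alpha> E \<and>
                  emeasure \<mu> (space M - E) = 0 \<and>
                  (\<forall>x\<in>E. limit_average m F \<alpha> f x = (LINT y|\<mu>. f y)))))"

definition convenient_sequence ::
    "'g monoid \<Rightarrow> 'g topology \<Rightarrow> 'g measure \<Rightarrow> (real \<Rightarrow> 'g set) \<Rightarrow> bool" where
  "convenient_sequence G T m F \<longleftrightarrow>
     (\<forall>t>0. F t \<in> sets (borel_of T) \<and> compactin T (T closure_of F t) \<and> 0 < emeasure m (F t)) \<and>
     (\<exists>V. decseq V \<and> (\<forall>n. openin T (V n) \<and> \<one>\<^bsub>G\<^esub> \<in> V n) \<and> convenient_growth G T m V F) \<and>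
     convenient_ergodicity G T m F"

text \<open>Computed in \<open>[0,\<infinity>]\<close>, so that an infinite intersection counts as \<open>\<infinity>\<close> rather than \<open>0\<close>.\<close>

definition lower_density :: "'g measure \<Rightarrow> (real \<Rightarrow> 'g set) \<Rightarrow> 'g set \<Rightarrow> ennreal" where
  "lower_density m F A =
     Liminf at_top (\<lambda>t. emeasure (count_space UNIV) (A \<inter> F t) / emeasure m (F t))"

end

theory Submission imports Defs begin

text \<open>The density of common return times is bounded below by an ergodic average. Let \<open>Q\<close> be a compact
  subset of \<open>Z\<^sub>1 \<times> \<dots> \<times> Z\<^sub>r\<close>, let \<open>L\<close> be a small compact identity neighbourhood, and put \<open>D = L\<^sup>-\<^sup>1 Q\<close>. If
  \<open>g z \<in> D\<close> for the diagonal action, then \<open>g \<in> L a\<close> for some \<open>a\<close> in the intersection of the hitting sets,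
  so if the averages of the indicator of \<open>D\<close> at \<open>z\<close> have a positive limit, then that intersection has
  positive lower density.

  Suppose that the averages fail to have a positive limit on a subset of \<open>Q\<close> of positive
  \<open>\<nu>\<^sub>1 \<otimes> \<dots> \<otimes> \<nu>\<^sub>r\<close>-measure; shrink it to a compact set \<open>K\<close>. By commensurability the set of points with
  a common return time is a separated cross section for the kernel \<open>N\<^sub>1\<close>. The corresponding transverse
  measure of \<open>\<mu>\<^sub>1 \<otimes> \<dots> \<otimes> \<mu>\<^sub>r\<close> is a finite measure, invariant under the diagonal action because \<open>G\<close> is
  unimodular and normalises \<open>N\<^sub>1\<close>, and it charges the orbit of \<open>K\<close>. Hence some ergodic invariant
  probability measure \<open>\<rho>\<close> charges this orbit too. Countably many translates of \<open>D\<close> cover the orbit, so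
  \<open>\<rho> D > 0\<close>, and the points of the orbit that are generic for \<open>\<rho>\<close> have the positive limit average \<open>\<rho> D\<close>.
  This contradicts the choice of \<open>K\<close>.

  The ergodic decomposition is not needed for the existence of \<open>\<rho>\<close>: after an equivariant Borel embedding
  into a Cantor space it is found as an extreme point of a compact set of measures.\<close>

section \<open>Borel sets of topological spaces\<close>

text \<open>Moving a Borel set by a group yields in general only an analytic set. Measurability
  therefore dictates the shape of the proof: sets to be hit are closed, compact or F-sigma, and sets
  of times are compact or sigma-compact, so that return sets are closed or F-sigma. This is why
  compact sets \<open>Q\<close> and \<open>K\<close> stand in for the product of the
  \<open>Z k\<close>. That product is in general a null set for \<open>M\<close>. To pass from the
  \<open>\<nu> k\<close> to \<open>M\<close>, the set \<open>K\<close> is thickened by times in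
  \<open>P\<close>, independently in each coordinate, and the transverse identities give the
  thickening positive measure. A tuple of times \<open>g\<close> splits into the kernel part
  \<open>inv (g 1) \<otimes> g j\<close> and the diagonal translation by \<open>g 1\<close>, so the
  measure on the orbit sees the thickening. Diagonal invariance of that measure comes from comparing
  windows: translation by \<open>a\<close> conjugates the window of times in the kernel, which keeps
  its Haar measure, and two windows of equal Haar measure with unique returns see the same mass. The
  generic set of an ergodic measure is invariant, so a generic point on the orbit of
  \<open>K\<close> can be moved into \<open>K\<close>, where it is needed.\<close>

lemma space_borel_of [simp]: "space (borel_of T) = topspace T"
  by (simp add: borel_of_def space_measure_of_conv)

lemma sets_borel_of: "sets (borel_of T) = sigma_sets (topspace T) {U. openin T U}"
  unfolding borel_of_def by (rule sets_measure_of) (auto dest: openin_subset)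

lemma openin_borel_of: "openin T U \<Longrightarrow> U \<in> sets (borel_of T)"
  by (simp add: sets_borel_of)

lemma closedin_borel_of: "closedin T C \<Longrightarrow> C \<in> sets (borel_of T)"
  by (metis closedin_def double_diff openin_borel_of order_refl sets.compl_sets space_borel_of)

lemma fsigma_in_borel_of:
  assumes "fsigma_in T C"
  shows "C \<in> sets (borel_of T)"
proof -
  obtain \<U> where "countable \<U>" "\<U> \<subseteq> Collect (closedin T)" "\<Union>\<U> = C"
    using assms unfolding fsigma_in_def union_of_def by auto
  then show ?thesis
    using sets.countable_Union[of \<U> "borel_of T"] closedin_borel_of by blast
qed

lemma compactin_borel_of: "Hausdorff_space T \<Longrightarrow> compactin T C \<Longrightarrow> C \<in> sets (borel_of T)"
  by (simp add: closedin_borel_of compactin_imp_closedin)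

text \<open>Closed generators suit the later arguments: a compact set of times hits a closed set in
  a closed set, so measurability and equality of measures are checked on closed sets.\<close>

lemma sets_borel_of_closedin: "sets (borel_of T) = sigma_sets (topspace T) {C. closedin T C}"
proof (rule antisym)
  show "sets (borel_of T) \<subseteq> sigma_sets (topspace T) {C. closedin T C}"
    unfolding sets_borel_of
  proof (rule sigma_sets_mono, rule subsetI)
    fix U assume "U \<in> {U. openin T U}"
    then have "U = topspace T - (topspace T - U)" "closedin T (topspace T - U)"
      by (auto dest: openin_subset)
    then show "U \<in> sigma_sets (topspace T) {C. closedin T C}"
      by (metis mem_Collect_eq sigma_sets.Basic sigma_sets.Compl)
  qed
  show "sigma_sets (topspace T) {C. closedin T C} \<subseteq> sets (borel_of T)"
    using sets.sigma_sets_subset[of "{C. closedin T C}" "borel_of T"] closedin_borel_of by auto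
qed

lemma measurable_borel_ofI:
  assumes "f \<in> space M \<rightarrow> topspace T"
    and "\<And>U. openin T U \<Longrightarrow> f -` U \<inter> space M \<in> sets M"
  shows "f \<in> M \<rightarrow>\<^sub>M borel_of T"
  unfolding borel_of_def by (rule measurable_sigma_sets) (use assms in \<open>auto simp: sets_measure_of_conv dest: openin_subset\<close>)

lemma continuous_map_measurable:
  assumes "continuous_map S T f"
  shows "f \<in> borel_of S \<rightarrow>\<^sub>M borel_of T"
proof (rule measurable_borel_ofI)
  show "f \<in> space (borel_of S) \<rightarrow> topspace T"
    using assms by (auto simp: continuous_map_def)
  show "f -` U \<inter> space (borel_of S) \<in> sets (borel_of S)" if "openin T U" for U
    using openin_continuous_map_preimage[OF assms that]
    by (auto intro!: openin_borel_of simp: vimage_def Int_def conj_commute)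
qed

text \<open>Projection along a compact factor is a closed map. This is the source of the
  measurability of return sets below; the projection of an arbitrary Borel set is only
  analytic.\<close>

lemma closed_projection:
  assumes U: "compactin S U" and C: "closedin (prod_topology S Y) C"
  shows "closedin Y {y. \<exists>n\<in>U. (n, y) \<in> C}"
proof -
  have "closed_map (prod_topology (subtopology S U) Y) Y snd"
    by (rule closed_map_snd) (use U compactin_subspace in blast)
  moreover have "prod_topology (subtopology S U) Y = subtopology (prod_topology S Y) (U \<times> topspace Y)"
    by (metis prod_topology_subtopology(1) subtopology_Times subtopology_topspace)
  moreover have "closedin (subtopology (prod_topology S Y) (U \<times> topspace Y)) (C \<inter> (U \<times> topspace Y))"
    by (metis C closedin_subtopology)
  ultimately have "closedin Y (snd ` (C \<inter> (U \<times> topspace Y)))"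
    by (auto simp: closed_map_def)
  moreover have "snd ` (C \<inter> (U \<times> topspace Y)) = {y. \<exists>n\<in>U. (n, y) \<in> C}"
    using closedin_subset[OF C] by (force simp: image_iff)
  ultimately show ?thesis by simp
qed

section \<open>Countable bases and the Borel sets of products\<close>

lemma second_countableE:
  assumes "second_countable X"
  obtains \<B> where "countable \<B>" "\<And>V. V \<in> \<B> \<Longrightarrow> openin X V"
    "\<And>U x. openin X U \<Longrightarrow> x \<in> U \<Longrightarrow> \<exists>V\<in>\<B>. x \<in> V \<and> V \<subseteq> U"
proof -
  obtain \<B> where B: "countable \<B> \<and> (\<forall>V \<in> \<B>. openin X V) \<and>
      (\<forall>U x. openin X U \<and> x \<in> U \<longrightarrow> (\<exists>V \<in> \<B>. x \<in> V \<and> V \<subseteq> U))"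
    using assms unfolding second_countable_def ..
  show ?thesis
    by (rule that[of \<B>]) (use B in auto)
qed

lemma prod_topology_countable_base:
  assumes "second_countable S" "second_countable T"
  obtains \<B> where "countable \<B>" "\<And>V. V \<in> \<B> \<Longrightarrow> \<exists>A B. V = A \<times> B \<and> openin S A \<and> openin T B"
    "\<And>U x. openin (prod_topology S T) U \<Longrightarrow> x \<in> U \<Longrightarrow> \<exists>V\<in>\<B>. x \<in> V \<and> V \<subseteq> U"
proof -
  obtain BS where BS: "countable BS" "\<And>V. V \<in> BS \<Longrightarrow> openin S V"
    "\<And>U x. openin S U \<Longrightarrow> x \<in> U \<Longrightarrow> \<exists>V\<in>BS. x \<in> V \<and> V \<subseteq> U"
    using assms(1) by (rule second_countableE) (rule that)
  obtain BT where BT: "countable BT" "\<And>V. V \<in> BT \<Longrightarrow> openin T V"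
    "\<And>U x. openin T U \<Longrightarrow> x \<in> U \<Longrightarrow> \<exists>V\<in>BT. x \<in> V \<and> V \<subseteq> U"
    using assms(2) by (rule second_countableE) (rule that)
  show ?thesis
  proof (rule that[of "(\<lambda>(A, B). A \<times> B) ` (BS \<times> BT)"])
    show "countable ((\<lambda>(A, B). A \<times> B) ` (BS \<times> BT))"
      using BS BT by auto
    show "\<And>V. V \<in> (\<lambda>(A, B). A \<times> B) ` (BS \<times> BT) \<Longrightarrow> \<exists>A B. V = A \<times> B \<and> openin S A \<and> openin T B"
    proof -
      fix V assume "V \<in> (\<lambda>(A, B). A \<times> B) ` (BS \<times> BT)"
      then obtain A B where "V = A \<times> B" "A \<in> BS" "B \<in> BT" by auto
      then show "\<exists>A B. V = A \<times> B \<and> openin S A \<and> openin T B"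
        using BS(2) BT(2) by blast
    qed
    fix U x assume U: "openin (prod_topology S T) U" "x \<in> U"
    obtain a b where x: "x = (a, b)" by (cases x)
    obtain A B where AB: "openin S A" "openin T B" "a \<in> A" "b \<in> B" "A \<times> B \<subseteq> U"
      using U(1)[unfolded openin_prod_topology_alt, rule_format, of a b] U(2) x by auto
    obtain A' where "A' \<in> BS" "a \<in> A'" "A' \<subseteq> A" using BS(3)[OF AB(1,3)] by auto
    moreover obtain B' where "B' \<in> BT" "b \<in> B'" "B' \<subseteq> B" using BT(3)[OF AB(2,4)] by auto
    ultimately show "\<exists>V\<in>(\<lambda>(A, B). A \<times> B) ` (BS \<times> BT). x \<in> V \<and> V \<subseteq> U"
      using AB(5) x by (intro bexI[of _ "A' \<times> B'"]) auto
  qed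
qed

lemma open_countable_Union:
  assumes "countable \<B>" "\<And>x. x \<in> U \<Longrightarrow> \<exists>V\<in>\<B>. x \<in> V \<and> V \<subseteq> U"
  shows "countable {V\<in>\<B>. V \<subseteq> U}" "U = \<Union>{V\<in>\<B>. V \<subseteq> U}"
  using assms by auto

lemma sets_subset_of_measurable_ident:
  assumes "(\<lambda>x. x) \<in> M \<rightarrow>\<^sub>M N" "space M = space N"
  shows "sets N \<subseteq> sets M"
proof
  fix A assume A: "A \<in> sets N"
  then have "(\<lambda>x. x) -` A \<inter> space M = A"
    using sets.sets_into_space[OF A] assms(2) by auto
  then show "A \<in> sets M"
    using measurable_sets[OF assms(1) A] by simp
qed

text \<open>Second countability makes every open set a countable union of open rectangles; the
  reverse inclusion is the continuity of the two projections.\<close>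

lemma sets_borel_of_prod:
  assumes S: "second_countable S" and T: "second_countable T"
  shows "sets (borel_of (prod_topology S T)) = sets (borel_of S \<Otimes>\<^sub>M borel_of T)"
proof (rule antisym)
  obtain \<B> where B: "countable \<B>" "\<And>V. V \<in> \<B> \<Longrightarrow> \<exists>A B. V = A \<times> B \<and> openin S A \<and> openin T B"
    "\<And>U x. openin (prod_topology S T) U \<Longrightarrow> x \<in> U \<Longrightarrow> \<exists>V\<in>\<B>. x \<in> V \<and> V \<subseteq> U"
    by (rule prod_topology_countable_base[OF S T]) (rule that)
  have sp: "space (borel_of S \<Otimes>\<^sub>M borel_of T) = topspace (prod_topology S T)"
    by (simp add: space_pair_measure)
  show "sets (borel_of (prod_topology S T)) \<subseteq> sets (borel_of S \<Otimes>\<^sub>M borel_of T)"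
    unfolding sets_borel_of sp[symmetric]
  proof (rule sets.sigma_sets_subset, clarify)
    fix U assume U: "openin (prod_topology S T) U"
    show "U \<in> sets (borel_of S \<Otimes>\<^sub>M borel_of T)"
    proof (subst open_countable_Union(2)[OF B(1) B(3)[OF U]], assumption, rule sets.countable_Union)
      show "{V \<in> \<B>. V \<subseteq> U} \<subseteq> sets (borel_of S \<Otimes>\<^sub>M borel_of T)"
        using B(2) by (auto intro!: pair_measureI openin_borel_of)
    qed (use B in auto)
  qed
  have "(\<lambda>x. x) \<in> borel_of (prod_topology S T) \<rightarrow>\<^sub>M borel_of S \<Otimes>\<^sub>M borel_of T"
    by (rule measurable_pair)
      (use continuous_map_measurable[OF continuous_map_fst] continuous_map_measurable[OF continuous_map_snd]
        in \<open>auto simp: comp_def\<close>)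
  then show "sets (borel_of S \<Otimes>\<^sub>M borel_of T) \<subseteq> sets (borel_of (prod_topology S T))"
    by (rule sets_subset_of_measurable_ident) (simp add: space_pair_measure)
qed

lemma product_topology_countable_base:
  assumes fin: "finite I" and sc: "\<And>i. i \<in> I \<Longrightarrow> second_countable (X i)"
  obtains \<B> where "countable \<B>" "\<And>V. V \<in> \<B> \<Longrightarrow> \<exists>A. V = Pi\<^sub>E I A \<and> (\<forall>i\<in>I. openin (X i) (A i))"
    "\<And>U x. openin (product_topology X I) U \<Longrightarrow> x \<in> U \<Longrightarrow> \<exists>V\<in>\<B>. x \<in> V \<and> V \<subseteq> U"
proof -
  have "\<forall>i\<in>I. \<exists>B. countable B \<and> (\<forall>V\<in>B. openin (X i) V) \<and>
      (\<forall>U x. openin (X i) U \<and> x \<in> U \<longrightarrow> (\<exists>V\<in>B. x \<in> V \<and> V \<subseteq> U))"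
    using sc unfolding second_countable_def by blast
  then obtain B where B: "\<And>i. i \<in> I \<Longrightarrow> countable (B i)" "\<And>i V. i \<in> I \<Longrightarrow> V \<in> B i \<Longrightarrow> openin (X i) V"
    "\<And>i U x. i \<in> I \<Longrightarrow> openin (X i) U \<Longrightarrow> x \<in> U \<Longrightarrow> \<exists>V\<in>B i. x \<in> V \<and> V \<subseteq> U"
    by metis
  show ?thesis
  proof (rule that[of "Pi\<^sub>E I ` (Pi\<^sub>E I B)"])
    show "countable (Pi\<^sub>E I ` Pi\<^sub>E I B)"
      using B(1) fin by (intro countable_image countable_PiE) auto
    show "\<And>V. V \<in> Pi\<^sub>E I ` Pi\<^sub>E I B \<Longrightarrow> \<exists>A. V = Pi\<^sub>E I A \<and> (\<forall>i\<in>I. openin (X i) (A i))"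
      using B(2) by (auto simp: PiE_iff)
    fix U x assume U: "openin (product_topology X I) U" "x \<in> U"
    obtain A where A: "\<forall>i\<in>I. openin (X i) (A i)" "x \<in> Pi\<^sub>E I A" "Pi\<^sub>E I A \<subseteq> U"
      using U unfolding openin_product_topology_alt by blast
    have "\<forall>i\<in>I. \<exists>V\<in>B i. x i \<in> V \<and> V \<subseteq> A i"
      using A B(3) by (auto simp: PiE_iff)
    then obtain V where V: "\<And>i. i \<in> I \<Longrightarrow> V i \<in> B i \<and> x i \<in> V i \<and> V i \<subseteq> A i" by metis
    have "Pi\<^sub>E I (restrict V I) \<subseteq> Pi\<^sub>E I A"
      using V by (intro PiE_mono) auto
    then have "Pi\<^sub>E I (restrict V I) \<subseteq> U"
      using A(3) by blast
    moreover have "x \<in> Pi\<^sub>E I (restrict V I)" using V A(2) by (auto simp: PiE_iff)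
    ultimately show "\<exists>V\<in>Pi\<^sub>E I ` Pi\<^sub>E I B. x \<in> V \<and> V \<subseteq> U"
      using V by (intro bexI[of _ "Pi\<^sub>E I (restrict V I)"]) auto
  qed
qed

lemma openin_PiE_finite:
  "finite I \<Longrightarrow> (\<And>i. i \<in> I \<Longrightarrow> openin (X i) (A i)) \<Longrightarrow> openin (product_topology X I) (Pi\<^sub>E I A)"
  by (simp add: openin_PiE_gen)

lemma second_countable_product_finite:
  assumes "finite I" "\<And>i. i \<in> I \<Longrightarrow> second_countable (X i)"
  shows "second_countable (product_topology X I)"
proof -
  obtain \<B> where B: "countable \<B>" "\<And>V. V \<in> \<B> \<Longrightarrow> \<exists>A. V = Pi\<^sub>E I A \<and> (\<forall>i\<in>I. openin (X i) (A i))"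
    "\<And>U x. openin (product_topology X I) U \<Longrightarrow> x \<in> U \<Longrightarrow> \<exists>V\<in>\<B>. x \<in> V \<and> V \<subseteq> U"
    by (rule product_topology_countable_base[where X = X, OF assms]) (assumption, rule that)
  have "openin (product_topology X I) V" if "V \<in> \<B>" for V
    using B(2)[OF that] openin_PiE_finite[OF assms(1)] by auto
  then show ?thesis
    unfolding second_countable_def by (intro exI[of _ \<B>]) (use B in auto)
qed

lemma sets_borel_of_product:
  assumes fin: "finite I" and sc: "\<And>i. i \<in> I \<Longrightarrow> second_countable (X i)"
  shows "sets (borel_of (product_topology X I)) = sets (PiM I (\<lambda>i. borel_of (X i)))"
proof (rule antisym)
  obtain \<B> where B: "countable \<B>" "\<And>V. V \<in> \<B> \<Longrightarrow> \<exists>A. V = Pi\<^sub>E I A \<and> (\<forall>i\<in>I. openin (X i) (A i))"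
    "\<And>U x. openin (product_topology X I) U \<Longrightarrow> x \<in> U \<Longrightarrow> \<exists>V\<in>\<B>. x \<in> V \<and> V \<subseteq> U"
    by (rule product_topology_countable_base[where X = X, OF assms]) (assumption, rule that)
  have sp: "space (PiM I (\<lambda>i. borel_of (X i))) = topspace (product_topology X I)"
    by (simp add: space_PiM)
  show "sets (borel_of (product_topology X I)) \<subseteq> sets (PiM I (\<lambda>i. borel_of (X i)))"
    unfolding sets_borel_of[of "product_topology X I"] sp[symmetric]
  proof (rule sets.sigma_sets_subset, clarify)
    fix U assume U: "openin (product_topology X I) U"
    have V: "V \<in> sets (PiM I (\<lambda>i. borel_of (X i)))" if W: "V \<in> \<B>" for V
    proof -
      obtain A where A: "V = Pi\<^sub>E I A" "\<forall>i\<in>I. openin (X i) (A i)"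
        using B(2)[OF W] by auto
      show ?thesis
        unfolding A(1) by (rule sets_PiM_I_finite[OF fin]) (use A(2) openin_borel_of in auto)
    qed
    have "\<Union>{V\<in>\<B>. V \<subseteq> U} \<in> sets (PiM I (\<lambda>i. borel_of (X i)))"
      by (rule sets.countable_Union) (use B(1) V in auto)
    then show "U \<in> sets (PiM I (\<lambda>i. borel_of (X i)))"
      by (simp only: open_countable_Union(2)[OF B(1) B(3)[OF U], symmetric])
  qed
  have "(\<lambda>x. x) \<in> borel_of (product_topology X I) \<rightarrow>\<^sub>M PiM I (\<lambda>i. borel_of (X i))"
  proof (rule measurable_PiM_single')
    show "(\<lambda>x. x i) \<in> borel_of (product_topology X I) \<rightarrow>\<^sub>M borel_of (X i)" if "i \<in> I" for i
      by (rule continuous_map_measurable, rule continuous_map_product_projection, rule that)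
  qed simp
  then show "sets (PiM I (\<lambda>i. borel_of (X i))) \<subseteq> sets (borel_of (product_topology X I))"
    by (rule sets_subset_of_measurable_ident) (simp add: space_PiM)
qed

lemma polish_space_product:
  assumes "finite I" "\<And>i. i \<in> I \<Longrightarrow> polish_space (X i)"
  shows "polish_space (product_topology X I)"
proof -
  have "countable {i \<in> I. \<nexists>a. topspace (X i) \<subseteq> {a}}"
    using assms(1) by (simp add: countable_finite)
  then show ?thesis
    using assms second_countable_product_finite[of I X] unfolding polish_space_def
    by (simp add: completely_metrizable_space_product_topology)
qed

lemma polish_imp_Hausdorff: "polish_space X \<Longrightarrow> Hausdorff_space X"
  by (simp add: polish_space_def completely_metrizable_imp_metrizable_space metrizable_imp_Hausdorff_space)

lemma countable_closure_dense:
  assumes "second_countable X"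
  obtains C where "countable C" "C \<subseteq> topspace X" "\<And>U. openin X U \<Longrightarrow> U \<noteq> {} \<Longrightarrow> C \<inter> U \<noteq> {}"
  using second_countable_imp_separable_space[OF assms] unfolding separable_space_def
  by (metis Int_commute dense_intersects_open)

section \<open>Polish spaces\<close>

text \<open>The conditions single out the distance functions of points among all functions on a
  dense sequence: indices at which \<open>y\<close> is small select a Cauchy subsequence of
  \<open>a\<close>, and the limit of that subsequence is the point.\<close>

lemma (in Metric_space) point_of_approximate_distances:
  fixes y :: "nat \<Rightarrow> real"
  assumes complete: mcomplete
    and a: "range a \<subseteq> M"
    and small: "\<And>e. e > 0 \<Longrightarrow> \<exists>n. y n < e"
    and upper: "\<And>n n'. y n \<le> y n' + d (a n) (a n')"
    and lower: "\<And>n n'. d (a n) (a n') \<le> y n + y n'"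
  shows "\<exists>x\<in>M. \<forall>n. y n = d x (a n)"
proof -
  \<comment> \<open>The factor 2 is chosen so that two of these errors add up to
    \<open>1 / Suc k\<close>.\<close>
  define h :: "nat \<Rightarrow> real" where "h k = 1 / (2 * real (Suc k))" for k
  have h2: "h k + h k = 1 / real (Suc k)" for k by (simp add: h_def field_simps)
  have "\<exists>f. \<forall>k. y (f k) < h k"
    using small by (intro choice allI) (auto simp: h_def)
  then obtain f where f: "\<And>k. y (f k) < h k" by blast
  have am: "a n \<in> M" for n using a by auto
  have dist: "d (a (f j)) (a (f k)) \<le> h j + h k" for j k
    using lower[of "f j" "f k"] f[of j] f[of k] by linarith
  have "MCauchy (a \<circ> f)"
    unfolding MCauchy_def
  proof (intro conjI allI impI)
    fix e :: real assume "e > 0"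
    then obtain N where N: "1 / real (Suc N) < e"
      using nat_approx_posE by blast
    have "d (a (f j)) (a (f k)) < e" if "N \<le> j" "N \<le> k" for j k
    proof -
      have "h j \<le> h N" "h k \<le> h N"
        using that unfolding h_def by (intro divide_left_mono; simp)+
      then show ?thesis using dist[of j k] N h2[of N] by linarith
    qed
    then show "\<exists>N. \<forall>n n'. N \<le> n \<longrightarrow> N \<le> n' \<longrightarrow> d ((a \<circ> f) n) ((a \<circ> f) n') < e"
      by auto
  qed (use a in auto)
  then obtain x where x: "limitin mtopology (a \<circ> f) x sequentially"
    using complete unfolding mcomplete_def by blast
  then have xM: "x \<in> M" by (metis limitin_mspace)
  \<comment> \<open>The index has to be good in both respects at once: its point is near
    \<open>x\<close> and its value of \<open>y\<close> is small.\<close>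
  have ev: "\<exists>k. d x (a (f k)) < e \<and> y (f k) < e" if pos: "e > 0" for e
  proof -
    obtain N where "\<forall>n\<ge>N. (a \<circ> f) n \<in> M \<and> d ((a \<circ> f) n) x < e"
      using x pos unfolding limit_metric_sequentially by meson
    then have N: "\<And>n. n \<ge> N \<Longrightarrow> d (a (f n)) x < e" by simp
    obtain K where K: "1 / real (Suc K) < e"
      using nat_approx_posE pos by blast
    have "h (N + K) \<le> 1 / real (Suc K)"
      unfolding h_def by (rule divide_left_mono) auto
    then have "y (f (N + K)) < e"
      using f[of "N + K"] K by linarith
    then show ?thesis using N[of "N + K"] commute by auto
  qed
  have "y n = d x (a n)" for n
  proof (rule antisym)
    show "y n \<le> d x (a n)"
    proof (rule field_le_epsilon)
      fix e :: real assume "e > 0"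
      then obtain k where k: "d x (a (f k)) < e / 2" "y (f k) < e / 2" using ev[of "e / 2"] by auto
      have "y n \<le> y (f k) + d (a n) (a (f k))" by (rule upper)
      also have "d (a n) (a (f k)) \<le> d x (a n) + d x (a (f k))"
        using triangle[OF am[of n] xM am[of "f k"]] by (simp add: commute)
      finally show "y n \<le> d x (a n) + e" using k by linarith
    qed
    show "d x (a n) \<le> y n"
    proof (rule field_le_epsilon)
      fix e :: real assume "e > 0"
      then obtain k where k: "d x (a (f k)) < e / 2" "y (f k) < e / 2" using ev[of "e / 2"] by auto
      have "d x (a n) \<le> d x (a (f k)) + d (a (f k)) (a n)"
        by (rule triangle[OF xM am am])
      also have "d (a (f k)) (a n) \<le> y (f k) + y n" by (rule lower)
      finally show "d x (a n) \<le> y n + e" using k by linarith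
    qed
  qed
  with xM show ?thesis by auto
qed

text \<open>The embedding is by the distances to a dense sequence.\<close>

lemma measurable_into_product:
  fixes f :: "'a \<Rightarrow> nat \<Rightarrow> real"
  assumes "\<And>n. (\<lambda>x. f x n) \<in> borel_measurable M"
  shows "f \<in> borel_measurable M"
proof -
  have "f \<in> M \<rightarrow>\<^sub>M PiM UNIV (\<lambda>_. borel)"
    by (rule measurable_PiM_single') (use assms in auto)
  then show ?thesis by (simp add: sets_PiM_equal_borel cong: measurable_cong_sets)
qed

text \<open>The map \<open>v\<close> decodes \<open>u\<close>. On the image of \<open>u\<close> it
  is continuous, because membership in an open set is witnessed by a ball
  \<open>mball (a n) q\<close>, which is an open condition on one coordinate; hence compact subsets
  of the image come from compact subsets of \<open>X\<close>.\<close>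

lemma polish_space_embedding:
  assumes X: "polish_space X" and ne: "topspace X \<noteq> {}"
  obtains u :: "'a \<Rightarrow> nat \<Rightarrow> real" and v :: "(nat \<Rightarrow> real) \<Rightarrow> 'a" where
    "u \<in> borel_measurable (borel_of X)" "v \<in> borel \<rightarrow>\<^sub>M borel_of X"
    "\<And>x. x \<in> topspace X \<Longrightarrow> v (u x) = x" "\<And>x n. x \<in> topspace X \<Longrightarrow> 0 \<le> u x n"
    "u ` topspace X \<in> sets borel"
    "\<And>K. compact K \<Longrightarrow> K \<subseteq> u ` topspace X \<Longrightarrow> compactin X {x\<in>topspace X. u x \<in> K}"
proof -
  obtain M d where "Metric_space M d" and complete: "Metric_space.mcomplete M d"
    and Xd: "X = Metric_space.mtopology M d"
    using X unfolding polish_space_def completely_metrizable_space_def by auto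
  interpret Metric_space M d by fact
  have [simp]: "topspace X = M" by (simp add: Xd)
  obtain C where C: "countable C" "C \<subseteq> topspace X" "\<And>U. openin X U \<Longrightarrow> U \<noteq> {} \<Longrightarrow> C \<inter> U \<noteq> {}"
    using countable_closure_dense X unfolding polish_space_def by metis
  have "C \<noteq> {}" using C(3)[OF openin_topspace ne] by auto
  then obtain a :: "nat \<Rightarrow> 'a" where a: "range a = C"
    using C(1) by (metis range_from_nat_into)
  have aM: "a n \<in> M" for n using a C(2) by auto
  have dense: "\<exists>n. d x (a n) < e" if "x \<in> M" "e > 0" for x e
    using C(3)[of "mball x e"] that a by (force simp: Xd)
  define u where "u x n = d x (a n)" for x n
  define R where "R = u ` M"
  obtain x0 where x0: "x0 \<in> M" using ne by auto
  have inj: "x = x'" if x: "x \<in> M" "x' \<in> M" "u x = u x'" for x x'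
  proof (rule ccontr)
    assume "x \<noteq> x'"
    then have "d x x' > 0" using x by simp
    then obtain n where n: "d x (a n) < d x x' / 2" using dense[OF x(1), of "d x x' / 2"] by auto
    moreover have "d x' (a n) < d x x' / 2" using n x(3) by (metis u_def)
    ultimately show False
      using triangle[OF x(1) aM[of n] x(2)] commute[of x' "a n"] by linarith
  qed
  \<comment> \<open>The image is cut out by countably many open and closed conditions on
    coordinates, which makes it Borel.\<close>
  have R_eq: "R = {y. (\<forall>k. \<exists>n. y n < 1 / Suc k) \<and> (\<forall>n n'. y n \<le> y n' + d (a n) (a n') \<and> d (a n) (a n') \<le> y n + y n')}"
    (is "R = ?R")
  proof (intro equalityI subsetI)
    fix y assume "y \<in> R"
    then obtain x where x: "x \<in> M" "y = u x" by (auto simp: R_def)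
    have "\<exists>n. y n < 1 / Suc k" for k using dense[OF x(1), of "1 / Suc k"] x(2) by (simp add: u_def)
    moreover have "y n \<le> y n' + d (a n) (a n')" "d (a n) (a n') \<le> y n + y n'" for n n'
      using triangle[OF x(1) aM[of n'] aM[of n]] triangle[OF aM[of n] x(1) aM[of n']] x(2)
      by (auto simp: u_def commute)
    ultimately show "y \<in> ?R" by auto
  next
    fix y assume y: "y \<in> ?R"
    have "\<exists>x\<in>M. \<forall>n. y n = d x (a n)"
    proof (rule point_of_approximate_distances[OF complete])
      show "\<exists>n. y n < e" if pos: "e > 0" for e
      proof -
        obtain k where "1 / Suc k < e" using nat_approx_posE[OF pos] by auto
        moreover obtain n where "y n < 1 / Suc k" using y by blast
        ultimately show ?thesis by (intro exI[of _ n]) linarith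
      qed
    qed (use y aM in auto)
    then show "y \<in> R" unfolding R_def u_def by (auto simp: image_iff fun_eq_iff)
  qed
  have o: "{y :: nat \<Rightarrow> real. y n < c} \<in> sets borel" for n c
    by (rule borel_open) (auto intro!: open_Collect_less)
  have c: "{y :: nat \<Rightarrow> real. y n \<le> y n' + c} \<inter> {y. c \<le> y n + y n'} \<in> sets borel" for n n' c
    by (rule borel_closed) (auto intro!: closed_Int closed_Collect_le continuous_on_add)
  have "(\<Inter>k. \<Union>n. {y :: nat \<Rightarrow> real. y n < 1 / Suc k}) \<inter>
      (\<Inter>n. \<Inter>n'. {y. y n \<le> y n' + d (a n) (a n')} \<inter> {y. d (a n) (a n') \<le> y n + y n'}) \<in> sets borel"
    by (intro sets.Int[OF sets.countable_INT'' sets.countable_INT''] sets.countable_INT'' sets.countable_UN c o)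
      (use o in auto)
  moreover have "R = (\<Inter>k. \<Union>n. {y. y n < 1 / Suc k}) \<inter>
      (\<Inter>n. \<Inter>n'. {y. y n \<le> y n' + d (a n) (a n')} \<inter> {y. d (a n) (a n') \<le> y n + y n'})"
    unfolding R_eq by auto
  ultimately have R: "R \<in> sets borel" by simp
  have key: "\<exists>W. open W \<and> (\<forall>x\<in>M. x \<in> U \<longleftrightarrow> u x \<in> W)" if U: "openin X U" for U
  proof -
    define W where "W = (\<Union>{{y :: nat \<Rightarrow> real. y n < q} | n q. mball (a n) q \<subseteq> U})"
    have "open {y :: nat \<Rightarrow> real. y n < q}" for n q
      by (rule open_Collect_less) auto
    then have "open W" unfolding W_def by auto
    moreover have "x \<in> U \<longleftrightarrow> u x \<in> W" if x: "x \<in> M" for x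
    proof
      assume "x \<in> U"
      then obtain r where r: "r > 0" "mball x r \<subseteq> U"
        using U unfolding Xd openin_mtopology by auto
      then obtain n where n: "d x (a n) < r / 2" using dense[OF x, of "r / 2"] by auto
      have "mball (a n) (r / 2) \<subseteq> U"
        using mball_subset[of "a n" x "r / 2" r] n r x by (auto simp: commute)
      then show "u x \<in> W" using n unfolding W_def u_def by blast
    next
      assume "u x \<in> W"
      then obtain n q where "d x (a n) < q" "mball (a n) q \<subseteq> U"
        unfolding W_def u_def by auto
      then show "x \<in> U" using x aM[of n] by (auto simp: commute subset_iff)
    qed
    ultimately show ?thesis by auto
  qed
  \<comment> \<open>Off the image \<open>v\<close> takes the constant value \<open>x0\<close>; since
    the image is Borel, this keeps \<open>v\<close> Borel on the whole space.\<close>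
  define v where "v y = (if y \<in> R then inv_into M u y else x0)" for y
  have inj_on: "inj_on u M" using inj by (auto simp: inj_on_def)
  have vu: "v (u x) = x" if "x \<in> M" for x
    using that inj_on by (simp add: v_def R_def)
  have vM: "v y \<in> M" for y using x0 by (auto simp: v_def R_def inv_into_into)
  have pre: "\<exists>W. open W \<and> (\<forall>y\<in>R. v y \<in> U \<longleftrightarrow> y \<in> W)" if U: "openin X U" for U
    using key[OF U] vu unfolding R_def by force
  show ?thesis
  proof (rule that[of u v])
    show "u \<in> borel_measurable (borel_of X)"
    proof (rule measurable_into_product)
      fix n
      have "{x \<in> space (borel_of X). u x n < q} = mball (a n) q" for q
        using aM by (auto simp: u_def commute)
      then show "(\<lambda>x. u x n) \<in> borel_measurable (borel_of X)"
        unfolding borel_measurable_iff_less using openin_borel_of[of X] by (simp add: Xd)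
    qed
    show "v \<in> borel \<rightarrow>\<^sub>M borel_of X"
    proof (rule measurable_borel_ofI)
      fix U assume "openin X U"
      then obtain W where W: "open W" "\<forall>y\<in>R. v y \<in> U \<longleftrightarrow> y \<in> W" using pre by blast
      have "y \<in> v -` U \<longleftrightarrow> y \<in> (R \<inter> W) \<union> (if x0 \<in> U then - R else {})" for y
        by (cases "y \<in> R") (use W(2) in \<open>simp, simp add: v_def\<close>)
      then have "v -` U \<inter> space borel = (R \<inter> W) \<union> (if x0 \<in> U then - R else {})"
        by auto
      also have "\<dots> \<in> sets borel" using R W(1) by auto
      finally show "v -` U \<inter> space borel \<in> sets borel" .
    qed (use vM in auto)
    show "compactin X {x \<in> topspace X. u x \<in> K}" if K: "compact K" "K \<subseteq> u ` topspace X" for K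
    proof -
      have "continuous_map (subtopology euclidean K) X v"
        unfolding continuous_map_def
      proof (intro conjI allI impI)
        fix U assume "openin X U"
        then obtain W where W: "open W" "\<forall>y\<in>R. v y \<in> U \<longleftrightarrow> y \<in> W" using pre by blast
        then have "{y \<in> topspace (subtopology euclidean K). v y \<in> U} = K \<inter> W"
          using K(2) by (auto simp: R_def)
        then show "openin (subtopology euclidean K) {y \<in> topspace (subtopology euclidean K). v y \<in> U}"
          using W(1) by auto
      qed (use vM in auto)
      moreover have "compactin (subtopology euclidean K) K"
        using K(1) by (simp add: compactin_subtopology)
      ultimately have "compactin X (v ` K)" by (rule image_compactin[rotated])
      moreover have "v ` K = {x \<in> topspace X. u x \<in> K}"
        using K(2) vu by force
      ultimately show ?thesis by simp
    qed
  qed (use vu R in \<open>auto simp: u_def R_def\<close>)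
qed

text \<open>Inner regularity on the Polish type \<open>nat \<Rightarrow> real\<close> is applied to
  the image measure \<open>N\<close>; compact subsets of \<open>C\<close> come back as compact
  subsets of \<open>B\<close> by the last property of the embedding.\<close>

lemma polish_inner_regular:
  assumes X: "polish_space X" and sets: "sets M = sets (borel_of X)" and fin: "finite_measure M"
    and B: "B \<in> sets M"
  shows "emeasure M B = (SUP K\<in>{K. K \<subseteq> B \<and> compactin X K}. emeasure M K)"
proof (cases "topspace X = {}")
  case True
  then have "B = {}" using B sets sets.sets_into_space by fastforce
  then show ?thesis by simp
next
  case False
  obtain u :: "'a \<Rightarrow> nat \<Rightarrow> real" and v :: "(nat \<Rightarrow> real) \<Rightarrow> 'a" where
    u: "u \<in> borel_measurable (borel_of X)" and v: "v \<in> borel \<rightarrow>\<^sub>M borel_of X"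
    and vu: "\<And>x. x \<in> topspace X \<Longrightarrow> v (u x) = x" "\<And>x n. x \<in> topspace X \<Longrightarrow> 0 \<le> u x n"
    and range: "u ` topspace X \<in> sets borel"
    and cpt: "\<And>K. compact K \<Longrightarrow> K \<subseteq> u ` topspace X \<Longrightarrow> compactin X {x\<in>topspace X. u x \<in> K}"
    by (rule polish_space_embedding[OF X False]) (rule that)
  have u': "u \<in> borel_measurable M" using u sets by (simp cong: measurable_cong_sets)
  have sp: "space M = topspace X" using sets_eq_imp_space_eq[OF sets] by simp
  interpret finite_measure M by fact
  define N where "N = distr M borel u"
  interpret N: finite_measure N unfolding N_def by (rule finite_measure_distr[OF u'])
  have BX: "B \<subseteq> topspace X" using sets.sets_into_space[OF B] sp by simp
  \<comment> \<open>This is the image of \<open>B\<close> under \<open>u\<close>, written through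
    the Borel map \<open>v\<close> so that it is visibly Borel.\<close>
  define C where "C = u ` topspace X \<inter> (v -` B \<inter> space borel)"
  have C: "C \<in> sets borel"
    unfolding C_def using range measurable_sets[OF v] B sets by (intro sets.Int) auto
  have em: "emeasure N A = emeasure M {x\<in>topspace X. u x \<in> A}" if "A \<in> sets borel" for A
    unfolding N_def by (subst emeasure_distr[OF u' that]) (simp add: sp vimage_def Int_def conj_commute)
  have "{x\<in>topspace X. u x \<in> C} = B" using BX vu by (auto simp: C_def image_iff) metis
  then have "emeasure M B = emeasure N C" by (simp add: em C)
  also have "\<dots> = (SUP K \<in> {K. K \<subseteq> C \<and> compact K}. emeasure N K)"
    using C by (intro inner_regular) (auto simp: N_def N.emeasure_finite[unfolded N_def])
  also have "\<dots> \<le> (SUP K\<in>{K. K \<subseteq> B \<and> compactin X K}. emeasure M K)"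
  proof (rule SUP_least, clarify)
    fix K assume K: "K \<subseteq> C" "compact K"
    have "emeasure N K = emeasure M {x\<in>topspace X. u x \<in> K}"
      by (rule em) (simp add: K(2) compact_imp_closed)
    also have "\<dots> \<le> (SUP K\<in>{K. K \<subseteq> B \<and> compactin X K}. emeasure M K)"
    proof (rule SUP_upper, intro CollectI conjI)
      show "{x \<in> topspace X. u x \<in> K} \<subseteq> B" using K(1) vu by (auto simp: C_def)
      show "compactin X {x \<in> topspace X. u x \<in> K}" by (rule cpt) (use K in \<open>auto simp: C_def\<close>)
    qed
    finally show "emeasure N K \<le> (SUP K\<in>{K. K \<subseteq> B \<and> compactin X K}. emeasure M K)" .
  qed
  finally show ?thesis
    by (intro antisym SUP_least) (auto intro!: emeasure_mono B)
qed

lemma polish_compact_subset: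
  assumes X: "polish_space X" and sets: "sets M = sets (borel_of X)" and fin: "finite_measure M"
    and B: "B \<in> sets M" "emeasure M B > 0"
  obtains K where "K \<subseteq> B" "compactin X K" "emeasure M K > 0"
  using B(2) unfolding polish_inner_regular[OF X sets fin B(1)] less_SUP_iff by auto

lemma polish_compact_exhaustion:
  assumes X: "polish_space X" and sets: "sets M = sets (borel_of X)" and fin: "finite_measure M"
    and B: "B \<in> sets M"
  obtains K :: "nat \<Rightarrow> 'a set" where "\<And>n. K n \<subseteq> B" "\<And>n. compactin X (K n)" "emeasure M (B - (\<Union>n. K n)) = 0"
proof -
  interpret finite_measure M by fact
  let ?S = "{K. K \<subseteq> B \<and> compactin X K}"
  have "?S \<noteq> {}" by (auto intro!: exI[of _ "{}"])
  \<comment> \<open>The supremum over all compact subsets is already the supremum of a sequence, and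
    the union of that sequence has full measure in \<open>B\<close>.\<close>
  then obtain f where f: "range f \<subseteq> emeasure M ` ?S" "(SUP K\<in>?S. emeasure M K) = (SUP n::nat. f n)"
    using ennreal_SUP_countable_SUP[of ?S "emeasure M"] by (metis)
  then have "\<forall>n. \<exists>K. K \<subseteq> B \<and> compactin X K \<and> f n = emeasure M K" by auto
  then obtain K where K: "\<And>n. K n \<subseteq> B" "\<And>n. compactin X (K n)" "\<And>n. f n = emeasure M (K n)" by metis
  have Ks: "K n \<in> sets M" for n
    using compactin_borel_of[OF polish_imp_Hausdorff[OF X] K(2)] sets by simp
  have "emeasure M B = (SUP n. emeasure M (K n))"
    using polish_inner_regular[OF X sets fin B] f(2) K(3) by simp
  also have "\<dots> \<le> emeasure M (\<Union>n. K n)"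
    using Ks by (intro SUP_least emeasure_mono) auto
  finally have "emeasure M B \<le> emeasure M (\<Union>n. K n)" .
  moreover have "emeasure M (\<Union>n. K n) \<le> emeasure M B"
    using K(1) B by (intro emeasure_mono) auto
  ultimately have "emeasure M (B - (\<Union>n. K n)) = 0"
    using Ks K(1) B by (subst emeasure_Diff) (auto simp: emeasure_eq_measure)
  with K show ?thesis by (intro that) auto
qed

section \<open>Ergodic measures on Cantor space\<close>

definition agree_below :: "nat \<Rightarrow> (nat \<Rightarrow> 'b) \<Rightarrow> (nat \<Rightarrow> 'b) \<Rightarrow> bool" where
  "agree_below n c c' \<longleftrightarrow> (\<forall>i<n. c i = c' i)"

definition depends_below :: "nat \<Rightarrow> (nat \<Rightarrow> bool) set \<Rightarrow> bool" where
  "depends_below n A \<longleftrightarrow> (\<forall>c c'. agree_below n c c' \<longrightarrow> c \<in> A \<longrightarrow> c' \<in> A)"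

text \<open>These are the clopen subsets of Cantor space. There are countably many of them, and each
  is given by a finite set of words.\<close>

definition cylinder_algebra :: "(nat \<Rightarrow> bool) set set" where
  "cylinder_algebra = {A. \<exists>n. depends_below n A}"

definition cylinder :: "bool list \<Rightarrow> (nat \<Rightarrow> bool) set" where
  "cylinder s = {c. \<forall>i<length s. c i = s ! i}"

definition cantor_topology :: "(nat \<Rightarrow> bool) topology" where
  "cantor_topology = product_topology (\<lambda>_. discrete_topology UNIV) UNIV"

lemma agree_below_sym: "agree_below n c c' \<Longrightarrow> agree_below n c' c"
  by (simp add: agree_below_def)

lemma agree_below_mono: "agree_below m c c' \<Longrightarrow> n \<le> m \<Longrightarrow> agree_below n c c'"
  by (simp add: agree_below_def)

lemma depends_belowD: "depends_below n A \<Longrightarrow> agree_below n c c' \<Longrightarrow> c \<in> A \<Longrightarrow> c' \<in> A"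
  by (simp add: depends_below_def)

lemma depends_below_mono: "depends_below n A \<Longrightarrow> n \<le> m \<Longrightarrow> depends_below m A"
  unfolding depends_below_def using agree_below_mono by blast

lemma cylinder_map_iff: "c' \<in> cylinder (map c [0..<n]) \<longleftrightarrow> agree_below n c c'"
  by (auto simp: cylinder_def agree_below_def)

lemma in_cylinder_map: "c \<in> cylinder (map c [0..<n])"
  by (simp add: cylinder_map_iff agree_below_def)

lemma depends_below_cylinder: "depends_below (length s) (cylinder s)"
  by (simp add: depends_below_def cylinder_def agree_below_def)

lemma cylinder_algebra_cylinder: "cylinder s \<in> cylinder_algebra"
  using depends_below_cylinder by (auto simp: cylinder_algebra_def)

lemma algebra_cylinder_algebra: "algebra UNIV cylinder_algebra"
  unfolding algebra_iff_Un
proof (intro conjI ballI)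
  show "{} \<in> cylinder_algebra" by (simp add: cylinder_algebra_def depends_below_def)
  fix A assume "A \<in> cylinder_algebra"
  then show "UNIV - A \<in> cylinder_algebra" 
    unfolding cylinder_algebra_def depends_below_def using agree_below_sym by blast
  fix B assume "B \<in> cylinder_algebra"
  with \<open>A \<in> cylinder_algebra\<close> obtain n m where "depends_below n A" "depends_below m B"
    by (auto simp: cylinder_algebra_def)
  then have "depends_below (max n m) A" "depends_below (max n m) B"
    by (auto intro: depends_below_mono)
  then have "depends_below (max n m) (A \<union> B)" unfolding depends_below_def by blast
  then show "A \<union> B \<in> cylinder_algebra" by (auto simp: cylinder_algebra_def)
qed simp

lemma cylinder_algebraE:
  assumes "A \<in> cylinder_algebra"
  obtains F where "finite F" "A = \<Union>(cylinder ` F)"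
proof -
  obtain n where n: "depends_below n A" using assms by (auto simp: cylinder_algebra_def)
  let ?F = "{s. length s = n \<and> cylinder s \<subseteq> A}"
  have "finite ?F"
    by (rule finite_subset[OF _ finite_lists_length_eq[of "UNIV :: bool set" n]]) auto
  moreover have "A = \<Union>(cylinder ` ?F)"
  proof
    show "A \<subseteq> \<Union>(cylinder ` ?F)"
    proof
      fix c assume c: "c \<in> A"
      have "cylinder (map c [0..<n]) \<subseteq> A"
        using depends_belowD[OF n _ c] by (auto simp: cylinder_map_iff)
      moreover have "c \<in> cylinder (map c [0..<n])" by (simp add: cylinder_map_iff agree_below_def)
      ultimately show "c \<in> \<Union>(cylinder ` ?F)" by (intro UN_I[of "map c [0..<n]"]) auto
    qed
  qed auto
  ultimately show ?thesis by (rule that)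
qed

lemma countable_cylinder_algebra: "countable cylinder_algebra"
proof -
  have "cylinder_algebra \<subseteq> (\<lambda>F. \<Union>(cylinder ` F)) ` {F. finite F}"
  proof
    fix A assume "A \<in> cylinder_algebra"
    then obtain F where "finite F" "A = \<Union>(cylinder ` F)" by (rule cylinder_algebraE)
    then show "A \<in> (\<lambda>F. \<Union>(cylinder ` F)) ` {F. finite F}" by blast
  qed
  then show ?thesis
    by (rule countable_subset) (intro countable_image countable_Collect_finite)
qed

lemma topspace_cantor [simp]: "topspace cantor_topology = UNIV"
  by (simp add: cantor_topology_def)

lemma openin_cantor_cylinder: "openin cantor_topology (cylinder s)"
proof -
  have "openin cantor_topology {c \<in> topspace cantor_topology. c i \<in> {b}}" for i b
    unfolding cantor_topology_def
    by (rule openin_continuous_map_preimage[OF continuous_map_product_projection]) auto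
  then have "openin cantor_topology {c. c i = b}" for i b by simp
  then have "openin cantor_topology (\<Inter>i\<in>{..<length s}. {c. c i = s ! i})" if "s \<noteq> []"
    using that by (intro openin_INT2) auto
  moreover have "(\<Inter>i\<in>{..<length s}. {c. c i = s ! i}) = cylinder s"
    by (auto simp: cylinder_def)
  moreover have "openin cantor_topology (cylinder [])"
    using openin_topspace[of cantor_topology] by (simp add: cylinder_def)
  ultimately show ?thesis by (cases "s = []") auto
qed

lemma openin_cantor_algebra: "A \<in> cylinder_algebra \<Longrightarrow> openin cantor_topology A"
  by (elim cylinder_algebraE) (auto intro: openin_cantor_cylinder)

lemma closedin_cantor_algebra: "A \<in> cylinder_algebra \<Longrightarrow> closedin cantor_topology A"
  using openin_cantor_algebra[of "UNIV - A"] algebra.compl_sets[OF algebra_cylinder_algebra, of A]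
  by (simp add: closedin_def)

lemma cantor_cylinder_in_open:
  assumes "openin cantor_topology U" "c \<in> U"
  shows "\<exists>n. cylinder (map c [0..<n]) \<subseteq> U"
proof -
  obtain V where V: "finite {i. V i \<noteq> UNIV}" "c \<in> Pi\<^sub>E UNIV V" "Pi\<^sub>E UNIV V \<subseteq> U"
    using assms unfolding cantor_topology_def openin_product_topology_alt by auto
  obtain n where n: "\<And>i. V i \<noteq> UNIV \<Longrightarrow> i < n"
    using V(1) unfolding finite_nat_set_iff_bounded by auto
  have "cylinder (map c [0..<n]) \<subseteq> Pi\<^sub>E UNIV V"
  proof
    fix c' assume c': "c' \<in> cylinder (map c [0..<n])"
    have "c' i \<in> V i" for i
      by (cases "i < n") (use c' V(2) n[of i] in \<open>auto simp: cylinder_def PiE_iff\<close>)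
    then show "c' \<in> Pi\<^sub>E UNIV V" by auto
  qed
  then show ?thesis using V(3) by blast
qed

lemma compact_space_cantor: "compact_space cantor_topology"
  unfolding cantor_topology_def by (simp add: compact_space_product_topology compact_space_discrete_topology)

lemma polish_space_cantor: "polish_space cantor_topology"
  unfolding polish_space_def
proof
  show "completely_metrizable_space cantor_topology"
    unfolding cantor_topology_def
    by (simp add: completely_metrizable_space_product_topology completely_metrizable_space_discrete_topology)
  show "second_countable cantor_topology"
    unfolding second_countable_def
  proof (intro exI[of _ "range cylinder"] conjI ballI allI impI)
    fix U c assume "openin cantor_topology U \<and> c \<in> U"
    then obtain n where "cylinder (map c [0..<n]) \<subseteq> U" using cantor_cylinder_in_open by blast
    then show "\<exists>V\<in>range cylinder. c \<in> V \<and> V \<subseteq> U"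
      by (intro bexI[of _ "cylinder (map c [0..<n])"]) (auto simp: in_cylinder_map)
  qed (auto intro: openin_cantor_cylinder)
qed

lemma sets_borel_of_cantor: "sets (borel_of cantor_topology) = sigma_sets UNIV cylinder_algebra"
proof
  show "sets (borel_of cantor_topology) \<subseteq> sigma_sets UNIV cylinder_algebra"
    unfolding sets_borel_of topspace_cantor
  proof (rule sigma_sets_mono, rule subsetI)
    fix U assume U: "U \<in> {U. openin cantor_topology U}"
    have "U = (\<Union>s\<in>{s. cylinder s \<subseteq> U}. cylinder s)"
    proof
      show "U \<subseteq> (\<Union>s\<in>{s. cylinder s \<subseteq> U}. cylinder s)"
      proof
        fix c assume "c \<in> U"
        then obtain n where "cylinder (map c [0..<n]) \<subseteq> U" using cantor_cylinder_in_open U by blast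
        then show "c \<in> (\<Union>s\<in>{s. cylinder s \<subseteq> U}. cylinder s)"
          by (intro UN_I[of "map c [0..<n]"]) (auto simp: in_cylinder_map)
      qed
    qed auto
    also have "\<dots> \<in> sigma_sets UNIV cylinder_algebra"
      by (rule sigma_sets_UNION) (auto intro: sigma_sets.Basic cylinder_algebra_cylinder)
    finally show "U \<in> sigma_sets UNIV cylinder_algebra" .
  qed
  show "sigma_sets UNIV cylinder_algebra \<subseteq> sets (borel_of cantor_topology)"
    using sets.sigma_sets_subset[of cylinder_algebra "borel_of cantor_topology"]
      openin_borel_of openin_cantor_algebra by auto
qed

text \<open>On clopen sets finite additivity already gives countable additivity: by compactness a
  decreasing sequence of clopen sets with empty intersection is eventually empty, so Caratheodory's
  theorem applies.\<close>

lemma cantor_measure_exists: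
  fixes p :: "(nat \<Rightarrow> bool) set \<Rightarrow> real"
  assumes nonneg: "\<And>A. 0 \<le> p A" and one: "p UNIV = 1"
    and add: "\<And>A B. A \<in> cylinder_algebra \<Longrightarrow> B \<in> cylinder_algebra \<Longrightarrow> A \<inter> B = {} \<Longrightarrow> p (A \<union> B) = p A + p B"
  obtains \<tau> where "sets \<tau> = sets (borel_of cantor_topology)" "prob_space \<tau>"
    "\<And>A. A \<in> cylinder_algebra \<Longrightarrow> measure \<tau> A = p A"
proof -
  interpret algebra UNIV cylinder_algebra by (rule algebra_cylinder_algebra)
  have p0: "p {} = 0" using add[of "{}" "{}"] by simp
  have "\<exists>\<mu> :: (nat \<Rightarrow> bool) set \<Rightarrow> ennreal. (\<forall>s\<in>cylinder_algebra. \<mu> s = ennreal (p s)) \<and>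
      measure_space UNIV (sigma_sets UNIV cylinder_algebra) \<mu>"
  proof (rule caratheodory_empty_continuous)
    show "positive cylinder_algebra (\<lambda>s. ennreal (p s))" by (simp add: positive_def p0)
    show "additive cylinder_algebra (\<lambda>s. ennreal (p s))"
      by (auto simp: additive_def add ennreal_plus nonneg)
    fix A :: "nat \<Rightarrow> (nat \<Rightarrow> bool) set"
    assume A: "range A \<subseteq> cylinder_algebra" "decseq A" "(\<Inter>i. A i) = {}"
    have "\<exists>n. A n = {}"
    proof (rule ccontr)
      assume "\<nexists>n. A n = {}"
      then have "(\<Inter>i. A i) \<noteq> {}"
        by (intro compact_space_imp_nest[OF compact_space_cantor] A(2) closedin_cantor_algebra)
          (use A(1) in auto)
      with A(3) show False by simp
    qed
    then obtain n where "A n = {}" by auto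
    then have "\<exists>n. \<forall>i\<ge>n. A i = {}" using A(2) unfolding decseq_def by blast
    then show "(\<lambda>i. ennreal (p (A i))) \<longlonglongrightarrow> 0"
      by (intro tendsto_eventually) (auto simp: eventually_sequentially p0 elim!: ex_forward)
  qed simp
  then obtain \<mu> :: "(nat \<Rightarrow> bool) set \<Rightarrow> ennreal"
    where m: "\<And>s. s \<in> cylinder_algebra \<Longrightarrow> \<mu> s = ennreal (p s)"
      "measure_space UNIV (sigma_sets UNIV cylinder_algebra) \<mu>" by blast
  define \<tau> where "\<tau> = measure_of UNIV cylinder_algebra \<mu>"
  have em: "emeasure \<tau> A = ennreal (p A)" if "A \<in> cylinder_algebra" for A
  proof -
    have "emeasure \<tau> A = \<mu> A"
      by (rule emeasure_measure_of[OF \<tau>_def])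
        (use m(2) that in \<open>auto simp: measure_space_def \<tau>_def sets_measure_of_conv\<close>)
    then show ?thesis using m(1)[OF that] by simp
  qed
  have sets: "sets \<tau> = sets (borel_of cantor_topology)"
    by (simp add: \<tau>_def sets_borel_of_cantor)
  have "emeasure \<tau> (space \<tau>) = 1"
    using em[OF top] one by (simp add: \<tau>_def space_measure_of_conv)
  then have "prob_space \<tau>" by (rule prob_spaceI)
  then show ?thesis
    using that sets em by (simp add: measure_def nonneg)
qed

text \<open>The approximants are the sets of points that share their first \<open>n\<close>
  coordinates with some point of \<open>K\<close>. They turn the mass of \<open>K\<close> into an
  infimum of masses of clopen sets, hence into an upper semicontinuous quantity.\<close>

lemma cantor_closed_Inter:
  assumes "closedin cantor_topology K"
  obtains A where "\<And>n. A n \<in> cylinder_algebra" "decseq A" "K = (\<Inter>n. A n)"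
proof -
  define A where "A n = {c. \<exists>c'\<in>K. agree_below n c c'}" for n :: nat
  have "depends_below n (A n)" for n
    unfolding depends_below_def A_def by (auto simp: agree_below_def)
  then have "A n \<in> cylinder_algebra" for n by (auto simp: cylinder_algebra_def)
  moreover have "decseq A" by (auto simp: decseq_def A_def intro: agree_below_mono)
  moreover have "K = (\<Inter>n. A n)"
  proof
    show "K \<subseteq> (\<Inter>n. A n)" by (auto simp: A_def agree_below_def)
    show "(\<Inter>n. A n) \<subseteq> K"
    proof (rule subsetI, rule ccontr)
      fix c assume c: "c \<in> (\<Inter>n. A n)" "c \<notin> K"
      have "openin cantor_topology (UNIV - K)" using assms by (simp add: closedin_def)
      then obtain n where "cylinder (map c [0..<n]) \<subseteq> UNIV - K"
        using cantor_cylinder_in_open c(2) by blast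
      moreover obtain c' where "c' \<in> K" "agree_below n c c'" using c(1) by (auto simp: A_def)
      ultimately show False using cylinder_map_iff[of c' c n] by auto
    qed
  qed
  ultimately show ?thesis by (rule that)
qed

text \<open>Upper semicontinuity enters as closedness of the superlevel sets. The sets
  \<open>{p. L q \<le> L p}\<close> have the finite intersection property on \<open>M\<close>
  because finitely many values have a maximum.\<close>

lemma usc_attains_sup:
  fixes L :: "'a::topological_space \<Rightarrow> real"
  assumes "compact M" "M \<noteq> {}" and closed: "\<And>s. closed {p. s \<le> L p}"
  obtains p where "p \<in> M" "\<And>q. q \<in> M \<Longrightarrow> L q \<le> L p"
proof -
  have "M \<inter> \<Inter>((\<lambda>q. {p. L q \<le> L p}) ` M) \<noteq> {}"
  proof (rule compact_imp_fip[OF assms(1)])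
    fix F' assume F': "finite F'" "F' \<subseteq> (\<lambda>q. {p. L q \<le> L p}) ` M"
    then obtain Q where Q: "Q \<subseteq> M" "finite Q" "F' = (\<lambda>q. {p. L q \<le> L p}) ` Q"
      by (meson finite_subset_image)
    show "M \<inter> \<Inter>F' \<noteq> {}"
    proof (cases "Q = {}")
      case False
      then have "Max (L ` Q) \<in> L ` Q" using Q(2) by (intro Max_in) auto
      then obtain q where q: "q \<in> Q" "L q = Max (L ` Q)" by (metis imageE)
      then have "q \<in> M \<inter> \<Inter>F'" using Q by auto
      then show ?thesis by blast
    qed (use Q assms(2) in auto)
  qed (use closed in auto)
  then obtain p where "p \<in> M" "\<forall>q\<in>M. L q \<le> L p" by auto
  then show ?thesis using that by auto
qed

text \<open>The set \<open>C (Suc i)\<close> consists of the maximisers of \<open>L i\<close> within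
  \<open>C i\<close>. These sets are non-empty, compact and decreasing, so they have a common point.
  For affine functionals that separate points such a maximum is an extreme point.\<close>

lemma lexicographic_maximum:
  fixes L :: "nat \<Rightarrow> 'a::topological_space \<Rightarrow> real"
  assumes M: "compact M" "closed M" "M \<noteq> {}" and closed: "\<And>i s. closed {p. s \<le> L i p}"
  obtains p where "p \<in> M" "\<And>i q. q \<in> M \<Longrightarrow> (\<And>j. j < i \<Longrightarrow> L j q = L j p) \<Longrightarrow> L i q \<le> L i p"
proof -
  define C where "C = rec_nat M (\<lambda>i S. {p\<in>S. \<forall>q\<in>S. L i q \<le> L i p})"
  have C0: "C 0 = M" and CS: "C (Suc i) = {p \<in> C i. \<forall>q\<in>C i. L i q \<le> L i p}" for i
    by (auto simp: C_def)
  have C: "compact (C i) \<and> closed (C i) \<and> C i \<noteq> {}" for i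
  proof (induction i)
    case (Suc i)
    obtain p where p: "p \<in> C i" "\<And>q. q \<in> C i \<Longrightarrow> L i q \<le> L i p"
      by (rule usc_attains_sup[of "C i" "L i"]) (use Suc closed in auto)
    have "C (Suc i) = C i \<inter> {q. L i p \<le> L i q}"
      using p unfolding CS by force
    moreover have "p \<in> C (Suc i)" using p by (auto simp: CS)
    ultimately show ?case using Suc closed compact_Int_closed by (metis closed_Int empty_iff)
  qed (use M C0 in auto)
  have "C i \<subseteq> C j" if "j \<le> i" for i j
    using lift_Suc_antimono_le[of C, OF _ that] by (auto simp: CS)
  note anti = this
  have "M \<inter> \<Inter>(range C) \<noteq> {}"
  proof (rule compact_imp_fip[OF M(1)])
    fix F' assume "finite F'" "F' \<subseteq> range C"
    then obtain J where J: "finite J" "F' = C ` J" by (meson finite_subset_image)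
    define N where "N = Max (insert 0 J)"
    have "C N \<subseteq> C j" if "j \<in> J" for j
      using that J(1) by (intro anti) (simp add: N_def)
    moreover have "C N \<subseteq> M" using anti[of 0 N] C0 by simp
    ultimately have "C N \<subseteq> M \<inter> \<Inter>F'" using J(2) by auto
    then show "M \<inter> \<Inter>F' \<noteq> {}" using C[of N] by blast
  qed (use C in auto)
  then obtain p where p: "\<And>i. p \<in> C i" by auto
  show ?thesis
  proof (rule that[of p])
    show "p \<in> M" using p[of 0] C0 by simp
    fix i q assume q: "q \<in> M" "\<And>j. j < i \<Longrightarrow> L j q = L j p"
    have "q \<in> C j" if "j \<le> i" for j
      using that
    proof (induction j)
      case (Suc j)
      then show ?case using q(2)[of j] p[of "Suc j"] by (auto simp: CS)
    qed (use q C0 in auto)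
    then show "L i q \<le> L i p" using p[of "Suc i"] by (auto simp: CS)
  qed
qed

lemma cantor_measure_eqI:
  assumes "sets M = sets (borel_of cantor_topology)" "sets N = sets (borel_of cantor_topology)"
    and "finite_measure M" "\<And>A. A \<in> cylinder_algebra \<Longrightarrow> emeasure M A = emeasure N A"
  shows "M = N"
proof (rule measure_eqI_generator_eq)
  show "Int_stable cylinder_algebra"
    using algebra_cylinder_algebra by (simp add: algebra_iff_Int Int_stable_def)
  show "range (\<lambda>_. UNIV) \<subseteq> cylinder_algebra" "(\<Union>i::nat. UNIV) = (UNIV :: (nat \<Rightarrow> bool) set)"
    using algebra.top[OF algebra_cylinder_algebra] by auto
  show "emeasure M UNIV \<noteq> \<infinity>" for i :: nat
    using finite_measure.emeasure_finite[OF assms(3)] by simp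
qed (use assms in \<open>auto simp: sets_borel_of_cantor\<close>)

lemma measurable_cantorI:
  assumes "\<And>A. A \<in> cylinder_algebra \<Longrightarrow> f -` A \<inter> space M \<in> sets M"
  shows "f \<in> M \<rightarrow>\<^sub>M borel_of cantor_topology"
  by (rule measurable_sigma_sets[OF sets_borel_of_cantor]) (use assms in auto)

text \<open>Tychonoff's theorem, used later with the subsets of Cantor space as indices.\<close>

lemma compact_unit_cube: "compact {p :: 'b \<Rightarrow> real. \<forall>x. 0 \<le> p x \<and> p x \<le> 1}"
proof -
  have "compactin (product_topology (\<lambda>_::'b. euclideanreal) UNIV) (Pi\<^sub>E UNIV (\<lambda>_. {0..1}))"
    by (subst compactin_PiE) auto
  moreover have "Pi\<^sub>E UNIV (\<lambda>_. {0..1}) = {p :: 'b \<Rightarrow> real. \<forall>x. 0 \<le> p x \<and> p x \<le> 1}"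
    by (auto simp: PiE_iff)
  ultimately show ?thesis by (simp add: euclidean_product_topology)
qed

text \<open>An extreme point of the compact convex set of invariant measures that charge \<open>K\<close> is found by
  maximising the mass of \<open>K\<close> and then, successively, the mass of every clopen set.\<close>

lemma cantor_ergodic_measure:
  fixes \<theta> :: "nat \<Rightarrow> (nat \<Rightarrow> bool) \<Rightarrow> (nat \<Rightarrow> bool)"
  assumes pre: "\<And>j A. A \<in> cylinder_algebra \<Longrightarrow> \<theta> j -` A \<in> cylinder_algebra"
    and sets0: "sets \<tau>\<^sub>0 = sets (borel_of cantor_topology)" and prob0: "prob_space \<tau>\<^sub>0"
    and inv0: "\<And>j A. A \<in> cylinder_algebra \<Longrightarrow> measure \<tau>\<^sub>0 (\<theta> j -` A) = measure \<tau>\<^sub>0 A"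
    and K: "closedin cantor_topology K" and pos: "measure \<tau>\<^sub>0 K > 0"
  obtains \<tau> where "sets \<tau> = sets (borel_of cantor_topology)" "prob_space \<tau>"
    "\<And>j A. A \<in> sets \<tau> \<Longrightarrow> measure \<tau> (\<theta> j -` A) = measure \<tau> A" "measure \<tau> K > 0"
    "\<And>A. A \<in> sets \<tau> \<Longrightarrow> (\<And>j. A \<subseteq> \<theta> j -` A) \<Longrightarrow> measure \<tau> A = 0 \<or> measure \<tau> A = 1"
proof -
  let ?\<A> = cylinder_algebra
  interpret algebra UNIV ?\<A> by (rule algebra_cylinder_algebra)
  have \<A>_sets: "A \<in> sets (borel_of cantor_topology)" if "A \<in> ?\<A>" for A
    using that by (simp add: openin_borel_of openin_cantor_algebra)
  have \<theta>: "\<theta> j \<in> borel_of cantor_topology \<rightarrow>\<^sub>M borel_of cantor_topology" for j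
    by (rule measurable_cantorI) (use pre \<A>_sets in auto)
  obtain Kn where Kn: "\<And>n. Kn n \<in> ?\<A>" "decseq Kn" "K = (\<Inter>n. Kn n)"
    using cantor_closed_Inter[OF K] by metis
  obtain B :: "nat \<Rightarrow> _" where B: "range B = ?\<A>"
    using range_from_nat_into[OF _ countable_cylinder_algebra] top by (metis empty_iff)
  \<comment> \<open>Priority 0 is the mass of \<open>K\<close>, as an infimum over its clopen
    approximants, so that the maximiser still charges \<open>K\<close>; the other priorities run
    through all clopen sets and so determine the measure. The \<open>max 0\<close> bounds the
    infimum from below for arbitrary \<open>p\<close>.\<close>
  define L :: "nat \<Rightarrow> ((nat \<Rightarrow> bool) set \<Rightarrow> real) \<Rightarrow> real"
    where "L i p = (case i of 0 \<Rightarrow> (INF n. max 0 (p (Kn n))) | Suc i \<Rightarrow> p (B i))" for i p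
  have L0: "L 0 p = (INF n. max 0 (p (Kn n)))" and LS: "L (Suc i) p = p (B i)" for i p
    by (auto simp: L_def)
  \<comment> \<open>Invariant finitely additive probabilities on the clopen sets, as a closed subset
    of a product of unit intervals; the coordinates outside the algebra range freely over the unit
    interval.\<close>
  define P :: "((nat \<Rightarrow> bool) set \<Rightarrow> real) set" where
    "P = {p. \<forall>x. 0 \<le> p x \<and> p x \<le> 1} \<inter> ({p. p UNIV = 1} \<inter>
      (\<Inter>A\<in>?\<A>. \<Inter>B\<in>{B\<in>?\<A>. A \<inter> B = {}}. {p. p (A \<union> B) = p A + p B}) \<inter>
      (\<Inter>j. \<Inter>A\<in>?\<A>. {p. p (\<theta> j -` A) = p A}))"
  have closed_rest: "closed ({p :: (nat \<Rightarrow> bool) set \<Rightarrow> real. p UNIV = 1} \<inter>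
      (\<Inter>A\<in>?\<A>. \<Inter>B\<in>{B\<in>?\<A>. A \<inter> B = {}}. {p. p (A \<union> B) = p A + p B}) \<inter>
      (\<Inter>j. \<Inter>A\<in>?\<A>. {p. p (\<theta> j -` A) = p A}))"
    by (intro closed_Int closed_INT ballI closed_Collect_eq continuous_intros continuous_on_product_coordinates)
  then have "compact P"
    unfolding P_def by (intro compact_Int_closed compact_unit_cube)
  have "closed {p :: (nat \<Rightarrow> bool) set \<Rightarrow> real. \<forall>x. 0 \<le> p x \<and> p x \<le> 1}"
    by (intro closed_Collect_all closed_Collect_conj closed_Collect_le continuous_intros
        continuous_on_product_coordinates)
  then have "closed P"
    unfolding P_def by (rule closed_Int) (rule closed_rest)
  have "measure \<tau>\<^sub>0 \<in> P"
  proof -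
    interpret \<tau>0: prob_space \<tau>\<^sub>0 by fact
    have "space \<tau>\<^sub>0 = UNIV" using sets_eq_imp_space_eq[OF sets0] by simp
    then show ?thesis
      unfolding P_def using inv0 \<tau>0.prob_space
      by (auto intro!: \<tau>0.finite_measure_Union simp: sets0 \<A>_sets)
  qed
  then have Pne: "P \<noteq> {}" by auto
  have closed: "closed {p. s \<le> L i p}" for i s
  proof (cases i)
    case 0
    have "{p. s \<le> L 0 p} = (\<Inter>n. {p. s \<le> max 0 (p (Kn n))})"
      unfolding L0 by (subst le_cINF_iff) (auto intro!: bdd_belowI[of _ 0])
    also have "closed \<dots>"
      by (intro closed_INT ballI closed_Collect_le continuous_intros continuous_on_product_coordinates)
    finally show ?thesis using 0 by simp
  next
    case (Suc k)
    then show ?thesis unfolding Suc LS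
      by (intro closed_Collect_le continuous_intros continuous_on_product_coordinates)
  qed
  obtain p where p: "p \<in> P" and max: "\<And>i q. q \<in> P \<Longrightarrow> (\<And>j. j < i \<Longrightarrow> L j q = L j p) \<Longrightarrow> L i q \<le> L i p"
    by (rule lexicographic_maximum[where L = L, OF \<open>compact P\<close> \<open>closed P\<close> Pne closed]) (rule that, assumption, blast)
  obtain \<tau> where \<tau>: "sets \<tau> = sets (borel_of cantor_topology)" "prob_space \<tau>"
      "\<And>A. A \<in> ?\<A> \<Longrightarrow> measure \<tau> A = p A"
    by (rule cantor_measure_exists[of p]) (use p in \<open>auto simp: P_def\<close>)
  interpret prob_space \<tau> by fact
  have sp: "space \<tau> = UNIV" using sets_eq_imp_space_eq[OF \<tau>(1)] by simp
  have \<theta>\<tau> [measurable]: "\<theta> j \<in> \<tau> \<rightarrow>\<^sub>M \<tau>" for j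
    using \<theta>[of j] \<tau>(1) by (simp cong: measurable_cong_sets)
  have "distr \<tau> \<tau> (\<theta> j) = \<tau>" for j
  proof (rule cantor_measure_eqI)
    fix A assume A: "A \<in> ?\<A>"
    have "measure \<tau> (\<theta> j -` A) = measure \<tau> A"
      using A pre[OF A, of j] p \<tau>(3) by (auto simp: P_def)
    then show "emeasure (distr \<tau> \<tau> (\<theta> j)) A = emeasure \<tau> A"
      using \<A>_sets[OF A] by (simp add: emeasure_distr \<tau>(1) sp emeasure_eq_measure)
  qed (auto simp: \<tau>(1) intro: finite_measure_distr)
  then have "measure (distr \<tau> \<tau> (\<theta> j)) A = measure \<tau> A" for j A by simp
  then have inv: "measure \<tau> (\<theta> j -` A) = measure \<tau> A" if "A \<in> sets \<tau>" for j A
    using that by (metis measure_distr \<theta>\<tau> sp Int_UNIV_right)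
  have KnS: "Kn n \<in> sets \<tau>" for n using \<A>_sets Kn(1) \<tau>(1) by simp
  have L0_lim: "L 0 q = l" if q: "(\<lambda>n. q (Kn n)) \<longlonglongrightarrow> l" "\<And>A. 0 \<le> q A" "decseq (\<lambda>n. q (Kn n))" for q l
  proof -
    have "(\<lambda>n. q (Kn n)) \<longlonglongrightarrow> (INF n. q (Kn n))"
      by (rule LIMSEQ_decseq_INF[OF _ q(3)]) (use q(2) in \<open>auto intro!: bdd_belowI[of _ 0]\<close>)
    then have "(INF n. q (Kn n)) = l" using q(1) LIMSEQ_unique by blast
    then show ?thesis unfolding L0 using q(2) by (simp add: max_absorb2)
  qed
  \<comment> \<open>Stated with \<open>A\<close> and \<open>t\<close> in order to cover conditional
    measures as well as a measure itself, which is the case \<open>A = UNIV\<close>,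
    \<open>t = 1\<close>.\<close>
  have L0_meas: "L 0 (\<lambda>S. measure N (S \<inter> A) / t) = measure N (K \<inter> A) / t"
    if N: "finite_measure N" "sets N = sets \<tau>" "A \<in> sets \<tau>" "t > 0" for N A t
  proof (rule L0_lim)
    interpret N: finite_measure N by fact
    have "(\<lambda>n. measure N (Kn n \<inter> A)) \<longlonglongrightarrow> measure N (\<Inter>n. Kn n \<inter> A)"
      using Kn(2) KnS N by (intro N.finite_Lim_measure_decseq) (auto simp: decseq_def)
    moreover have "(\<Inter>n. Kn n \<inter> A) = K \<inter> A" using Kn(3) by auto
    ultimately show "(\<lambda>n. measure N (Kn n \<inter> A) / t) \<longlonglongrightarrow> measure N (K \<inter> A) / t"
      using N(4) by (intro tendsto_intros) auto
    show "decseq (\<lambda>n. measure N (Kn n \<inter> A) / t)"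
      unfolding decseq_def using Kn(2) KnS N
      by (auto intro!: divide_right_mono N.finite_measure_mono simp: decseq_def)
  qed (use N in auto)
  have L0p: "L 0 p = measure \<tau> K"
  proof -
    have "L 0 p = L 0 (\<lambda>S. measure \<tau> (S \<inter> UNIV) / 1)"
      unfolding L0 using \<tau>(3) Kn(1) by simp
    also have "\<dots> = measure \<tau> K"
      by (subst L0_meas) (use sp sets.top[of \<tau>] finite_measure_axioms in auto)
    finally show ?thesis .
  qed
  have "measure \<tau>\<^sub>0 K = L 0 (\<lambda>S. measure \<tau>\<^sub>0 (S \<inter> UNIV) / 1)"
    by (subst L0_meas)
      (use sp sets.top[of \<tau>] prob0 sets0 \<tau>(1) in \<open>auto simp: prob_space_def\<close>)
  also have "\<dots> \<le> L 0 p"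
    using max[OF \<open>measure \<tau>\<^sub>0 \<in> P\<close>, of 0] by simp
  finally have posK: "measure \<tau> K > 0" using pos L0p by simp
  \<comment> \<open>If \<open>t\<close> were strictly between 0 and 1, the measure would be a proper
    convex combination of its conditionals on \<open>A\<close> and on the complement, both
    invariant; lexicographic maximality forces both to agree with it.\<close>
  have "measure \<tau> A = 0 \<or> measure \<tau> A = 1" if A: "A \<in> sets \<tau>" and AS: "\<And>j. A \<subseteq> \<theta> j -` A" for A
  proof (rule ccontr)
    define t where "t = measure \<tau> A"
    assume "\<not> (measure \<tau> A = 0 \<or> measure \<tau> A = 1)"
    then have t: "0 < t" "t < 1"
      using prob_le_1[of A] measure_nonneg[of \<tau> A] by (auto simp: t_def less_le)
    have cA: "UNIV - A \<in> sets \<tau>" "measure \<tau> (UNIV - A) = 1 - t"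
      using A sets.compl_sets[OF A] prob_compl[OF A] by (auto simp: sp t_def)
    have split: "measure \<tau> S = measure \<tau> (S \<inter> A) + measure \<tau> (S \<inter> (UNIV - A))" if "S \<in> sets \<tau>" for S
    proof -
      have "S = (S \<inter> A) \<union> (S \<inter> (UNIV - A))" by auto
      then show ?thesis
        using finite_measure_Union[of "S \<inter> A" "S \<inter> (UNIV - A)"] that A cA(1) by auto
    qed
    \<comment> \<open>The set \<open>A\<close> is only known to be forward invariant, but its
      preimage under \<open>\<theta> j\<close> has the same mass, so the two differ by a null
      set.\<close>
    have invA: "measure \<tau> (\<theta> j -` S \<inter> A) = measure \<tau> (S \<inter> A)" if S: "S \<in> sets \<tau>" for S j
    proof -
      have mS: "\<theta> j -` S \<in> sets \<tau>" "\<theta> j -` A \<in> sets \<tau>"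
        using measurable_sets[OF \<theta>\<tau>[of j] S] measurable_sets[OF \<theta>\<tau>[of j] A] by (auto simp: sp)
      have "measure \<tau> (\<theta> j -` A - A) = 0"
        using finite_measure_Diff[OF mS(2) A AS] inv[OF A] by simp
      then have "measure \<tau> (\<theta> j -` S \<inter> (\<theta> j -` A - A)) = 0"
        using finite_measure_mono[of "\<theta> j -` S \<inter> (\<theta> j -` A - A)" "\<theta> j -` A - A"] mS A
        by (simp add: measure_le_0_iff)
      moreover have "\<theta> j -` (S \<inter> A) = (\<theta> j -` S \<inter> A) \<union> (\<theta> j -` S \<inter> (\<theta> j -` A - A))"
        using AS by blast
      ultimately have "measure \<tau> (\<theta> j -` (S \<inter> A)) = measure \<tau> (\<theta> j -` S \<inter> A)"
        using finite_measure_Union[of "\<theta> j -` S \<inter> A" "\<theta> j -` S \<inter> (\<theta> j -` A - A)"] mS A by auto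
      then show ?thesis using inv[of "S \<inter> A"] S A by simp
    qed
    have inv_compl: "measure \<tau> (\<theta> j -` S \<inter> (UNIV - A)) = measure \<tau> (S \<inter> (UNIV - A))" if S: "S \<in> sets \<tau>" for S j
      using split[OF S] split[of "\<theta> j -` S"] measurable_sets[OF \<theta>\<tau>[of j] S] inv[OF S, of j] invA[OF S, of j]
      by (simp add: sp)
    have inP: "(\<lambda>S. measure \<tau> (S \<inter> D) / measure \<tau> D) \<in> P"
      if D: "D \<in> sets \<tau>" "measure \<tau> D > 0" "\<And>S j. S \<in> sets \<tau> \<Longrightarrow> measure \<tau> (\<theta> j -` S \<inter> D) = measure \<tau> (S \<inter> D)" for D
    proof -
      have "measure \<tau> (S \<inter> D) \<le> measure \<tau> D" for S
        by (rule finite_measure_mono) (use D in auto)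
      moreover have "measure \<tau> ((S \<union> S') \<inter> D) = measure \<tau> (S \<inter> D) + measure \<tau> (S' \<inter> D)"
        if "S \<in> ?\<A>" "S' \<in> ?\<A>" "S \<inter> S' = {}" for S S'
        using that D(1) \<A>_sets \<tau>(1)
        by (subst Int_Un_distrib2, intro finite_measure_Union) auto
      ultimately show ?thesis
        using D \<A>_sets \<tau>(1) by (auto simp: P_def add_divide_distrib)
    qed
    define q1 where "q1 S = measure \<tau> (S \<inter> A) / t" for S
    define q2 where "q2 S = measure \<tau> (S \<inter> (UNIV - A)) / (1 - t)" for S
    have q1: "q1 \<in> P" using inP[OF A] t invA unfolding q1_def t_def by simp
    have q2: "q2 \<in> P" using inP[OF cA(1)] t inv_compl unfolding q2_def cA(2) by simp
    have conv: "measure \<tau> S = t * q1 S + (1 - t) * q2 S" if "S \<in> sets \<tau>" for S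
      using split[OF that] t by (simp add: q1_def q2_def)
    have KS: "K \<in> sets \<tau>" using closedin_borel_of[OF K] \<tau>(1) by simp
    \<comment> \<open>All functionals are affine along this decomposition; for priority 0 this holds
      because on measures it is the mass of \<open>K\<close>.\<close>
    have L_conv: "L i p = t * L i q1 + (1 - t) * L i q2" for i
    proof (cases i)
      case 0
      have "L 0 q1 = q1 K" "L 0 q2 = q2 K"
        unfolding q1_def q2_def using t A cA finite_measure_axioms by (auto intro!: L0_meas)
      then show ?thesis using 0 L0p conv[OF KS] by simp
    next
      case (Suc k)
      have "B k \<in> ?\<A>" using B by auto
      then show ?thesis
        unfolding Suc LS using conv[of "B k"] \<tau>(1,3) \<A>_sets by simp
    qed
    \<comment> \<open>At priority \<open>i\<close> all earlier values agree by induction, so neither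
      conditional can exceed the value at \<open>p\<close>; as their weighted mean equals that
      value, both attain it.\<close>
    have L_eq: "L i q1 = L i p \<and> L i q2 = L i p" for i
    proof (induction i rule: less_induct)
      case (less i)
      have le: "L i q1 \<le> L i p" "L i q2 \<le> L i p"
        using less max[OF q1, of i] max[OF q2, of i] by auto
      have "t * (L i p - L i q1) + (1 - t) * (L i p - L i q2) = 0"
        using L_conv[of i] by (simp add: algebra_simps)
      moreover have "0 \<le> t * (L i p - L i q1)" "0 \<le> (1 - t) * (L i p - L i q2)"
        using le t by auto
      ultimately have "t * (L i p - L i q1) = 0" "(1 - t) * (L i p - L i q2) = 0" by linarith+
      then show ?case using t by simp
    qed
    have eqA: "measure \<tau> (S \<inter> A) = t * measure \<tau> S" if S: "S \<in> ?\<A>" for S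
    proof -
      obtain k where "S = B k" using S B by blast
      then have "q1 S = p S" using L_eq[of "Suc k"] by (simp add: LS)
      then show ?thesis using t \<tau>(3)[OF S] by (simp add: q1_def field_simps)
    qed
    \<comment> \<open>Independence of \<open>A\<close> from every clopen set extends to all Borel
      sets; applied to \<open>A\<close> itself it gives \<open>t = t * t\<close>.\<close>
    have "density \<tau> (indicator A) = density \<tau> (\<lambda>_. ennreal t)"
    proof (rule cantor_measure_eqI)
      show "finite_measure (density \<tau> (indicator A))"
        by (rule finite_measureI) (use A in \<open>simp add: emeasure_restricted[OF A]\<close>)
      fix S assume S: "S \<in> ?\<A>"
      then have "S \<in> sets \<tau>" using \<A>_sets \<tau>(1) by simp
      then show "emeasure (density \<tau> (indicator A)) S = emeasure (density \<tau> (\<lambda>_. ennreal t)) S"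
        using eqA[OF S] A t
        by (simp add: emeasure_restricted emeasure_density_const emeasure_eq_measure Int_commute ennreal_mult)
    qed (simp_all add: \<tau>(1))
    then have "emeasure (density \<tau> (indicator A)) A = emeasure (density \<tau> (\<lambda>_. ennreal t)) A" by simp
    then have "ennreal t = ennreal t * ennreal t"
      using A by (simp add: emeasure_restricted emeasure_density_const emeasure_eq_measure t_def)
    then have "t = t * t" using t by (simp add: ennreal_mult[symmetric])
    with t show False by simp
  qed
  with that[of \<tau>] \<tau>(1,2) inv posK show ?thesis by blast
qed

section \<open>Continuous actions\<close>

text \<open>The inverse of \<open>g\<close> supplies the inverse bijection. The extensionality
  condition is there because \<open>BijGroup\<close> consists of bijections that are
  \<open>undefined\<close> outside \<open>E\<close>.\<close>

lemma group_actionI: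
  assumes G: "group G"
    and closed: "\<And>g x. g \<in> carrier G \<Longrightarrow> x \<in> E \<Longrightarrow> \<phi> g x \<in> E"
    and ext: "\<And>g. g \<in> carrier G \<Longrightarrow> \<phi> g \<in> extensional E"
    and one: "\<And>x. x \<in> E \<Longrightarrow> \<phi> \<one>\<^bsub>G\<^esub> x = x"
    and mult: "\<And>g h x. g \<in> carrier G \<Longrightarrow> h \<in> carrier G \<Longrightarrow> x \<in> E \<Longrightarrow> \<phi> (g \<otimes>\<^bsub>G\<^esub> h) x = \<phi> g (\<phi> h x)"
  shows "group_action G E \<phi>"
proof -
  interpret group G by fact
  have bij: "bij_betw (\<phi> g) E E" if g: "g \<in> carrier G" for g
  proof (rule bij_betwI[where g = "\<phi> (inv\<^bsub>G\<^esub> g)"])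
    show "\<phi> (inv\<^bsub>G\<^esub> g) (\<phi> g x) = x" if "x \<in> E" for x
      using mult[of "inv\<^bsub>G\<^esub> g" g x] g that one by simp
    show "\<phi> g (\<phi> (inv\<^bsub>G\<^esub> g) x) = x" if "x \<in> E" for x
      using mult[of g "inv\<^bsub>G\<^esub> g" x] g that one by simp
  qed (use closed g in auto)
  have Bij: "\<phi> g \<in> Bij E" if "g \<in> carrier G" for g
    using bij ext that by (auto simp: Bij_def)
  have "\<phi> \<in> hom G (BijGroup E)"
    unfolding hom_def
  proof (intro CollectI conjI ballI)
    show "\<phi> \<in> carrier G \<rightarrow> carrier (BijGroup E)" using Bij by (simp add: BijGroup_def)
    fix g h assume gh: "g \<in> carrier G" "h \<in> carrier G"
    show "\<phi> (g \<otimes>\<^bsub>G\<^esub> h) = \<phi> g \<otimes>\<^bsub>BijGroup E\<^esub> \<phi> h"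
    proof (rule extensionalityI[where A = E])
      show "\<phi> (g \<otimes>\<^bsub>G\<^esub> h) \<in> extensional E" using ext gh by simp
    qed (use gh Bij mult in \<open>auto simp: BijGroup_def compose_def\<close>)
  qed
  then show ?thesis
    by (simp add: group_action_def group_hom_def group_hom_axioms_def G group_BijGroup)
qed

lemma actionD:
  assumes "jointly_continuous_action G T X \<alpha>"
  shows "group_action G (topspace X) \<alpha>"
    and "continuous_map (prod_topology T X) X (\<lambda>(g, x). \<alpha> g x)"
    and "g \<in> carrier G \<Longrightarrow> x \<in> topspace X \<Longrightarrow> \<alpha> g x \<in> topspace X"
    and "x \<in> topspace X \<Longrightarrow> \<alpha> \<one>\<^bsub>G\<^esub> x = x"
    and "g \<in> carrier G \<Longrightarrow> h \<in> carrier G \<Longrightarrow> x \<in> topspace X \<Longrightarrow> \<alpha> (g \<otimes>\<^bsub>G\<^esub> h) x = \<alpha> g (\<alpha> h x)"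
proof -
  show act: "group_action G (topspace X) \<alpha>" and "continuous_map (prod_topology T X) X (\<lambda>(g, x). \<alpha> g x)"
    using assms by (auto simp: jointly_continuous_action_def)
  interpret group_action G "topspace X" \<alpha> by (rule act)
  show "g \<in> carrier G \<Longrightarrow> x \<in> topspace X \<Longrightarrow> \<alpha> g x \<in> topspace X"
    using element_image by blast
  show "x \<in> topspace X \<Longrightarrow> \<alpha> \<one>\<^bsub>G\<^esub> x = x"
    using id_eq_one by (metis restrict_apply')
  show "g \<in> carrier G \<Longrightarrow> h \<in> carrier G \<Longrightarrow> x \<in> topspace X \<Longrightarrow> \<alpha> (g \<otimes>\<^bsub>G\<^esub> h) x = \<alpha> g (\<alpha> h x)"
    using composition_rule by blast
qed

lemma action_continuous_point:
  assumes "jointly_continuous_action G T X \<alpha>" "x \<in> topspace X"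
  shows "continuous_map T X (\<lambda>g. \<alpha> g x)"
proof -
  have "continuous_map T (prod_topology T X) (\<lambda>g. (g, x))"
    using assms(2) by (simp add: continuous_map_pairedI)
  from continuous_map_compose[OF this actionD(2)[OF assms(1)]] show ?thesis by (simp add: comp_def)
qed

lemma action_continuous_element:
  assumes "jointly_continuous_action G T X \<alpha>" "g \<in> topspace T"
  shows "continuous_map X X (\<alpha> g)"
proof -
  have "continuous_map X (prod_topology T X) (\<lambda>x. (g, x))"
    using assms(2) by (simp add: continuous_map_pairedI)
  from continuous_map_compose[OF this actionD(2)[OF assms(1)]] show ?thesis by (simp add: comp_def)
qed

lemma emeasure_action_preimage:
  assumes "invariant_measure G \<alpha> \<mu>" "sets \<mu> = sets (borel_of X)" "g \<in> carrier G" "A \<in> sets \<mu>"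
  shows "emeasure \<mu> {x \<in> topspace X. \<alpha> g x \<in> A} = emeasure \<mu> A"
proof -
  have sp: "space \<mu> = topspace X" using sets_eq_imp_space_eq[OF assms(2)] by simp
  have "\<alpha> g \<in> \<mu> \<rightarrow>\<^sub>M \<mu>" "distr \<mu> \<mu> (\<alpha> g) = \<mu>"
    using assms(1,3) by (auto simp: invariant_measure_def)
  then have "emeasure \<mu> A = emeasure \<mu> (\<alpha> g -` A \<inter> space \<mu>)"
    using emeasure_distr assms(4) by metis
  also have "\<alpha> g -` A \<inter> space \<mu> = {x \<in> topspace X. \<alpha> g x \<in> A}" by (auto simp: sp)
  finally show ?thesis by simp
qed

lemma Int_stable_openin: "Int_stable {U. openin X U}"
  by (auto simp: Int_stable_def)

lemma borel_of_measure_eqI: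
  assumes "sets M = sets (borel_of X)" "sets N = sets (borel_of X)" "finite_measure M"
    and "\<And>U. openin X U \<Longrightarrow> emeasure M U = emeasure N U"
  shows "M = N"
proof (rule measure_eqI_generator_eq[OF Int_stable_openin[of X]])
  show "emeasure M (topspace X) \<noteq> \<infinity>" for i :: nat
    using finite_measure.emeasure_finite[OF assms(3)] by simp
qed (use assms in \<open>auto simp: sets_borel_of dest: openin_subset\<close>)

text \<open>If \<open>d i\<close> tends to \<open>g\<close>, every point that \<open>g\<close> sends
  into an open set \<open>U\<close> is sent into \<open>U\<close> by all late \<open>d i\<close>, so
  a Fatou argument bounds the mass of the preimage of \<open>U\<close> by that of \<open>U\<close>.
  The same bound for \<open>inv g\<close> gives equality.\<close>

lemma (in lcsc_group) invariant_measure_if_dense: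
  assumes act: "jointly_continuous_action G T X \<alpha>"
    and sets: "sets \<mu> = sets (borel_of X)" and fin: "finite_measure \<mu>"
    and D: "D \<subseteq> carrier G" "\<And>U. openin T U \<Longrightarrow> U \<noteq> {} \<Longrightarrow> D \<inter> U \<noteq> {}"
    and inv: "\<And>d A. d \<in> D \<Longrightarrow> A \<in> sets \<mu> \<Longrightarrow> emeasure \<mu> {x \<in> topspace X. \<alpha> d x \<in> A} = emeasure \<mu> A"
  shows "invariant_measure G \<alpha> \<mu>"
  unfolding invariant_measure_def
proof (intro ballI conjI)
  interpret finite_measure \<mu> by fact
  note act_simps = actionD(3-5)[OF act]
  have sp: "space \<mu> = topspace X" using sets_eq_imp_space_eq[OF sets] by simp
  have meas: "\<alpha> g \<in> \<mu> \<rightarrow>\<^sub>M \<mu>" if "g \<in> carrier G" for g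
    using continuous_map_measurable[OF action_continuous_element[OF act]] that sets
    by (simp add: topspace_eq cong: measurable_cong_sets)
  then show "\<alpha> g \<in> \<mu> \<rightarrow>\<^sub>M \<mu>" if "g \<in> carrier G" for g using that .
  have open_pre: "openin X {x \<in> topspace X. \<alpha> g x \<in> U}" if "openin X U" "g \<in> carrier G" for g U
    using openin_continuous_map_preimage[OF action_continuous_element[OF act] that(1)] that(2)
    by (simp add: topspace_eq)
  have le: "emeasure \<mu> {x \<in> topspace X. \<alpha> g x \<in> U} \<le> emeasure \<mu> U"
    if U: "openin X U" and g: "g \<in> carrier G" for g U
  proof -
    obtain \<B> where B: "countable \<B>" "\<And>V. V \<in> \<B> \<Longrightarrow> openin T V"
      "\<And>U x. openin T U \<Longrightarrow> x \<in> U \<Longrightarrow> \<exists>V\<in>\<B>. x \<in> V \<and> V \<subseteq> U"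
      using second_countable by (rule second_countableE) (rule that)
    have "{V\<in>\<B>. g \<in> V} \<noteq> {}" using B(3)[of "carrier G" g] g openin_topspace[of T] topspace_eq by auto
    then obtain N :: "nat \<Rightarrow> 'g set" where N: "range N = {V\<in>\<B>. g \<in> V}"
      using range_from_nat_into[of "{V\<in>\<B>. g \<in> V}"] B(1) by (metis countable_Collect)
    have "\<exists>d. d \<in> D \<inter> (\<Inter>j\<le>i. N j)" for i
    proof -
      have gN: "g \<in> N j" "openin T (N j)" for j using N B(2) by auto
      have "openin T (\<Inter>j\<in>{..i}. N j)" by (rule openin_INT2) (use gN in auto)
      then show ?thesis using D(2)[of "\<Inter>j\<le>i. N j"] gN by fastforce
    qed
    \<comment> \<open>The sets \<open>N j\<close> are the basic neighbourhoods of \<open>g\<close>,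
      and \<open>d i\<close> lies in the first \<open>i + 1\<close> of them, so the sequence
      converges to \<open>g\<close>.\<close>
    then obtain d where d: "\<And>i. d i \<in> D" "\<And>i j. j \<le> i \<Longrightarrow> d i \<in> N j"
      by (metis INT_E IntD1 IntD2 atMost_iff)
    define E where "E n = (\<Inter>i\<in>{n..}. {x \<in> topspace X. \<alpha> (d i) x \<in> U})" for n
    have pre_d: "{x \<in> topspace X. \<alpha> (d i) x \<in> U} \<in> sets \<mu>" for i
      using openin_borel_of[OF open_pre[OF U, of "d i"]] d(1) D(1) sets by auto
    have ES: "E n \<in> sets \<mu>" for n
      unfolding E_def using pre_d by (intro sets.countable_INT') auto
    have "incseq E" by (auto simp: incseq_def E_def)
    have "{x \<in> topspace X. \<alpha> g x \<in> U} \<subseteq> (\<Union>n. E n)"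
    proof clarify
      fix x assume x: "x \<in> topspace X" "\<alpha> g x \<in> U"
      have "openin T {h \<in> topspace T. \<alpha> h x \<in> U}"
        by (rule openin_continuous_map_preimage[OF action_continuous_point[OF act x(1)] U])
      then obtain V where V: "V \<in> \<B>" "g \<in> V" "V \<subseteq> {h \<in> topspace T. \<alpha> h x \<in> U}"
        using B(3)[of _ g] x g topspace_eq by (metis (no_types, lifting) mem_Collect_eq)
      then obtain j where "V = N j" using N by blast
      then have "x \<in> E j" using d(2)[of j] V(3) x(1) by (auto simp: E_def)
      then show "x \<in> (\<Union>n. E n)" by blast
    qed
    then have "emeasure \<mu> {x \<in> topspace X. \<alpha> g x \<in> U} \<le> emeasure \<mu> (\<Union>n. E n)"
      using ES by (intro emeasure_mono) auto
    also have "\<dots> = (SUP n. emeasure \<mu> (E n))"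
      using ES \<open>incseq E\<close> by (intro SUP_emeasure_incseq[symmetric]) auto
    also have "\<dots> \<le> emeasure \<mu> U"
    proof (rule SUP_least)
      fix n
      have "emeasure \<mu> (E n) \<le> emeasure \<mu> {x \<in> topspace X. \<alpha> (d n) x \<in> U}"
        using pre_d by (intro emeasure_mono) (auto simp: E_def)
      also have "\<dots> = emeasure \<mu> U"
        using inv[OF d(1)] openin_borel_of[OF U] sets by simp
      finally show "emeasure \<mu> (E n) \<le> emeasure \<mu> U" .
    qed
    finally show ?thesis .
  qed
  fix g assume g: "g \<in> carrier G"
  show "distr \<mu> \<mu> (\<alpha> g) = \<mu>"
  proof (rule borel_of_measure_eqI)
    show "finite_measure (distr \<mu> \<mu> (\<alpha> g))" by (rule finite_measure_distr[OF meas[OF g]])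
    fix U assume U: "openin X U"
    let ?P = "{x \<in> topspace X. \<alpha> g x \<in> U}"
    have "{x \<in> topspace X. \<alpha> (inv g) x \<in> ?P} = U"
    proof -
      have "\<alpha> g (\<alpha> (inv g) x) = x" if "x \<in> topspace X" for x
        using act_simps(3)[of g "inv g" x] act_simps(2) g that by simp
      then show ?thesis using openin_subset[OF U] act_simps(1)[of "inv g"] g by auto
    qed
    then have "emeasure \<mu> ?P = emeasure \<mu> U"
      using le[OF U g] le[OF open_pre[OF U g], of "inv g"] g by (simp add: antisym)
    moreover have "emeasure (distr \<mu> \<mu> (\<alpha> g)) U = emeasure \<mu> ?P"
      using openin_borel_of[OF U] sets
      by (subst emeasure_distr[OF meas[OF g]]) (auto simp: sp intro!: arg_cong[where f = "emeasure \<mu>"])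
    ultimately show "emeasure (distr \<mu> \<mu> (\<alpha> g)) U = emeasure \<mu> U" by simp
  qed (use sets in auto)
qed

text \<open>The elements are the words in a countable dense set. Closure under products is what
  later lets a translation act on codes by a mere change of indices; the identity serves for
  decoding.\<close>

lemma (in lcsc_group) countable_dense_monoid:
  obtains \<gamma> :: "nat \<Rightarrow> 'g" where "range \<gamma> \<subseteq> carrier G" "\<one> \<in> range \<gamma>"
    "\<And>i j. \<gamma> i \<otimes> \<gamma> j \<in> range \<gamma>" "\<And>U. openin T U \<Longrightarrow> U \<noteq> {} \<Longrightarrow> range \<gamma> \<inter> U \<noteq> {}"
proof -
  obtain C where C: "countable C" "C \<subseteq> topspace T" "\<And>U. openin T U \<Longrightarrow> U \<noteq> {} \<Longrightarrow> C \<inter> U \<noteq> {}"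
    by (rule countable_closure_dense[OF second_countable]) (rule that)
  let ?w = "\<lambda>l. foldr (\<otimes>) l \<one>"
  define D where "D = ?w ` lists C"
  have CG: "C \<subseteq> carrier G" using C(2) topspace_eq by simp
  have wG: "?w l \<in> carrier G" if "l \<in> lists C" for l
    using that by (induction l) (use CG in auto)
  have app: "?w (k @ l) = ?w k \<otimes> ?w l" if "k \<in> lists C" "l \<in> lists C" for k l
    using that(1)
  proof (induction k)
    case (Cons a k)
    then have "a \<in> carrier G" "?w k \<in> carrier G" "?w l \<in> carrier G" using CG wG that(2) by auto
    then show ?case using Cons by (simp add: m_assoc)
  qed (use wG[OF that(2)] in simp)
  have "countable D" unfolding D_def using C(1) by (intro countable_image countable_lists)
  have "\<one> \<in> D" unfolding D_def by (rule image_eqI[of _ _ "[]"]) auto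
  then obtain \<gamma> :: "nat \<Rightarrow> 'g" where \<gamma>: "range \<gamma> = D"
    using range_from_nat_into[of D] \<open>countable D\<close> by (metis empty_iff)
  show ?thesis
  proof (rule that[of \<gamma>])
    show "range \<gamma> \<subseteq> carrier G" using wG by (auto simp: \<gamma> D_def)
    show "\<one> \<in> range \<gamma>" using \<open>\<one> \<in> D\<close> \<gamma> by simp
    fix i j
    have "\<gamma> i \<in> D" "\<gamma> j \<in> D" using \<gamma> by auto
    then obtain k l where "k \<in> lists C" "l \<in> lists C" "\<gamma> i = ?w k" "\<gamma> j = ?w l"
      unfolding D_def by auto
    then show "\<gamma> i \<otimes> \<gamma> j \<in> range \<gamma>"
      unfolding \<gamma> D_def using app by (intro image_eqI[of _ _ "k @ l"]) auto
  next
    fix U assume "openin T U" "U \<noteq> {}"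
    then obtain c where "c \<in> C" "c \<in> U" using C(3) by blast
    moreover have "c \<in> D" unfolding D_def using \<open>c \<in> C\<close> CG by (intro image_eqI[of _ _ "[c]"]) auto
    ultimately show "range \<gamma> \<inter> U \<noteq> {}" using \<gamma> by blast
  qed
qed

section \<open>Coding a Polish G-space in Cantor space\<close>

lemma measurable_cantor_coordinate: "{c. c k} \<in> sets (borel_of cantor_topology)"
proof (rule openin_borel_of)
  have "{c :: nat \<Rightarrow> bool. c k} \<in> cylinder_algebra"
    by (auto simp: cylinder_algebra_def depends_below_def agree_below_def intro!: exI[of _ "Suc k"])
  then show "openin cantor_topology {c. c k}" by (rule openin_cantor_algebra)
qed

lemma measurable_cantor_componentwise:
  assumes "\<And>k. {x \<in> space M. f x k} \<in> sets M"
  shows "f \<in> M \<rightarrow>\<^sub>M borel_of cantor_topology"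
proof (rule measurable_cantorI)
  fix A assume "A \<in> cylinder_algebra"
  then obtain F where F: "finite F" "A = \<Union>(cylinder ` F)" by (rule cylinder_algebraE)
  have k: "{x \<in> space M. f x k = b} \<in> sets M" for k b
  proof (cases b)
    case False
    then have "{x \<in> space M. f x k = b} = space M - {x \<in> space M. f x k}" by auto
    then show ?thesis using assms by auto
  qed (use assms in simp)
  define P where "P s = {x \<in> space M. \<forall>i\<in>{..<length s}. f x i = s ! i}" for s
  have P: "P s \<in> sets M" for s
    unfolding P_def by (rule sets.sets_Collect_finite_All) (rule k, simp)
  have "(\<Union>s\<in>F. P s) \<in> sets M"
    by (rule sets.finite_UN[OF F(1) P])
  moreover have "f -` cylinder s \<inter> space M = P s" for s
    by (auto simp: cylinder_def P_def)
  then have "f -` A \<inter> space M = (\<Union>s\<in>F. P s)"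
    unfolding F(2) by blast
  ultimately show "f -` A \<inter> space M \<in> sets M" by simp
qed

lemma cylinder_algebra_reindex:
  assumes "A \<in> cylinder_algebra"
  shows "(\<lambda>c k. c (g k)) -` A \<in> cylinder_algebra"
proof -
  obtain n where n: "depends_below n A" using assms by (auto simp: cylinder_algebra_def)
  obtain m where m: "\<And>k. k < n \<Longrightarrow> g k < m"
    using finite_nat_set_iff_bounded[of "g ` {..<n}"] by auto
  have "depends_below m ((\<lambda>c k. c (g k)) -` A)"
    unfolding depends_below_def
  proof (intro allI impI)
    fix c c' :: "nat \<Rightarrow> bool"
    assume "agree_below m c c'" "c \<in> (\<lambda>c k. c (g k)) -` A"
    then show "c' \<in> (\<lambda>c k. c (g k)) -` A"
      using depends_belowD[OF n, of "\<lambda>k. c (g k)" "\<lambda>k. c' (g k)"] m by (simp add: agree_below_def)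
  qed
  then show ?thesis by (auto simp: cylinder_algebra_def)
qed

text \<open>A real number is recovered from the set of rationals above it. The value
  \<open>\<top>\<close> stands in for the rationals outside that set, so that they do not influence
  the infimum; \<open>from_nat\<close> enumerates the rationals.\<close>

lemma INF_rationals_above:
  fixes a :: real
  assumes "0 \<le> a"
  shows "(INF s. if a < real_of_rat (from_nat s) then ennreal (real_of_rat (from_nat s)) else \<top>) = ennreal a"
    (is "(INF s. ?f s) = _")
proof (rule antisym)
  show "(INF s. ?f s) \<le> ennreal a"
  proof (rule ennreal_le_epsilon)
    fix e :: real assume "0 < e"
    then obtain q where q: "a < real_of_rat q" "real_of_rat q < a + e"
      using of_rat_dense[of a "a + e"] by auto
    obtain s :: nat where s: "q = from_nat s" using surj_from_nat by (metis surjD)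
    have "(INF s. ?f s) \<le> ?f s" by (rule INF_lower) simp
    also have "\<dots> = ennreal (real_of_rat q)" using q s by simp
    also have "\<dots> \<le> ennreal (a + e)" using q by (intro ennreal_leI) simp
    finally show "(INF s. ?f s) \<le> ennreal a + ennreal e"
      using assms \<open>0 < e\<close> by (simp add: ennreal_plus)
  qed
  show "ennreal a \<le> (INF s. ?f s)"
    by (rule INF_greatest) (auto intro: ennreal_leI)
qed

text \<open>A point \<open>x\<close> is coded by the rational upper cuts of the coordinates of
  \<open>u\<close> at all translates of \<open>x\<close> by the monoid. On codes each
  \<open>\<gamma> j\<close> acts by reindexing, a continuous map of Cantor space, so the compactness
  argument there applies. The measure found there charges a compact set of valid codes, and the
  action preserves validity; by ergodicity almost every code is valid, and decoding yields the
  measure on \<open>X\<close>.\<close>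

theorem (in lcsc_group) ergodic_measure_exists:
  fixes X :: "'a topology"
  assumes X: "polish_space X" and act: "jointly_continuous_action G T X \<alpha>"
    and sets: "sets \<sigma> = sets (borel_of X)" and fin: "finite_measure \<sigma>"
    and inv: "invariant_measure G \<alpha> \<sigma>"
    and C: "C \<in> sets \<sigma>" "emeasure \<sigma> C > 0"
  obtains \<sigma>' where "sets \<sigma>' = sets (borel_of X)" "prob_space \<sigma>'" "invariant_measure G \<alpha> \<sigma>'"
    "ergodic_measure G \<alpha> \<sigma>'" "emeasure \<sigma>' C > 0"
proof -
  interpret \<sigma>: finite_measure \<sigma> by fact
  note act_simps = actionD(3-5)[OF act]
  have sp: "space \<sigma> = topspace X" using sets_eq_imp_space_eq[OF sets] by simp
  have "C \<noteq> {}" using C(2) by auto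
  then have ne: "topspace X \<noteq> {}" using sets.sets_into_space[OF C(1)] sp by auto
  obtain u :: "'a \<Rightarrow> nat \<Rightarrow> real" and v where
    u: "u \<in> borel_measurable (borel_of X)" and v: "v \<in> borel \<rightarrow>\<^sub>M borel_of X"
    and vu: "\<And>x. x \<in> topspace X \<Longrightarrow> v (u x) = x" and u_nonneg: "\<And>x n. x \<in> topspace X \<Longrightarrow> 0 \<le> u x n"
    by (rule polish_space_embedding[OF X ne]) (rule that)
  obtain \<gamma> :: "nat \<Rightarrow> 'g" where \<gamma>: "range \<gamma> \<subseteq> carrier G" "\<one> \<in> range \<gamma>"
    "\<And>i j. \<gamma> i \<otimes> \<gamma> j \<in> range \<gamma>" "\<And>U. openin T U \<Longrightarrow> U \<noteq> {} \<Longrightarrow> range \<gamma> \<inter> U \<noteq> {}"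
    by (rule countable_dense_monoid) (rule that)
  have \<gamma>G: "\<gamma> i \<in> carrier G" for i using \<gamma>(1) by auto
  obtain i0 where i0: "\<gamma> i0 = \<one>" using \<gamma>(2) by auto
  have "\<exists>\<pi>. \<forall>j i. \<gamma> i \<otimes> \<gamma> j = \<gamma> (\<pi> j i)"
    using \<gamma>(3) by (intro choice allI) (metis rangeE)
  then obtain \<pi> where \<pi>: "\<And>j i. \<gamma> i \<otimes> \<gamma> j = \<gamma> (\<pi> j i)" by blast
  \<comment> \<open>A coordinate of a code is a triple: an element of the monoid, a coordinate of
    the embedding and a rational. \<open>I\<close>, \<open>N\<close> and \<open>S\<close> read off
    the three entries.\<close>
  define code :: "nat \<Rightarrow> nat \<Rightarrow> nat \<Rightarrow> nat" where "code i n s = prod_encode (i, prod_encode (n, s))" for i n s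
  define I where "I k = fst (prod_decode k)" for k
  define N where "N k = fst (prod_decode (snd (prod_decode k)))" for k
  define S where "S k = snd (prod_decode (snd (prod_decode k)))" for k
  define Q :: "nat \<Rightarrow> real" where "Q s = real_of_rat (from_nat s)" for s
  have code [simp]: "I (code i n s) = i" "N (code i n s) = n" "S (code i n s) = s" for i n s
    by (auto simp: I_def N_def S_def code_def)
  define e where "e x k \<longleftrightarrow> u (\<alpha> (\<gamma> (I k)) x) (N k) < Q (S k)" for x k
  \<comment> \<open>Decoding reads the block of the identity element \<open>\<gamma> i0\<close>,
    which holds the cuts of \<open>u x\<close> itself.\<close>
  define w where "w c n = enn2real (INF s. if c (code i0 n s) then ennreal (Q s) else \<top>)" for c n
  define \<delta> where "\<delta> c = v (w c)" for c
  \<comment> \<open>The image of \<open>e\<close>, described as the fixed points of the Borel map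
    that decodes and encodes again; this makes it Borel.\<close>
  define Ecode where "Ecode = {c. e (\<delta> c) = c}"
  \<comment> \<open>Block \<open>i\<close> of the code of the translate of \<open>x\<close> by
    \<open>\<gamma> j\<close> is block \<open>\<pi> j i\<close> of the code of \<open>x\<close>,
    because \<open>\<gamma> i \<otimes> \<gamma> j = \<gamma> (\<pi> j i)\<close>.\<close>
  define \<theta> where "\<theta> j c = (\<lambda>k. c (code (\<pi> j (I k)) (N k) (S k)))" for j and c :: "nat \<Rightarrow> bool"
  have \<alpha>m: "\<alpha> g \<in> borel_of X \<rightarrow>\<^sub>M borel_of X" if "g \<in> carrier G" for g
    using that by (intro continuous_map_measurable action_continuous_element[OF act]) (simp add: topspace_eq)
  have u_coord: "(\<lambda>x. u x n) \<in> borel_measurable (borel_of X)" for n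
  proof -
    have "(\<lambda>y :: nat \<Rightarrow> real. y n) \<in> borel_measurable borel"
      by (rule borel_measurable_continuous_onI) simp
    from measurable_compose[OF u this] show ?thesis .
  qed
  have e: "e \<in> borel_of X \<rightarrow>\<^sub>M borel_of cantor_topology"
  proof (rule measurable_cantor_componentwise)
    fix k
    have "(\<lambda>x. u (\<alpha> (\<gamma> (I k)) x) (N k)) \<in> borel_measurable (borel_of X)"
      by (rule measurable_compose[OF \<alpha>m[OF \<gamma>G] u_coord])
    then show "{x \<in> space (borel_of X). e x k} \<in> sets (borel_of X)"
      unfolding e_def borel_measurable_iff_less by blast
  qed
  have w: "w \<in> borel_measurable (borel_of cantor_topology)"
  proof (rule measurable_into_product)
    fix n
    have "Measurable.pred (borel_of cantor_topology) (\<lambda>c. c k)" for k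
      using measurable_cantor_coordinate by (simp add: pred_def)
    then show "(\<lambda>c. w c n) \<in> borel_measurable (borel_of cantor_topology)"
      unfolding w_def by measurable
  qed
  have \<delta>: "\<delta> \<in> borel_of cantor_topology \<rightarrow>\<^sub>M borel_of X"
    unfolding \<delta>_def by (rule measurable_compose[OF w v])
  have \<delta>X: "\<delta> c \<in> topspace X" for c
    using measurable_space[OF \<delta>, of c] by simp
  have e_act: "e (\<alpha> (\<gamma> j) x) = \<theta> j (e x)" if "x \<in> topspace X" for j x
    using act_simps(3)[OF \<gamma>G \<gamma>G that] by (auto simp: fun_eq_iff e_def \<theta>_def \<pi>[symmetric])
  have \<delta>e: "\<delta> (e x) = x" if x: "x \<in> topspace X" for x
  proof -
    have "e x (code i0 n s) \<longleftrightarrow> u x n < Q s" for n s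
      using act_simps(2)[OF x] by (simp add: e_def i0)
    then have "w (e x) n = u x n" for n
      using INF_rationals_above[OF u_nonneg[OF x]] u_nonneg[OF x]
      unfolding w_def Q_def by simp
    then have "w (e x) = u x" by auto
    then show ?thesis using vu[OF x] by (simp add: \<delta>_def)
  qed
  have eEcode: "e x \<in> Ecode" if "x \<in> topspace X" for x
    using \<delta>e[OF that] by (simp add: Ecode_def)
  have Ecode: "Ecode \<in> sets (borel_of cantor_topology)"
  proof -
    have "{c. e (\<delta> c) k = c k} \<in> sets (borel_of cantor_topology)" for k
    proof -
      have "{c. e (\<delta> c) k} = (\<lambda>c. e (\<delta> c)) -` {c. c k} \<inter> space (borel_of cantor_topology)" by auto
      also have "\<dots> \<in> sets (borel_of cantor_topology)"
        by (rule measurable_sets[OF measurable_compose[OF \<delta> e] measurable_cantor_coordinate])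
      finally have a: "{c. e (\<delta> c) k} \<in> sets (borel_of cantor_topology)" .
      let ?A = "{c. e (\<delta> c) k}" and ?B = "{c :: nat \<Rightarrow> bool. c k}"
      have "(?A \<inter> ?B) \<union> (space (borel_of cantor_topology) - (?A \<union> ?B)) \<in> sets (borel_of cantor_topology)"
        by (intro sets.Un sets.Int sets.compl_sets a measurable_cantor_coordinate)
      moreover have "(?A \<inter> ?B) \<union> (space (borel_of cantor_topology) - (?A \<union> ?B)) = {c. e (\<delta> c) k = c k}"
        by auto
      ultimately show ?thesis by simp
    qed
    then have "(\<Inter>k. {c. e (\<delta> c) k = c k}) \<in> sets (borel_of cantor_topology)"
      by (intro sets.countable_INT'') (auto simp: sets.top[of "borel_of cantor_topology", simplified])
    moreover have "Ecode = (\<Inter>k. {c. e (\<delta> c) k = c k})" by (auto simp: Ecode_def fun_eq_iff)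
    ultimately show ?thesis by simp
  qed
  have Ecode\<theta>: "Ecode \<subseteq> \<theta> j -` Ecode" for j
  proof
    fix c assume "c \<in> Ecode"
    then have c: "e (\<delta> c) = c" by (simp add: Ecode_def)
    have "\<theta> j c = e (\<alpha> (\<gamma> j) (\<delta> c))" using e_act[OF \<delta>X, of j c] c by simp
    then show "c \<in> \<theta> j -` Ecode" using eEcode[OF act_simps(1)[OF \<gamma>G \<delta>X]] by simp
  qed
  have \<theta>_pre: "\<theta> j -` A \<in> cylinder_algebra" if "A \<in> cylinder_algebra" for j A
    unfolding \<theta>_def by (rule cylinder_algebra_reindex[OF that])
  define s where "s = emeasure \<sigma> (space \<sigma>)"
  have s: "0 < s" "s < \<top>"
  proof -
    show "0 < s"
      unfolding s_def using C(2) emeasure_mono[OF sets.sets_into_space[OF C(1)] sets.top] by (rule less_le_trans)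
    show "s < \<top>"
      unfolding s_def using \<sigma>.emeasure_finite[of "space \<sigma>"] by (metis infinity_ennreal_def less_top)
  qed
  define \<sigma>1 where "\<sigma>1 = scale_measure (1 / s) \<sigma>"
  have \<sigma>1: "prob_space \<sigma>1" "sets \<sigma>1 = sets (borel_of X)" "space \<sigma>1 = topspace X"
    using s by (auto simp: \<sigma>1_def space_scale_measure sp sets ennreal_divide_times s_def
        intro!: prob_spaceI)
  have e1: "e \<in> \<sigma>1 \<rightarrow>\<^sub>M borel_of cantor_topology" using e \<sigma>1(2) by (simp cong: measurable_cong_sets)
  define \<tau>\<^sub>0 where "\<tau>\<^sub>0 = distr \<sigma>1 (borel_of cantor_topology) e"
  have \<tau>0: "sets \<tau>\<^sub>0 = sets (borel_of cantor_topology)" "prob_space \<tau>\<^sub>0"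
    unfolding \<tau>\<^sub>0_def using prob_space.prob_space_distr[OF \<sigma>1(1) e1] by auto
  have em0: "emeasure \<tau>\<^sub>0 A = (1 / s) * emeasure \<sigma> {x \<in> topspace X. e x \<in> A}"
    if "A \<in> sets (borel_of cantor_topology)" for A
    unfolding \<tau>\<^sub>0_def using that
    by (subst emeasure_distr[OF e1]) (auto simp: \<sigma>1_def space_scale_measure sp vimage_def Int_def conj_commute)
  have inv0: "measure \<tau>\<^sub>0 (\<theta> j -` A) = measure \<tau>\<^sub>0 A" if A: "A \<in> cylinder_algebra" for j A
  proof -
    have AS: "A \<in> sets (borel_of cantor_topology)" "\<theta> j -` A \<in> sets (borel_of cantor_topology)"
      by (intro openin_borel_of openin_cantor_algebra \<theta>_pre A)+
    have B: "{x \<in> topspace X. e x \<in> A} \<in> sets \<sigma>"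
      using measurable_sets[OF e AS(1)] sets by (simp add: vimage_def Int_def conj_commute)
    have "{x \<in> topspace X. e x \<in> \<theta> j -` A} = {x \<in> topspace X. \<alpha> (\<gamma> j) x \<in> {x \<in> topspace X. e x \<in> A}}"
      using e_act act_simps(1)[OF \<gamma>G] by auto
    then have "emeasure \<tau>\<^sub>0 (\<theta> j -` A) = emeasure \<tau>\<^sub>0 A"
      using emeasure_action_preimage[OF inv sets \<gamma>G B] AS by (simp add: em0)
    then show ?thesis by (simp add: measure_def)
  qed
  define eC where "eC = Ecode \<inter> (\<delta> -` C \<inter> space (borel_of cantor_topology))"
  have eC: "eC \<in> sets \<tau>\<^sub>0"
    unfolding eC_def \<tau>0(1) by (rule sets.Int[OF Ecode measurable_sets[OF \<delta>]]) (use C(1) sets in simp)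
  have "{x \<in> topspace X. e x \<in> eC} = C"
    using sets.sets_into_space[OF C(1)] \<delta>e eEcode by (auto simp: eC_def sp)
  then have "emeasure \<tau>\<^sub>0 eC > 0"
    using em0[of eC] eC C(2) s by (simp add: \<tau>0(1) ennreal_zero_less_mult_iff ennreal_zero_less_divide)
  \<comment> \<open>The maximisation needs a closed set to charge. One that consists of valid codes
    of points of \<open>C\<close> ensures that the new measure charges the valid codes, and
    \<open>C\<close> after decoding.\<close>
  then obtain K where K: "K \<subseteq> eC" "compactin cantor_topology K" "emeasure \<tau>\<^sub>0 K > 0"
    by (rule polish_compact_subset[OF polish_space_cantor \<tau>0(1) prob_space.axioms(1)[OF \<tau>0(2)] eC]) (rule that)
  have Kc: "closedin cantor_topology K"
    by (rule compactin_imp_closedin[OF polish_imp_Hausdorff[OF polish_space_cantor] K(2)])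
  interpret \<tau>0: prob_space \<tau>\<^sub>0 by (rule \<tau>0(2))
  have posK: "measure \<tau>\<^sub>0 K > 0" using K(3) by (simp add: \<tau>0.emeasure_eq_measure)
  have "\<exists>\<tau>. sets \<tau> = sets (borel_of cantor_topology) \<and> prob_space \<tau> \<and>
      (\<forall>j. \<forall>A\<in>sets \<tau>. measure \<tau> (\<theta> j -` A) = measure \<tau> A) \<and> measure \<tau> K > 0 \<and>
      (\<forall>A\<in>sets \<tau>. (\<forall>j. A \<subseteq> \<theta> j -` A) \<longrightarrow> measure \<tau> A = 0 \<or> measure \<tau> A = 1)"
    by (rule cantor_ergodic_measure[where \<theta> = \<theta>, OF \<theta>_pre \<tau>0(1,2) inv0 Kc posK]) blast+
  then obtain \<tau> where \<tau>: "sets \<tau> = sets (borel_of cantor_topology)" "prob_space \<tau>"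
    "\<And>j A. A \<in> sets \<tau> \<Longrightarrow> measure \<tau> (\<theta> j -` A) = measure \<tau> A" "measure \<tau> K > 0"
    "\<And>A. A \<in> sets \<tau> \<Longrightarrow> (\<And>j. A \<subseteq> \<theta> j -` A) \<Longrightarrow> measure \<tau> A = 0 \<or> measure \<tau> A = 1"
    by auto
  interpret \<tau>: prob_space \<tau> by fact
  have \<tau>sp: "space \<tau> = UNIV" using sets_eq_imp_space_eq[OF \<tau>(1)] by simp
  have Ecode\<tau>: "Ecode \<in> sets \<tau>" using Ecode \<tau>(1) by simp
  have "measure \<tau> K \<le> measure \<tau> Ecode"
    using K(1) Ecode\<tau> by (intro \<tau>.finite_measure_mono) (auto simp: eC_def)
  \<comment> \<open>The valid codes contain \<open>K\<close>, so their measure is positive, and they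
    are forward invariant, so it is 1.\<close>
  then have Ecode1: "measure \<tau> Ecode = 1" using \<tau>(4) \<tau>(5)[OF Ecode\<tau> Ecode\<theta>] by linarith
  have restrict_code: "measure \<tau> (A \<inter> Ecode) = measure \<tau> A" if "A \<in> sets \<tau>" for A
  proof -
    have "measure \<tau> (A - Ecode) \<le> measure \<tau> (space \<tau> - Ecode)"
      using sets.compl_sets[OF Ecode\<tau>] by (intro \<tau>.finite_measure_mono) (auto simp: \<tau>sp)
    also have "\<dots> = 0" using \<tau>.prob_compl[OF Ecode\<tau>] Ecode1 by simp
    finally have "measure \<tau> (A - Ecode) = 0" by (simp add: measure_le_0_iff)
    moreover have "measure \<tau> A = measure \<tau> (A \<inter> Ecode) + measure \<tau> (A - Ecode)"
      using \<tau>.finite_measure_Union[of "A \<inter> Ecode" "A - Ecode"] that Ecode\<tau> by (simp add: Int_Diff_Un Int_Diff_disjoint)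
    ultimately show ?thesis by simp
  qed
  have \<delta>\<tau>: "\<delta> \<in> \<tau> \<rightarrow>\<^sub>M borel_of X" using \<delta> \<tau>(1) by (simp cong: measurable_cong_sets)
  define \<sigma>' where "\<sigma>' = distr \<tau> (borel_of X) \<delta>"
  have sets': "sets \<sigma>' = sets (borel_of X)" by (simp add: \<sigma>'_def)
  have prob': "prob_space \<sigma>'" unfolding \<sigma>'_def by (rule \<tau>.prob_space_distr[OF \<delta>\<tau>])
  interpret \<sigma>': prob_space \<sigma>' by (rule prob')
  have sp': "space \<sigma>' = topspace X" by (simp add: \<sigma>'_def)
  have em': "measure \<sigma>' A = measure \<tau> (\<delta> -` A)" if "A \<in> sets (borel_of X)" for A
    unfolding \<sigma>'_def using that by (subst measure_distr[OF \<delta>\<tau>]) (auto simp: \<tau>sp)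
  have \<delta>S: "\<delta> -` A \<in> sets \<tau>" if "A \<in> sets (borel_of X)" for A
    using measurable_sets[OF \<delta>\<tau> that] by (simp add: \<tau>sp)
  have \<delta>\<theta>: "\<delta> (\<theta> j c) = \<alpha> (\<gamma> j) (\<delta> c)" if "c \<in> Ecode" for c j
    using that e_act[OF \<delta>X, of j c] \<delta>e[OF act_simps(1)[OF \<gamma>G \<delta>X], of j c] by (simp add: Ecode_def)
  have inv': "invariant_measure G \<alpha> \<sigma>'"
  proof (rule invariant_measure_if_dense[OF act sets' _ \<gamma>(1,4)])
    show "finite_measure \<sigma>'" by (rule \<sigma>'.finite_measure_axioms)
    fix d A assume "d \<in> range \<gamma>" and A: "A \<in> sets \<sigma>'"
    then obtain j where j: "d = \<gamma> j" by auto
    let ?B = "{x \<in> topspace X. \<alpha> d x \<in> A}"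
    have A': "A \<in> sets (borel_of X)" using A sets' by simp
    have B: "?B \<in> sets (borel_of X)"
      using measurable_sets[OF \<alpha>m[OF \<gamma>G[of j]] A'] by (simp add: j vimage_def Int_def conj_commute)
    have "measure \<sigma>' ?B = measure \<tau> (\<delta> -` ?B \<inter> Ecode)"
      using em'[OF B] restrict_code[OF \<delta>S[OF B]] by simp
    also have "\<delta> -` ?B \<inter> Ecode = \<theta> j -` (\<delta> -` A) \<inter> Ecode"
      using \<delta>\<theta> \<delta>X by (auto simp: j)
    also have "measure \<tau> (\<theta> j -` (\<delta> -` A) \<inter> Ecode) = measure \<tau> (\<theta> j -` (\<delta> -` A))"
    proof (rule restrict_code)
      have "\<theta> j \<in> borel_of cantor_topology \<rightarrow>\<^sub>M borel_of cantor_topology"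
        by (rule measurable_cantorI) (simp add: \<theta>_pre openin_borel_of openin_cantor_algebra)
      then have "\<theta> j \<in> \<tau> \<rightarrow>\<^sub>M \<tau>" using \<tau>(1) by (simp cong: measurable_cong_sets)
      from measurable_sets[OF this \<delta>S[OF A']] show "\<theta> j -` (\<delta> -` A) \<in> sets \<tau>" by (simp add: \<tau>sp)
    qed
    also have "\<dots> = measure \<sigma>' A" using \<tau>(3)[OF \<delta>S[OF A']] em'[OF A'] by simp
    finally show "emeasure \<sigma>' ?B = emeasure \<sigma>' A" by (simp add: \<sigma>'.emeasure_eq_measure)
  qed
  have erg': "ergodic_measure G \<alpha> \<sigma>'"
    unfolding ergodic_measure_def
  proof (intro ballI impI)
    fix A assume A: "A \<in> sets \<sigma>'" and invA: "invariant_set G \<alpha> A"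
    have A': "A \<in> sets (borel_of X)" using A sets' by simp
    have "\<delta> -` A \<inter> Ecode \<subseteq> \<theta> j -` (\<delta> -` A \<inter> Ecode)" for j
    proof
      fix c assume c: "c \<in> \<delta> -` A \<inter> Ecode"
      have "\<alpha> (\<gamma> j) (\<delta> c) \<in> A" using c invA \<gamma>G by (auto simp: invariant_set_def)
      then show "c \<in> \<theta> j -` (\<delta> -` A \<inter> Ecode)" using \<delta>\<theta> c Ecode\<theta> by auto
    qed
    then have "measure \<tau> (\<delta> -` A \<inter> Ecode) = 0 \<or> measure \<tau> (\<delta> -` A \<inter> Ecode) = 1"
      using \<delta>S[OF A'] Ecode\<tau> by (intro \<tau>(5)) auto
    then have "measure \<sigma>' A = 0 \<or> measure \<sigma>' A = 1"
      using restrict_code[OF \<delta>S[OF A']] em'[OF A'] by simp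
    then show "emeasure \<sigma>' A = 0 \<or> emeasure \<sigma>' (space \<sigma>' - A) = 0"
      using \<sigma>'.prob_compl[OF A] by (auto simp: \<sigma>'.emeasure_eq_measure)
  qed
  have "measure \<tau> K \<le> measure \<tau> (\<delta> -` C)"
    using K(1) \<delta>S C(1) sets by (intro \<tau>.finite_measure_mono) (auto simp: eC_def)
  then have "emeasure \<sigma>' C > 0"
    using \<tau>(4) em'[of C] C(1) sets by (simp add: \<sigma>'.emeasure_eq_measure)
  then show ?thesis using that[of \<sigma>'] sets' prob' inv' erg' by blast
qed

section \<open>Haar measure and return sets\<close>

context lcsc_group
begin

lemma continuous_map_multI:
  assumes "continuous_map S T f" "continuous_map S T g"
  shows "continuous_map S T (\<lambda>x. f x \<otimes> g x)"
proof -
  have "continuous_map S (prod_topology T T) (\<lambda>x. (f x, g x))"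
    using assms by (rule continuous_map_pairedI)
  from continuous_map_compose[OF this continuous_mult] show ?thesis by (simp add: comp_def)
qed

lemma continuous_map_invI:
  assumes "continuous_map S T f"
  shows "continuous_map S T (\<lambda>x. inv (f x))"
  using continuous_map_compose[OF assms continuous_inv] by (simp add: comp_def)

lemma continuous_map_left_mult: "g \<in> carrier G \<Longrightarrow> continuous_map T T (\<lambda>x. g \<otimes> x)"
  by (intro continuous_map_multI) (auto simp: topspace_eq)

lemma continuous_map_right_mult: "g \<in> carrier G \<Longrightarrow> continuous_map T T (\<lambda>x. x \<otimes> g)"
  by (intro continuous_map_multI) (auto simp: topspace_eq)

lemma compact_nhd:
  assumes "openin T U" "g \<in> U"
  obtains V K where "openin T V" "compactin T K" "g \<in> V" "V \<subseteq> K" "K \<subseteq> U"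
proof -
  have "neighbourhood_base_of (compactin T) T"
    using locally_compact Hausdorff locally_compact_space_neighbourhood_base by blast
  then have "\<exists>V K. openin T V \<and> compactin T K \<and> g \<in> V \<and> V \<subseteq> K \<and> K \<subseteq> U"
    using assms unfolding neighbourhood_base_of by blast
  then show ?thesis using that by auto
qed

lemma sigma_compact:
  obtains L :: "nat \<Rightarrow> 'g set" where "\<And>n. compactin T (L n)" "(\<Union>n. L n) = carrier G"
proof -
  obtain \<B> where B: "countable \<B>" "\<And>V. V \<in> \<B> \<Longrightarrow> openin T V"
    "\<And>U x. openin T U \<Longrightarrow> x \<in> U \<Longrightarrow> \<exists>V\<in>\<B>. x \<in> V \<and> V \<subseteq> U"
    using second_countable by (rule second_countableE) (rule that)
  define \<C> where "\<C> = {V\<in>\<B>. \<exists>K. compactin T K \<and> V \<subseteq> K}"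
  have cover: "\<exists>V\<in>\<C>. g \<in> V" if g: "g \<in> carrier G" for g
  proof -
    obtain V K where VK: "openin T V" "compactin T K" "g \<in> V" "V \<subseteq> K" "K \<subseteq> topspace T"
      by (rule compact_nhd[OF openin_topspace, of g]) (use g topspace_eq in auto)
    obtain V' where "V' \<in> \<B>" "g \<in> V'" "V' \<subseteq> V" using B(3)[OF VK(1,3)] by auto
    then show ?thesis using VK by (auto simp: \<C>_def)
  qed
  then have "\<C> \<noteq> {}" using one_closed by blast
  moreover have "countable \<C>" using B(1) by (simp add: \<C>_def)
  ultimately obtain W :: "nat \<Rightarrow> 'g set" where W: "range W = \<C>"
    by (metis range_from_nat_into)
  have "W n \<in> \<C>" for n using W by auto
  then have "\<forall>n. \<exists>K. compactin T K \<and> W n \<subseteq> K" by (simp add: \<C>_def)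
  then obtain L where L: "\<And>n. compactin T (L n)" "\<And>n. W n \<subseteq> L n" by metis
  show ?thesis
  proof (rule that[of L])
    show "(\<Union>n. L n) = carrier G"
    proof
      show "(\<Union>n. L n) \<subseteq> carrier G" using compactin_subset_topspace[OF L(1)] topspace_eq by auto
      show "carrier G \<subseteq> (\<Union>n. L n)" using cover L(2) W by blast
    qed
  qed (rule L)
qed

end

text \<open>Invariance is stated through preimages of translations, which avoids set translates.\<close>

locale bi_invariant_measure = lcsc_group G T for G :: "'g monoid" (structure) and T :: "'g topology" +
  fixes m :: "'g measure"
  assumes sets_m: "sets m = sets (borel_of T)"
    and sigma_finite_m: "sigma_finite_measure m"
    and left_invariant: "g \<in> carrier G \<Longrightarrow> A \<in> sets m \<Longrightarrow> emeasure m {x \<in> carrier G. g \<otimes> x \<in> A} = emeasure m A"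
    and right_invariant: "g \<in> carrier G \<Longrightarrow> A \<in> sets m \<Longrightarrow> emeasure m {x \<in> carrier G. x \<otimes> g \<in> A} = emeasure m A"
begin

lemma space_m: "space m = carrier G"
  using sets_eq_imp_space_eq[OF sets_m] by (simp add: topspace_eq)

lemma compactin_sets_m: "compactin T K \<Longrightarrow> K \<in> sets m"
  using compactin_borel_of[OF Hausdorff] sets_m by simp

end

text \<open>This is \<open>U\<^sup>-\<^sup>1 A\<close> in the usual notation. In this form it is the
  projection of a condition on pairs of a time and a point, which is closed when \<open>A\<close>
  is.\<close>

definition hit :: "('h \<Rightarrow> 's \<Rightarrow> 's) \<Rightarrow> 's topology \<Rightarrow> 'h set \<Rightarrow> 's set \<Rightarrow> 's set" where
  "hit \<beta> X U A = {x \<in> topspace X. \<exists>n\<in>U. \<beta> n x \<in> A}"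

lemma hit_UN: "hit \<beta> X U (\<Union>i\<in>J. A i) = (\<Union>i\<in>J. hit \<beta> X U (A i))"
  by (auto simp: hit_def)

lemma hit_UN_left: "hit \<beta> X (\<Union>i\<in>J. U i) A = (\<Union>i\<in>J. hit \<beta> X (U i) A)"
  by (auto simp: hit_def)

text \<open>The pairs form the projection of a closed set along the compact set \<open>U\<close>.
  The condition on \<open>\<kappa> (n, b)\<close> serves the comparison of two windows of times,
  where \<open>b\<close> is a translation and \<open>\<kappa>\<close> is
  \<open>n \<otimes> b\<close> or \<open>n \<otimes> inv b\<close>.\<close>

lemma closedin_hit_pairs:
  assumes act: "jointly_continuous_action H T X \<beta>" and U: "compactin T U" and A: "closedin X A"
    and \<kappa>: "continuous_map (prod_topology T S) R \<kappa>" and B: "closedin R B"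
  shows "closedin (prod_topology X S) {(x, b). x \<in> topspace X \<and> b \<in> topspace S \<and> (\<exists>n\<in>U. \<beta> n x \<in> A \<and> \<kappa> (n, b) \<in> B)}"
proof -
  let ?P = "prod_topology T (prod_topology X S)"
  have f1: "continuous_map ?P (prod_topology T X) (\<lambda>p. (fst p, fst (snd p)))"
    by (intro continuous_map_pairedI continuous_map_fst continuous_map_compose[OF continuous_map_snd continuous_map_fst, unfolded comp_def])
  have f2: "continuous_map ?P (prod_topology T S) (\<lambda>p. (fst p, snd (snd p)))"
    by (intro continuous_map_pairedI continuous_map_fst continuous_map_compose[OF continuous_map_snd continuous_map_snd, unfolded comp_def])
  have g1: "continuous_map ?P X (\<lambda>p. \<beta> (fst p) (fst (snd p)))"
    using continuous_map_compose[OF f1 actionD(2)[OF act]] by (simp add: comp_def)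
  have g2: "continuous_map ?P R (\<lambda>p. \<kappa> (fst p, snd (snd p)))"
    using continuous_map_compose[OF f2 \<kappa>] by (simp add: comp_def)
  let ?C = "{p \<in> topspace ?P. \<beta> (fst p) (fst (snd p)) \<in> A} \<inter> {p \<in> topspace ?P. \<kappa> (fst p, snd (snd p)) \<in> B}"
  have "closedin ?P ?C"
    by (intro closedin_Int closedin_continuous_map_preimage[OF g1 A] closedin_continuous_map_preimage[OF g2 B])
  then have "closedin (prod_topology X S) {y. \<exists>n\<in>U. (n, y) \<in> ?C}"
    by (rule closed_projection[OF U])
  moreover have "{y. \<exists>n\<in>U. (n, y) \<in> ?C} =
      {(x, b). x \<in> topspace X \<and> b \<in> topspace S \<and> (\<exists>n\<in>U. \<beta> n x \<in> A \<and> \<kappa> (n, b) \<in> B)}"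
    using compactin_subset_topspace[OF U] by auto
  ultimately show ?thesis by simp
qed

lemma closedin_hit:
  assumes act: "jointly_continuous_action H T X \<beta>" and U: "compactin T U" and A: "closedin X A"
  shows "closedin X (hit \<beta> X U A)"
proof -
  let ?C = "{p \<in> topspace (prod_topology T X). (\<lambda>(g, x). \<beta> g x) p \<in> A}"
  have "closedin (prod_topology T X) ?C"
    by (rule closedin_continuous_map_preimage[OF actionD(2)[OF act] A])
  then have "closedin X {y. \<exists>n\<in>U. (n, y) \<in> ?C}"
    by (rule closed_projection[OF U])
  moreover have "{y. \<exists>n\<in>U. (n, y) \<in> ?C} = hit \<beta> X U A"
    using compactin_subset_topspace[OF U] by (auto simp: hit_def)
  ultimately show ?thesis by simp
qed

lemma fsigma_closed_sequence:
  assumes "fsigma_in X A"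
  obtains C where "\<And>n::nat. closedin X (C n)" "A = (\<Union>n. C n)"
  using assms unfolding fsigma_in_ascending by auto

lemma fsigma_in_UN: "(\<And>n::nat. fsigma_in X (C n)) \<Longrightarrow> fsigma_in X (\<Union>n. C n)"
  by (rule fsigma_in_Union) auto

text \<open>F-sigma sets are a convenient class: they are Borel, they include the orbits of compact
  sets, and by the closed case they are stable under hits with compact windows.\<close>

lemma fsigma_in_hit:
  assumes act: "jointly_continuous_action H T X \<beta>" and U: "compactin T U" and A: "fsigma_in X A"
  shows "fsigma_in X (hit \<beta> X U A)"
proof -
  obtain C where C: "\<And>n::nat. closedin X (C n)" "A = (\<Union>n. C n)"
    using fsigma_closed_sequence[OF A] by metis
  show ?thesis
    unfolding C(2) hit_UN
    by (intro fsigma_in_UN closed_imp_fsigma_in closedin_hit[OF act U] C(1))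
qed

lemma measurable_hit_pairs:
  assumes act: "jointly_continuous_action H T X \<beta>" and U: "compactin T U" and A: "fsigma_in X A"
    and \<kappa>: "continuous_map (prod_topology T S) R \<kappa>" and B: "closedin R B"
    and sc: "second_countable X" "second_countable S"
  shows "{(x, b). x \<in> topspace X \<and> b \<in> topspace S \<and> (\<exists>n\<in>U. \<beta> n x \<in> A \<and> \<kappa> (n, b) \<in> B)} \<in> sets (borel_of X \<Otimes>\<^sub>M borel_of S)"
proof -
  obtain C where C: "\<And>n::nat. closedin X (C n)" "A = (\<Union>n. C n)"
    using fsigma_closed_sequence[OF A] by metis
  have "{(x, b). x \<in> topspace X \<and> b \<in> topspace S \<and> (\<exists>n\<in>U. \<beta> n x \<in> C i \<and> \<kappa> (n, b) \<in> B)} \<in> sets (borel_of X \<Otimes>\<^sub>M borel_of S)" for i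
    unfolding sets_borel_of_prod[OF sc, symmetric]
    by (rule closedin_borel_of[OF closedin_hit_pairs[OF act U C(1) \<kappa> B]])
  then have "(\<Union>i. {(x, b). x \<in> topspace X \<and> b \<in> topspace S \<and> (\<exists>n\<in>U. \<beta> n x \<in> C i \<and> \<kappa> (n, b) \<in> B)}) \<in> sets (borel_of X \<Otimes>\<^sub>M borel_of S)"
    by (intro sets.countable_UN) auto
  moreover have "(\<Union>i. {(x, b). x \<in> topspace X \<and> b \<in> topspace S \<and> (\<exists>n\<in>U. \<beta> n x \<in> C i \<and> \<kappa> (n, b) \<in> B)})
      = {(x, b). x \<in> topspace X \<and> b \<in> topspace S \<and> (\<exists>n\<in>U. \<beta> n x \<in> A \<and> \<kappa> (n, b) \<in> B)}"
    unfolding C(2) by auto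
  ultimately show ?thesis by simp
qed

text \<open>Both sides compute the \<open>\<mu> \<otimes> m\<close>-measure of pairs, up to the translation \<open>x \<mapsto> b x\<close>; this is the
  uniqueness of Haar measure applied to the counting measure of returns to \<open>A\<close>.\<close>

lemma (in bi_invariant_measure) hit_measure_ratio:
  assumes act: "jointly_continuous_action G T X \<beta>" and sc: "second_countable X"
    and sets: "sets \<mu> = sets (borel_of X)" and fin: "finite_measure \<mu>" and inv: "invariant_measure G \<beta> \<mu>"
    and A: "fsigma_in X A" and U: "compactin T U" and U': "compactin T U'"
    and uniq: "\<And>x n n'. x \<in> topspace X \<Longrightarrow> n \<in> U \<Longrightarrow> n' \<in> U \<Longrightarrow> \<beta> n x \<in> A \<Longrightarrow> \<beta> n' x \<in> A \<Longrightarrow> n = n'"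
    and uniq': "\<And>x n n'. x \<in> topspace X \<Longrightarrow> n \<in> U' \<Longrightarrow> n' \<in> U' \<Longrightarrow> \<beta> n x \<in> A \<Longrightarrow> \<beta> n' x \<in> A \<Longrightarrow> n = n'"
  shows "emeasure \<mu> (hit \<beta> X U A) * emeasure m {b \<in> carrier G. inv b \<in> U'} = emeasure \<mu> (hit \<beta> X U' A) * emeasure m U"
proof -
  interpret M: sigma_finite_measure m by (rule sigma_finite_m)
  interpret \<mu>: finite_measure \<mu> by (rule fin)
  interpret pair_sigma_finite \<mu> m ..
  note act_simps = actionD(3-5)[OF act]
  have UG: "U \<subseteq> carrier G" "U' \<subseteq> carrier G"
    using compactin_subset_topspace U U' topspace_eq by auto
  have sp: "space \<mu> = topspace X" using sets_eq_imp_space_eq[OF sets] by simp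
  have pair_sets: "sets (\<mu> \<Otimes>\<^sub>M m) = sets (borel_of X \<Otimes>\<^sub>M borel_of T)"
    by (rule sets_pair_measure_cong[OF sets sets_m])
  let ?W = "{b \<in> carrier G. inv b \<in> U'}"
  \<comment> \<open>The set \<open>?S\<close> records a return at a time \<open>n\<close> in
    \<open>U\<close> together with a translation \<open>b\<close> that shifts this time into
    \<open>U'\<close>; \<open>?S'\<close> is the same configuration seen from
    \<open>\<beta> b x\<close>.\<close>
  let ?S = "{(x, b). x \<in> topspace X \<and> b \<in> topspace T \<and> (\<exists>n\<in>U. \<beta> n x \<in> A \<and> (\<lambda>(n, b). n \<otimes> inv b) (n, b) \<in> U')}"
  let ?S' = "{(x, b). x \<in> topspace X \<and> b \<in> topspace T \<and> (\<exists>n\<in>U'. \<beta> n x \<in> A \<and> (\<lambda>(n, b). n \<otimes> b) (n, b) \<in> U)}"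
  have \<kappa>: "continuous_map (prod_topology T T) T (\<lambda>(n, b). n \<otimes> inv b)"
    "continuous_map (prod_topology T T) T (\<lambda>(n, b). n \<otimes> b)"
    unfolding case_prod_beta
    by (intro continuous_map_multI continuous_map_invI continuous_map_fst continuous_map_snd)+
  have S: "?S \<in> sets (\<mu> \<Otimes>\<^sub>M m)" "?S' \<in> sets (\<mu> \<Otimes>\<^sub>M m)"
    unfolding pair_sets
    by (intro measurable_hit_pairs[OF act _ A \<kappa>(1)] measurable_hit_pairs[OF act _ A \<kappa>(2)] U U' sc second_countable
        compactin_imp_closedin[OF Hausdorff])+
  have hitS: "hit \<beta> X U A \<in> sets \<mu>" "hit \<beta> X U' A \<in> sets \<mu>"
    using fsigma_in_borel_of fsigma_in_hit[OF act] U U' A sets by auto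
  have WS: "?W \<in> sets m"
  proof -
    have "?W = (\<lambda>b. inv b) -` U' \<inter> space m" by (auto simp: space_m)
    also have "\<dots> \<in> sets m"
      using measurable_sets[OF continuous_map_measurable[OF continuous_inv], of U'] compactin_sets_m[OF U'] sets_m
      by (simp add: space_m topspace_eq)
    finally show ?thesis .
  qed
  \<comment> \<open>Over \<open>x\<close> there is at most one return time \<open>n\<close>, so the
    fibre is empty or a right translate of \<open>?W\<close>, whose measure is that of
    \<open>?W\<close> by right invariance.\<close>
  have sec: "emeasure m (Pair x -` ?S) = emeasure m ?W * indicator (hit \<beta> X U A) x" if x: "x \<in> space \<mu>" for x
  proof (cases "x \<in> hit \<beta> X U A")
    case True
    then obtain n where n: "n \<in> U" "\<beta> n x \<in> A" by (auto simp: hit_def)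
    have nG: "n \<in> carrier G" using n UG by auto
    have "Pair x -` ?S = {b \<in> carrier G. n \<otimes> inv b \<in> U'}"
    proof (intro equalityI subsetI)
      fix b assume "b \<in> Pair x -` ?S"
      then obtain n' where n': "b \<in> carrier G" "n' \<in> U" "\<beta> n' x \<in> A" "n' \<otimes> inv b \<in> U'"
        by (auto simp: topspace_eq)
      have "n' = n" using uniq[of x n' n] n n' x sp by simp
      then show "b \<in> {b \<in> carrier G. n \<otimes> inv b \<in> U'}" using n' by simp
    next
      fix b assume "b \<in> {b \<in> carrier G. n \<otimes> inv b \<in> U'}"
      then show "b \<in> Pair x -` ?S" using n x sp by (simp add: topspace_eq) blast
    qed
    also have "\<dots> = {b \<in> carrier G. b \<otimes> inv n \<in> ?W}"
      using nG by (auto simp: inv_mult_group)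
    finally show ?thesis using right_invariant[OF inv_closed[OF nG] WS] True by simp
  next
    case False
    then have empty: "Pair x -` ?S = {}" by (auto simp: hit_def)
    show ?thesis unfolding empty using False by simp
  qed
  have sec': "emeasure m (Pair x -` ?S') = emeasure m U * indicator (hit \<beta> X U' A) x" if x: "x \<in> space \<mu>" for x
  proof (cases "x \<in> hit \<beta> X U' A")
    case True
    then obtain n where n: "n \<in> U'" "\<beta> n x \<in> A" by (auto simp: hit_def)
    have nG: "n \<in> carrier G" using n UG by auto
    have "Pair x -` ?S' = {b \<in> carrier G. n \<otimes> b \<in> U}"
    proof (intro equalityI subsetI)
      fix b assume "b \<in> Pair x -` ?S'"
      then obtain n' where n': "b \<in> carrier G" "n' \<in> U'" "\<beta> n' x \<in> A" "n' \<otimes> b \<in> U"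
        by (auto simp: topspace_eq)
      have "n' = n" using uniq'[of x n' n] n n' x sp by simp
      then show "b \<in> {b \<in> carrier G. n \<otimes> b \<in> U}" using n' by simp
    next
      fix b assume "b \<in> {b \<in> carrier G. n \<otimes> b \<in> U}"
      then show "b \<in> Pair x -` ?S'" using n x sp by (simp add: topspace_eq) blast
    qed
    then show ?thesis using left_invariant[OF nG compactin_sets_m[OF U]] True by simp
  next
    case False
    then have empty: "Pair x -` ?S' = {}" by (auto simp: hit_def)
    show ?thesis unfolding empty using False by simp
  qed
  \<comment> \<open>Reaching \<open>A\<close> from \<open>x\<close> at time \<open>n\<close> is
    reaching it from \<open>\<beta> b x\<close> at time \<open>n \<otimes> inv b\<close>. So the
    fibre of \<open>?S\<close> over \<open>b\<close> is the preimage under \<open>\<beta> b\<close>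
    of that of \<open>?S'\<close>, and \<open>\<mu>\<close> is invariant.\<close>
  have swap: "emeasure \<mu> ((\<lambda>x. (x, b)) -` ?S) = emeasure \<mu> ((\<lambda>x. (x, b)) -` ?S')" if b: "b \<in> space m" for b
  proof -
    have bG: "b \<in> carrier G" using b by (simp add: space_m)
    let ?E = "(\<lambda>x. (x, b)) -` ?S'"
    have E: "?E \<in> sets \<mu>" using sets_Pair2[OF S(2)] .
    have "(\<lambda>x. (x, b)) -` ?S = {x \<in> topspace X. \<beta> b x \<in> ?E}"
    proof (intro equalityI subsetI)
      fix x assume "x \<in> (\<lambda>x. (x, b)) -` ?S"
      then obtain n where n: "x \<in> topspace X" "n \<in> U" "\<beta> n x \<in> A" "n \<otimes> inv b \<in> U'" by auto
      have nG: "n \<in> carrier G" using n UG by auto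
      have nb: "n \<otimes> inv b \<otimes> b = n" using nG bG by (simp add: m_assoc)
      have "\<beta> (n \<otimes> inv b) (\<beta> b x) = \<beta> (n \<otimes> inv b \<otimes> b) x"
        using act_simps(3)[of "n \<otimes> inv b" b x] nG bG n(1) by simp
      then have "\<beta> (n \<otimes> inv b) (\<beta> b x) = \<beta> n x" "n \<otimes> inv b \<otimes> b = n" using nb by simp_all
      then show "x \<in> {x \<in> topspace X. \<beta> b x \<in> ?E}"
        using n bG act_simps(1)[OF bG n(1)] by (simp add: topspace_eq) metis
    next
      fix x assume "x \<in> {x \<in> topspace X. \<beta> b x \<in> ?E}"
      then obtain n where n: "x \<in> topspace X" "n \<in> U'" "\<beta> n (\<beta> b x) \<in> A" "n \<otimes> b \<in> U" by auto
      have nG: "n \<in> carrier G" using n UG by auto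
      have "\<beta> (n \<otimes> b) x = \<beta> n (\<beta> b x)" "n \<otimes> b \<otimes> inv b = n"
        using nG bG n(1) act_simps(3)[of n b x] by (simp_all add: m_assoc)
      then show "x \<in> (\<lambda>x. (x, b)) -` ?S"
        using n bG by (simp add: topspace_eq) metis
    qed
    then show ?thesis using emeasure_action_preimage[OF inv sets bG E] by simp
  qed
  have "emeasure m ?W * emeasure \<mu> (hit \<beta> X U A) = (\<integral>\<^sup>+x. emeasure m (Pair x -` ?S) \<partial>\<mu>)"
    by (simp only: nn_integral_cong[OF sec] nn_integral_cmult_indicator[OF hitS(1)])
  also have "\<dots> = (\<integral>\<^sup>+b. emeasure \<mu> ((\<lambda>x. (x, b)) -` ?S) \<partial>m)"
    by (simp only: M.emeasure_pair_measure_alt[OF S(1), symmetric] emeasure_pair_measure_alt2[OF S(1), symmetric])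
  also have "\<dots> = (\<integral>\<^sup>+b. emeasure \<mu> ((\<lambda>x. (x, b)) -` ?S') \<partial>m)"
    by (rule nn_integral_cong) (rule swap)
  also have "\<dots> = (\<integral>\<^sup>+x. emeasure m (Pair x -` ?S') \<partial>\<mu>)"
    by (simp only: M.emeasure_pair_measure_alt[OF S(2), symmetric] emeasure_pair_measure_alt2[OF S(2), symmetric])
  also have "\<dots> = emeasure m U * emeasure \<mu> (hit \<beta> X U' A)"
    by (simp only: nn_integral_cong[OF sec'] nn_integral_cmult_indicator[OF hitS(2)])
  finally show ?thesis by (simp add: mult.commute)
qed

section \<open>Products\<close>

text \<open>The locale \<open>product_sigma_finite\<close> asks for sigma-finiteness at every index
  of the type, while the families here are controlled on \<open>I\<close>. Putting the measure on
  the empty space elsewhere leaves \<open>PiM I\<close> unchanged.\<close>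

lemma product_sigma_finite_if:
  assumes "\<And>i. i \<in> I \<Longrightarrow> sigma_finite_measure (M i)"
  shows "product_sigma_finite (\<lambda>i. if i \<in> I then M i else count_space {})"
  unfolding product_sigma_finite_def
  using assms by (auto intro: sigma_finite_measure_count_space_finite)

lemma measurable_component:
  "i \<in> I \<Longrightarrow> g \<in> M i \<rightarrow>\<^sub>M N \<Longrightarrow> (\<lambda>x. g (x i)) \<in> PiM I M \<rightarrow>\<^sub>M N"
  by (rule measurable_compose[OF measurable_component_singleton])

lemma PiM_if: "PiM I (\<lambda>i. if i \<in> I then M i else N i) = PiM I M"
  by (rule PiM_cong) auto

lemma PiM_eqI_on:
  assumes I: "finite I" "\<And>i. i \<in> I \<Longrightarrow> sigma_finite_measure (M i)" and P: "sets P = sets (PiM I M)"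
    and eq: "\<And>A. (\<And>i. i \<in> I \<Longrightarrow> A i \<in> sets (M i)) \<Longrightarrow> emeasure P (Pi\<^sub>E I A) = (\<Prod>i\<in>I. emeasure (M i) (A i))"
  shows "P = PiM I M"
proof -
  interpret product_sigma_finite "\<lambda>i. if i \<in> I then M i else count_space {}"
    by (rule product_sigma_finite_if[OF I(2)])
  have "P = PiM I (\<lambda>i. if i \<in> I then M i else count_space {})"
    by (rule PiM_eqI[OF I(1)]) (use P eq in \<open>auto simp: PiM_if\<close>)
  then show ?thesis by (simp add: PiM_if)
qed

lemma emeasure_PiM_on:
  assumes I: "finite I" "\<And>i. i \<in> I \<Longrightarrow> sigma_finite_measure (M i)" and A: "\<And>i. i \<in> I \<Longrightarrow> A i \<in> sets (M i)"
  shows "emeasure (PiM I M) (Pi\<^sub>E I A) = (\<Prod>i\<in>I. emeasure (M i) (A i))"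
proof -
  interpret product_sigma_finite "\<lambda>i. if i \<in> I then M i else count_space {}"
    by (rule product_sigma_finite_if[OF I(2)])
  show ?thesis using emeasure_PiM[OF I(1), of A] A by (simp add: PiM_if)
qed

lemma sigma_finite_PiM_on:
  assumes I: "finite I" "\<And>i. i \<in> I \<Longrightarrow> sigma_finite_measure (M i)"
  shows "sigma_finite_measure (PiM I M)"
proof -
  interpret product_sigma_finite "\<lambda>i. if i \<in> I then M i else count_space {}"
    by (rule product_sigma_finite_if[OF I(2)])
  show ?thesis using sigma_finite[OF I(1)] by (simp add: PiM_if)
qed

lemma nn_integral_PiM_prod_on:
  assumes I: "finite I" "\<And>i. i \<in> I \<Longrightarrow> sigma_finite_measure (M i)"
    and f: "\<And>i. i \<in> I \<Longrightarrow> f i \<in> borel_measurable (M i)"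
  shows "(\<integral>\<^sup>+x. (\<Prod>i\<in>I. f i (x i)) \<partial>PiM I M) = (\<Prod>i\<in>I. integral\<^sup>N (M i) (f i))"
proof -
  interpret product_sigma_finite "\<lambda>i. if i \<in> I then M i else count_space {}"
    by (rule product_sigma_finite_if[OF I(2)])
  show ?thesis using product_nn_integral_prod[OF I(1), of f] f by (simp add: PiM_if)
qed

lemma measurable_componentwise:
  assumes "\<And>i. i \<in> I \<Longrightarrow> f i \<in> M i \<rightarrow>\<^sub>M N i"
  shows "(\<lambda>x. \<lambda>i\<in>I. f i (x i)) \<in> PiM I M \<rightarrow>\<^sub>M PiM I N"
  by (rule measurable_restrict, rule measurable_component, assumption, rule assms)

lemma distr_PiM_componentwise:
  assumes I: "finite I" "\<And>i. i \<in> I \<Longrightarrow> sigma_finite_measure (M i)"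
    and f: "\<And>i. i \<in> I \<Longrightarrow> f i \<in> M i \<rightarrow>\<^sub>M N i"
    and sf: "\<And>i. i \<in> I \<Longrightarrow> sigma_finite_measure (distr (M i) (N i) (f i))"
  shows "distr (PiM I M) (PiM I N) (\<lambda>x. \<lambda>i\<in>I. f i (x i)) = PiM I (\<lambda>i. distr (M i) (N i) (f i))"
proof (rule PiM_eqI_on[OF I(1) sf])
  show "sets (distr (PiM I M) (PiM I N) (\<lambda>x. \<lambda>i\<in>I. f i (x i))) = sets (PiM I (\<lambda>i. distr (M i) (N i) (f i)))"
    by (simp cong: sets_PiM_cong)
  fix A assume A: "\<And>i. i \<in> I \<Longrightarrow> A i \<in> sets (distr (M i) (N i) (f i))"
  have pre: "(\<lambda>x. \<lambda>i\<in>I. f i (x i)) -` Pi\<^sub>E I A \<inter> space (PiM I M) = Pi\<^sub>E I (\<lambda>i. f i -` A i \<inter> space (M i))"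
    by (auto simp: space_PiM PiE_iff)
  have "emeasure (distr (PiM I M) (PiM I N) (\<lambda>x. \<lambda>i\<in>I. f i (x i))) (Pi\<^sub>E I A)
      = emeasure (PiM I M) (Pi\<^sub>E I (\<lambda>i. f i -` A i \<inter> space (M i)))"
    using A I(1) by (subst emeasure_distr) (auto simp: pre intro!: measurable_componentwise f sets_PiM_I_finite)
  also have "\<dots> = (\<Prod>i\<in>I. emeasure (M i) (f i -` A i \<inter> space (M i)))"
    using A by (intro emeasure_PiM_on I) (auto intro!: measurable_sets[OF f])
  also have "\<dots> = (\<Prod>i\<in>I. emeasure (distr (M i) (N i) (f i)) (A i))"
    using A by (intro prod.cong refl) (simp add: emeasure_distr f)
  finally show "emeasure (distr (PiM I M) (PiM I N) (\<lambda>x. \<lambda>i\<in>I. f i (x i))) (Pi\<^sub>E I A)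
      = (\<Prod>i\<in>I. emeasure (distr (M i) (N i) (f i)) (A i))" .
qed

text \<open>On boxes this is Fubini: the integral of a product of functions of separate coordinates
  factors.\<close>

lemma PiM_density:
  assumes I: "finite I" "\<And>i. i \<in> I \<Longrightarrow> sigma_finite_measure (M i)"
    and f: "\<And>i. i \<in> I \<Longrightarrow> f i \<in> borel_measurable (M i)"
    and sf: "\<And>i. i \<in> I \<Longrightarrow> sigma_finite_measure (density (M i) (f i))"
  shows "density (PiM I M) (\<lambda>x. \<Prod>i\<in>I. f i (x i)) = PiM I (\<lambda>i. density (M i) (f i))"
proof (rule PiM_eqI_on[OF I(1) sf])
  show "sets (density (PiM I M) (\<lambda>x. \<Prod>i\<in>I. f i (x i))) = sets (PiM I (\<lambda>i. density (M i) (f i)))"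
    by (simp cong: sets_PiM_cong)
  fix A assume "\<And>i. i \<in> I \<Longrightarrow> A i \<in> sets (density (M i) (f i))"
  then have A: "\<And>i. i \<in> I \<Longrightarrow> A i \<in> sets (M i)" by simp
  have prod_f: "(\<lambda>x. \<Prod>i\<in>I. f i (x i)) \<in> borel_measurable (PiM I M)"
    by (intro borel_measurable_prod_ennreal measurable_component f) auto
  have ind: "indicator (Pi\<^sub>E I A) x = (\<Prod>i\<in>I. indicator (A i) (x i) :: ennreal)" if "x \<in> space (PiM I M)" for x
  proof (cases "\<forall>i\<in>I. x i \<in> A i")
    case True
    then show ?thesis using that by (auto simp: space_PiM PiE_iff indicator_def)
  next
    case False
    then obtain i where "i \<in> I" "x i \<notin> A i" by auto
    then have "(\<Prod>i\<in>I. indicator (A i) (x i) :: ennreal) = 0"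
      using I(1) by (intro prod_zero bexI[of _ i]) auto
    moreover have "x \<notin> Pi\<^sub>E I A" using False by auto
    ultimately show ?thesis by simp
  qed
  have "emeasure (density (PiM I M) (\<lambda>x. \<Prod>i\<in>I. f i (x i))) (Pi\<^sub>E I A)
      = (\<integral>\<^sup>+x. (\<Prod>i\<in>I. f i (x i)) * indicator (Pi\<^sub>E I A) x \<partial>PiM I M)"
    using A I(1) by (intro emeasure_density prod_f) (auto intro!: sets_PiM_I_finite)
  also have "\<dots> = (\<integral>\<^sup>+x. (\<Prod>i\<in>I. f i (x i) * indicator (A i) (x i)) \<partial>PiM I M)"
    by (intro nn_integral_cong) (simp add: ind prod.distrib)
  also have "\<dots> = (\<Prod>i\<in>I. \<integral>\<^sup>+x. f i x * indicator (A i) x \<partial>M i)"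
    using A f by (intro nn_integral_PiM_prod_on[OF I, where f = "\<lambda>i x. f i x * indicator (A i) x"]) auto
  also have "\<dots> = (\<Prod>i\<in>I. emeasure (density (M i) (f i)) (A i))"
    using A f by (intro prod.cong refl) (simp add: emeasure_density)
  finally show "emeasure (density (PiM I M) (\<lambda>x. \<Prod>i\<in>I. f i (x i))) (Pi\<^sub>E I A)
      = (\<Prod>i\<in>I. emeasure (density (M i) (f i)) (A i))" .
qed

section \<open>Haar measure of the group and of its finite powers\<close>

context lcsc_group
begin

lemma haar_sigma_finite:
  assumes "haar_measure G T m"
  shows "sigma_finite_measure m"
proof -
  have m: "sets m = sets (borel_of T)" "\<And>K. compactin T K \<Longrightarrow> emeasure m K < \<infinity>"
    using assms by (auto simp: haar_measure_def)
  have sp: "space m = carrier G" using sets_eq_imp_space_eq[OF m(1)] topspace_eq by simp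
  obtain L :: "nat \<Rightarrow> 'g set" where L: "\<And>n. compactin T (L n)" "(\<Union>n. L n) = carrier G"
    by (rule sigma_compact) (rule that)
  show ?thesis
  proof
    show "\<exists>A. countable A \<and> A \<subseteq> sets m \<and> \<Union>A = space m \<and> (\<forall>a\<in>A. emeasure m a \<noteq> \<infinity>)"
      using L m(1) compactin_borel_of[OF Hausdorff] sp less_imp_neq[OF m(2)[OF L(1)]]
      by (intro exI[of _ "range L"]) auto
  qed
qed

text \<open>The preimage of \<open>A\<close> under translation by \<open>g\<close> is the translate
  of \<open>A\<close> by \<open>inv g\<close>, so invariance for translates becomes invariance for
  preimages; unimodularity supplies the right-hand version.\<close>

lemma haar_bi_invariant:
  assumes haar: "haar_measure G T m" and uni: "unimodular G T"
  shows "bi_invariant_measure G T m"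
  unfolding bi_invariant_measure_def bi_invariant_measure_axioms_def
proof (intro conjI allI impI)
  show "lcsc_group G T" by unfold_locales
  show sets: "sets m = sets (borel_of T)" using haar by (simp add: haar_measure_def)
  have left: "emeasure m (g <# A) = emeasure m A" if "g \<in> carrier G" "A \<in> sets m" for g A
    using haar that by (simp add: haar_measure_def)
  have right: "emeasure m (A #> g) = emeasure m A" if "g \<in> carrier G" "A \<in> sets m" for g A
    using uni haar that by (simp add: unimodular_def)
  show "sigma_finite_measure m" by (rule haar_sigma_finite[OF haar])
  fix g A assume g: "g \<in> carrier G" and A: "A \<in> sets m"
  have AG: "A \<subseteq> carrier G" using sets.sets_into_space[OF A] sets_eq_imp_space_eq[OF sets] topspace_eq by simp
  have "{x \<in> carrier G. g \<otimes> x \<in> A} = inv g <# A"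
  proof (intro equalityI subsetI)
    fix x assume "x \<in> {x \<in> carrier G. g \<otimes> x \<in> A}"
    moreover from this have "x = inv g \<otimes> (g \<otimes> x)" using g by (simp add: m_assoc[symmetric])
    ultimately show "x \<in> inv g <# A" by (auto simp: l_coset_def)
  next
    fix x assume "x \<in> inv g <# A"
    then obtain a where "a \<in> A" "x = inv g \<otimes> a" by (auto simp: l_coset_def)
    moreover from this have "a \<in> carrier G" using AG by auto
    ultimately show "x \<in> {x \<in> carrier G. g \<otimes> x \<in> A}" using g by (simp add: m_assoc[symmetric])
  qed
  then show "emeasure m {x \<in> carrier G. g \<otimes> x \<in> A} = emeasure m A"
    using left[OF inv_closed[OF g] A] by simp
  have "{x \<in> carrier G. x \<otimes> g \<in> A} = A #> inv g"
  proof (intro equalityI subsetI)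
    fix x assume "x \<in> {x \<in> carrier G. x \<otimes> g \<in> A}"
    moreover from this have "x = x \<otimes> g \<otimes> inv g" using g by (simp add: m_assoc)
    ultimately show "x \<in> A #> inv g" by (auto simp: r_coset_def)
  next
    fix x assume "x \<in> A #> inv g"
    then obtain a where "a \<in> A" "x = a \<otimes> inv g" by (auto simp: r_coset_def)
    moreover from this have "a \<in> carrier G" using AG by auto
    ultimately show "x \<in> {x \<in> carrier G. x \<otimes> g \<in> A}" using g by (simp add: m_assoc)
  qed
  then show "emeasure m {x \<in> carrier G. x \<otimes> g \<in> A} = emeasure m A"
    using right[OF inv_closed[OF g] A] by simp
qed

text \<open>The translates of \<open>U\<close> by a countable dense set cover the group; if
  \<open>U\<close> were null, the whole space would be null.\<close>

lemma haar_open_pos: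
  assumes haar: "haar_measure G T m" and U: "openin T U" "U \<noteq> {}"
  shows "emeasure m U > 0"
proof (rule ccontr)
  have sets: "sets m = sets (borel_of T)" using haar by (simp add: haar_measure_def)
  have sp: "space m = carrier G" using sets_eq_imp_space_eq[OF sets] topspace_eq by simp
  have US: "U \<in> sets m" using openin_borel_of[OF U(1)] sets by simp
  assume "\<not> emeasure m U > 0"
  then have U0: "emeasure m U = 0" by (simp add: zero_less_iff_neq_zero)
  obtain \<gamma> :: "nat \<Rightarrow> 'g" where \<gamma>: "range \<gamma> \<subseteq> carrier G" "\<one> \<in> range \<gamma>"
    "\<And>i j. \<gamma> i \<otimes> \<gamma> j \<in> range \<gamma>" "\<And>U. openin T U \<Longrightarrow> U \<noteq> {} \<Longrightarrow> range \<gamma> \<inter> U \<noteq> {}"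
    by (rule countable_dense_monoid) (rule that)
  have UG: "U \<subseteq> carrier G" using openin_subset[OF U(1)] topspace_eq by simp
  have \<gamma>U: "\<gamma> i <# U \<in> null_sets m" for i
  proof -
    have \<gamma>G: "\<gamma> i \<in> carrier G" using \<gamma>(1) by auto
    have "\<gamma> i <# U = {x \<in> topspace T. inv (\<gamma> i) \<otimes> x \<in> U}"
    proof (intro equalityI subsetI)
      fix x assume "x \<in> \<gamma> i <# U"
      then obtain a where "a \<in> U" "x = \<gamma> i \<otimes> a" by (auto simp: l_coset_def)
      moreover from this have "a \<in> carrier G" using UG by auto
      ultimately show "x \<in> {x \<in> topspace T. inv (\<gamma> i) \<otimes> x \<in> U}"
        using \<gamma>G topspace_eq by (simp add: m_assoc[symmetric])
    next
      fix x assume x: "x \<in> {x \<in> topspace T. inv (\<gamma> i) \<otimes> x \<in> U}"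
      then have "x = \<gamma> i \<otimes> (inv (\<gamma> i) \<otimes> x)" using \<gamma>G topspace_eq by (simp add: m_assoc[symmetric])
      then show "x \<in> \<gamma> i <# U" using x by (auto simp: l_coset_def)
    qed
    moreover have "openin T {x \<in> topspace T. inv (\<gamma> i) \<otimes> x \<in> U}"
      by (rule openin_continuous_map_preimage[OF continuous_map_left_mult U(1)]) (simp add: \<gamma>G)
    ultimately have "\<gamma> i <# U \<in> sets m" using openin_borel_of sets by simp
    moreover have "emeasure m (\<gamma> i <# U) = 0"
      using haar \<gamma>G US U0 by (simp add: haar_measure_def)
    ultimately show ?thesis by auto
  qed
  have "space m \<subseteq> (\<Union>i. \<gamma> i <# U)"
  proof
    fix x assume "x \<in> space m"
    then have x: "x \<in> carrier G" by (simp add: sp)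
    obtain a where a: "a \<in> U" using U(2) by auto
    then have aG: "a \<in> carrier G" using UG by auto
    have cont: "continuous_map T T (\<lambda>g. inv g \<otimes> x)"
      using x by (intro continuous_map_multI continuous_inv) (simp add: topspace_eq)
    have "x \<otimes> inv a \<in> {g \<in> topspace T. inv g \<otimes> x \<in> U}"
      using x aG a by (simp add: topspace_eq inv_mult_group m_assoc)
    then have "range \<gamma> \<inter> {g \<in> topspace T. inv g \<otimes> x \<in> U} \<noteq> {}"
      by (intro \<gamma>(4) openin_continuous_map_preimage[OF cont U(1)]) auto
    then obtain i where i: "\<gamma> i \<in> carrier G" "inv (\<gamma> i) \<otimes> x \<in> U" using topspace_eq by auto
    then have "x = \<gamma> i \<otimes> (inv (\<gamma> i) \<otimes> x)" using x by (simp add: m_assoc[symmetric])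
    then show "x \<in> (\<Union>i. \<gamma> i <# U)" using i(2) by (auto simp: l_coset_def)
  qed
  then have "emeasure m (space m) \<le> emeasure m (\<Union>i. \<gamma> i <# U)"
    using \<gamma>U by (intro emeasure_mono) auto
  also have "\<dots> = 0" using null_sets_UN[of "\<lambda>i. \<gamma> i <# U" m] \<gamma>U by auto
  finally show False using haar by (simp add: haar_measure_def)
qed

lemma lcsc_group_product:
  assumes "finite J"
  shows "lcsc_group (product_group J (\<lambda>_. G)) (product_topology (\<lambda>_. T) J)"
proof -
  let ?H = "product_group J (\<lambda>_. G)" and ?T = "product_topology (\<lambda>_. T) J"
  interpret H: group ?H by (rule product_group) (rule is_group)
  show ?thesis
  proof
    show top: "topspace ?T = carrier ?H" by (simp add: topspace_eq)
    show "continuous_map (prod_topology ?T ?T) ?T (\<lambda>(g, h). g \<otimes>\<^bsub>?H\<^esub> h)"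
      unfolding continuous_map_componentwise
    proof (intro conjI ballI)
      fix k assume k: "k \<in> J"
      have "continuous_map (prod_topology ?T ?T) T (\<lambda>p. fst p k \<otimes> snd p k)"
        by (intro continuous_map_multI
            continuous_map_compose[OF continuous_map_fst continuous_map_product_projection[OF k], unfolded comp_def]
            continuous_map_compose[OF continuous_map_snd continuous_map_product_projection[OF k], unfolded comp_def])
      then show "continuous_map (prod_topology ?T ?T) T (\<lambda>x. (case x of (g, h) \<Rightarrow> g \<otimes>\<^bsub>?H\<^esub> h) k)"
        using k by (simp add: case_prod_beta)
    qed auto
    have "continuous_map ?T ?T (\<lambda>g. \<lambda>i\<in>J. inv (g i))"
      unfolding continuous_map_componentwise
    proof (intro conjI ballI)
      fix k assume k: "k \<in> J"
      then show "continuous_map ?T T (\<lambda>x. (\<lambda>i\<in>J. inv (x i)) k)"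
        using continuous_map_invI[OF continuous_map_product_projection[OF k]] by simp
    qed auto
    then show "continuous_map ?T ?T (\<lambda>g. inv\<^bsub>?H\<^esub> g)"
      by (rule continuous_map_eq) (auto simp: topspace_eq is_group)
    show "Hausdorff_space ?T" by (simp add: Hausdorff_space_product_topology Hausdorff)
    show "locally_compact_space ?T"
      using assms by (simp add: locally_compact_space_product_topology locally_compact)
    show "Abstract_Topological_Spaces.second_countable ?T"
      by (rule second_countable_product_finite[OF assms second_countable])
  qed
qed

end

text \<open>Translations act coordinatewise, so they preserve the product measure on boxes and hence
  everywhere. With \<open>J = {2..r}\<close> this is the Haar measure of the kernel
  \<open>N\<^sub>1\<close>.\<close>

lemma (in bi_invariant_measure) bi_invariant_product:
  assumes fin: "finite J"
  shows "bi_invariant_measure (product_group J (\<lambda>_. G)) (product_topology (\<lambda>_. T) J) (PiM J (\<lambda>_. m))"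
proof -
  let ?H = "product_group J (\<lambda>_. G)" and ?T = "product_topology (\<lambda>_. T) J" and ?M = "PiM J (\<lambda>_. m)"
  interpret H: lcsc_group ?H ?T by (rule lcsc_group_product[OF fin])
  have sp: "space ?M = carrier ?H" by (simp add: space_PiM space_m)
  have comp: "emeasure ?M {x \<in> carrier ?H. (\<lambda>i\<in>J. f i (x i)) \<in> A} = emeasure ?M A"
    if A: "A \<in> sets ?M" and f: "\<And>i. i \<in> J \<Longrightarrow> f i \<in> m \<rightarrow>\<^sub>M m" "\<And>i. i \<in> J \<Longrightarrow> distr m m (f i) = m" for f A
  proof -
    have "distr ?M ?M (\<lambda>x. \<lambda>i\<in>J. f i (x i)) = PiM J (\<lambda>i. distr m m (f i))"
      by (rule distr_PiM_componentwise) (use fin sigma_finite_m f in auto)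
    also have "\<dots> = ?M" using f(2) by (intro PiM_cong) auto
    finally have "emeasure ?M A = emeasure (distr ?M ?M (\<lambda>x. \<lambda>i\<in>J. f i (x i))) A" by simp
    also have "\<dots> = emeasure ?M ((\<lambda>x. \<lambda>i\<in>J. f i (x i)) -` A \<inter> space ?M)"
      by (rule emeasure_distr[OF measurable_componentwise A]) (use f in auto)
    also have "(\<lambda>x. \<lambda>i\<in>J. f i (x i)) -` A \<inter> space ?M = {x \<in> carrier ?H. (\<lambda>i\<in>J. f i (x i)) \<in> A}"
      by (auto simp: sp)
    finally show ?thesis by simp
  qed
  have meas: "(\<lambda>x. g \<otimes> x) \<in> m \<rightarrow>\<^sub>M m" "(\<lambda>x. x \<otimes> g) \<in> m \<rightarrow>\<^sub>M m" if "g \<in> carrier G" for g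
    using continuous_map_measurable[OF continuous_map_left_mult[OF that]]
      continuous_map_measurable[OF continuous_map_right_mult[OF that]] sets_m
    by (simp_all cong: measurable_cong_sets)
  have distr: "distr m m (\<lambda>x. g \<otimes> x) = m" "distr m m (\<lambda>x. x \<otimes> g) = m" if g: "g \<in> carrier G" for g
  proof -
    show "distr m m (\<lambda>x. g \<otimes> x) = m"
    proof (rule measure_eqI)
      fix A assume "A \<in> sets (distr m m (\<lambda>x. g \<otimes> x))"
      then show "emeasure (distr m m (\<lambda>x. g \<otimes> x)) A = emeasure m A"
        using left_invariant[OF g, of A]
        by (simp add: emeasure_distr[OF meas(1)[OF g]] space_m vimage_def Int_def conj_commute)
    qed simp
    show "distr m m (\<lambda>x. x \<otimes> g) = m"
    proof (rule measure_eqI)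
      fix A assume "A \<in> sets (distr m m (\<lambda>x. x \<otimes> g))"
      then show "emeasure (distr m m (\<lambda>x. x \<otimes> g)) A = emeasure m A"
        using right_invariant[OF g, of A]
        by (simp add: emeasure_distr[OF meas(2)[OF g]] space_m vimage_def Int_def conj_commute)
    qed simp
  qed
  show ?thesis
    unfolding bi_invariant_measure_def bi_invariant_measure_axioms_def
  proof (intro conjI allI impI)
    show "lcsc_group ?H ?T" by unfold_locales
    show "sets ?M = sets (borel_of ?T)"
      using sets_borel_of_product[OF fin second_countable] sets_m by (simp cong: sets_PiM_cong)
    show "sigma_finite_measure ?M" by (rule sigma_finite_PiM_on[OF fin sigma_finite_m])
    fix g A assume g: "g \<in> carrier ?H" and A: "A \<in> sets ?M"
    have gi: "g i \<in> carrier G" if "i \<in> J" for i using g that by auto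
    show "emeasure ?M {x \<in> carrier ?H. g \<otimes>\<^bsub>?H\<^esub> x \<in> A} = emeasure ?M A"
      using comp[OF A, of "\<lambda>i x. g i \<otimes> x"] meas(1) distr(1) gi by simp
    show "emeasure ?M {x \<in> carrier ?H. x \<otimes>\<^bsub>?H\<^esub> g \<in> A} = emeasure ?M A"
      using comp[OF A, of "\<lambda>i x. x \<otimes> g i"] meas(2) distr(2) gi by simp
  qed
qed

text \<open>The maps \<open>\<psi> k\<close> into \<open>G\<close> say how the acting group moves
  each coordinate. The diagonal action, the action of the full power and that of the kernel are its
  three instances.\<close>

definition multi_action :: "'i set \<Rightarrow> ('i \<Rightarrow> 's topology) \<Rightarrow> ('i \<Rightarrow> 'g \<Rightarrow> 's \<Rightarrow> 's) \<Rightarrow> ('i \<Rightarrow> 'h \<Rightarrow> 'g) \<Rightarrow> 'h \<Rightarrow> ('i \<Rightarrow> 's) \<Rightarrow> ('i \<Rightarrow> 's)" where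
  "multi_action I X \<alpha> \<psi> h = (\<lambda>x\<in>topspace (product_topology X I). \<lambda>k\<in>I. \<alpha> k (\<psi> k h) (x k))"

lemma jointly_continuous_multi_action:
  assumes H: "group H" "topspace TH = carrier H"
    and act: "\<And>k. k \<in> I \<Longrightarrow> jointly_continuous_action G T (X k) (\<alpha> k)"
    and \<psi>: "\<And>k. k \<in> I \<Longrightarrow> \<psi> k \<in> hom H G" "\<And>k. k \<in> I \<Longrightarrow> continuous_map TH T (\<psi> k)"
    and G: "group G"
  shows "jointly_continuous_action H TH (product_topology X I) (multi_action I X \<alpha> \<psi>)"
  unfolding jointly_continuous_action_def
proof
  let ?X = "product_topology X I"
  have \<psi>G: "\<psi> k h \<in> carrier G" if "k \<in> I" "h \<in> carrier H" for k h
    using \<psi>(1)[OF that(1)] that(2) by (auto simp: hom_def)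
  have comp: "\<alpha> k (\<psi> k h) (x k) \<in> topspace (X k)" if "k \<in> I" "h \<in> carrier H" "x \<in> topspace ?X" for k h x
    using actionD(3)[OF act[OF that(1)] \<psi>G[OF that(1,2)], of "x k"] that by (auto simp: PiE_iff)
  show "group_action H (topspace ?X) (multi_action I X \<alpha> \<psi>)"
  proof (rule group_actionI[OF H(1)])
    fix g x assume gx: "g \<in> carrier H" "x \<in> topspace ?X"
    show "multi_action I X \<alpha> \<psi> g x \<in> topspace ?X"
      using comp[OF _ gx] gx(2) by (auto simp: multi_action_def)
  next
    fix g assume "g \<in> carrier H"
    show "multi_action I X \<alpha> \<psi> g \<in> extensional (topspace ?X)" by (simp add: multi_action_def)
  next
    fix x assume x: "x \<in> topspace ?X"
    have "\<alpha> k (\<psi> k \<one>\<^bsub>H\<^esub>) (x k) = x k" if "k \<in> I" for k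
      using hom_one[OF \<psi>(1)[OF that] H(1) G] actionD(4)[OF act[OF that], of "x k"] that x
      by (auto simp: PiE_iff)
    then show "multi_action I X \<alpha> \<psi> \<one>\<^bsub>H\<^esub> x = x"
      using x by (auto simp: multi_action_def PiE_iff extensional_def fun_eq_iff)
  next
    fix g h x assume gh: "g \<in> carrier H" "h \<in> carrier H" and x: "x \<in> topspace ?X"
    have "\<alpha> k (\<psi> k (g \<otimes>\<^bsub>H\<^esub> h)) (x k) = \<alpha> k (\<psi> k g) (\<alpha> k (\<psi> k h) (x k))" if "k \<in> I" for k
      using hom_mult[OF \<psi>(1)[OF that] gh] actionD(5)[OF act[OF that] \<psi>G[OF that gh(1)] \<psi>G[OF that gh(2)], of "x k"] that x
      by (auto simp: PiE_iff)
    moreover have "(\<lambda>k\<in>I. \<alpha> k (\<psi> k h) (x k)) \<in> topspace ?X"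
      using comp[OF _ gh(2) x] by auto
    ultimately show "multi_action I X \<alpha> \<psi> (g \<otimes>\<^bsub>H\<^esub> h) x = multi_action I X \<alpha> \<psi> g (multi_action I X \<alpha> \<psi> h x)"
      using x by (auto simp: multi_action_def fun_eq_iff)
  qed
  have "continuous_map (prod_topology TH ?X) ?X (\<lambda>p. \<lambda>k\<in>I. \<alpha> k (\<psi> k (fst p)) (snd p k))"
    unfolding continuous_map_componentwise
  proof (intro conjI ballI)
    fix k assume k: "k \<in> I"
    have "continuous_map (prod_topology TH ?X) (prod_topology T (X k)) (\<lambda>p. (\<psi> k (fst p), snd p k))"
      by (intro continuous_map_pairedI
          continuous_map_compose[OF continuous_map_fst \<psi>(2)[OF k], unfolded comp_def]
          continuous_map_compose[OF continuous_map_snd continuous_map_product_projection[OF k], unfolded comp_def])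
    from continuous_map_compose[OF this actionD(2)[OF act[OF k]]]
    show "continuous_map (prod_topology TH ?X) (X k) (\<lambda>x. (\<lambda>k\<in>I. \<alpha> k (\<psi> k (fst x)) (snd x k)) k)"
      using k by (simp add: comp_def)
  qed auto
  then show "continuous_map (prod_topology TH ?X) ?X (\<lambda>(g, x). multi_action I X \<alpha> \<psi> g x)"
    by (rule continuous_map_eq) (auto simp: multi_action_def)
qed

lemma invariant_measure_multi_action:
  assumes I: "finite I" and \<mu>: "\<And>k. k \<in> I \<Longrightarrow> sets (\<mu> k) = sets (borel_of (X k))" "\<And>k. k \<in> I \<Longrightarrow> prob_space (\<mu> k)"
    and inv: "\<And>k. k \<in> I \<Longrightarrow> invariant_measure G (\<alpha> k) (\<mu> k)"
    and \<psi>: "\<And>k h. k \<in> I \<Longrightarrow> h \<in> carrier H \<Longrightarrow> \<psi> k h \<in> carrier G"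
  shows "invariant_measure H (multi_action I X \<alpha> \<psi>) (PiM I \<mu>)"
  unfolding invariant_measure_def
proof (intro ballI conjI)
  fix h assume h: "h \<in> carrier H"
  have sf: "sigma_finite_measure (\<mu> k)" if "k \<in> I" for k
    using \<mu>(2)[OF that] by (simp add: prob_space_def finite_measure_def)
  have a: "\<alpha> k (\<psi> k h) \<in> \<mu> k \<rightarrow>\<^sub>M \<mu> k" "distr (\<mu> k) (\<mu> k) (\<alpha> k (\<psi> k h)) = \<mu> k" if "k \<in> I" for k
    using inv[OF that] \<psi>[OF that h] by (auto simp: invariant_measure_def)
  have sp: "space (PiM I \<mu>) = topspace (product_topology X I)"
    using sets_eq_imp_space_eq[OF \<mu>(1)] by (auto simp: space_PiM PiE_iff extensional_def)
  have eq: "multi_action I X \<alpha> \<psi> h x = (\<lambda>k\<in>I. \<alpha> k (\<psi> k h) (x k))" if "x \<in> space (PiM I \<mu>)" for x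
    using that by (simp add: sp multi_action_def)
  show "multi_action I X \<alpha> \<psi> h \<in> PiM I \<mu> \<rightarrow>\<^sub>M PiM I \<mu>"
    using measurable_componentwise[of I "\<lambda>k. \<alpha> k (\<psi> k h)" \<mu> \<mu>] a(1) eq by (simp cong: measurable_cong)
  have "distr (PiM I \<mu>) (PiM I \<mu>) (multi_action I X \<alpha> \<psi> h)
      = distr (PiM I \<mu>) (PiM I \<mu>) (\<lambda>x. \<lambda>k\<in>I. \<alpha> k (\<psi> k h) (x k))"
    by (rule distr_cong) (use eq in auto)
  also have "\<dots> = PiM I (\<lambda>k. distr (\<mu> k) (\<mu> k) (\<alpha> k (\<psi> k h)))"
    by (rule distr_PiM_componentwise) (use I a sf in auto)
  also have "\<dots> = PiM I \<mu>" using a(2) by (intro PiM_cong) auto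
  finally show "distr (PiM I \<mu>) (PiM I \<mu>) (multi_action I X \<alpha> \<psi> h) = PiM I \<mu>" .
qed

section \<open>Transverse measures\<close>

lemma nn_integral_count_space_unique:
  assumes "h \<in> A" "\<And>x. x \<in> A \<Longrightarrow> f x = (if x = h then c else 0)"
  shows "(\<integral>\<^sup>+x. f x \<partial>count_space A) = c"
proof -
  have "(\<integral>\<^sup>+x. f x \<partial>count_space A) = (\<integral>\<^sup>+x. c * indicator {h} x \<partial>count_space A)"
    by (rule nn_integral_cong) (use assms(2) in \<open>auto simp: indicator_def\<close>)
  also have "\<dots> = c * emeasure (count_space A) {h}"
    using assms(1) by (intro nn_integral_cmult_indicator) auto
  also have "\<dots> = c" using assms(1) by (simp add: emeasure_count_space)
  finally show ?thesis .
qed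

context bi_invariant_measure
begin

text \<open>Testing the defining identity on the indicator of \<open>P \<times> Z\<close> bounds the
  inner sum by 1, as a point has at most one return time in \<open>P\<close>. Symmetry of
  \<open>P\<close> accounts for the inverse in the identity. With \<open>P\<close> of positive Haar
  measure this makes the transverse measure of a finite measure finite.\<close>

lemma transverse_measure_le:
  assumes tm: "transverse_measure G T m \<alpha> Z \<mu> \<nu>" and Z: "Z \<in> sets \<mu>" and P: "compactin T P"
    and sep: "\<And>h h' s. h \<in> P \<Longrightarrow> h' \<in> P \<Longrightarrow> s \<in> space \<mu> \<Longrightarrow> \<alpha> h s \<in> Z \<Longrightarrow> \<alpha> h' s \<in> Z \<Longrightarrow> h = h'"
    and sym: "\<And>h. h \<in> P \<Longrightarrow> inv h \<in> P"
  shows "emeasure m P * emeasure \<nu> (space \<nu>) \<le> emeasure \<mu> (space \<mu>)"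
proof -
  have PG: "P \<subseteq> carrier G" using compactin_subset_topspace[OF P] topspace_eq by simp
  have PS: "P \<in> sets (borel_of T)" using compactin_sets_m[OF P] sets_m by simp
  have spn: "space \<nu> = Z"
    using tm sets.sets_into_space[OF Z] sets_eq_imp_space_eq[of \<nu> "restrict_space \<mu> Z"]
    by (auto simp: transverse_measure_def space_restrict_space)
  define f :: "'g \<times> 'a \<Rightarrow> real" where "f = (\<lambda>p. indicator P (fst p))"
  have fm: "f \<in> borel_measurable (borel_of T \<Otimes>\<^sub>M \<nu>)"
    unfolding f_def using PS by (intro borel_measurable_indicator' measurable_fst) auto
  have "emeasure m P * emeasure \<nu> (space \<nu>) = (\<integral>\<^sup>+h. emeasure \<nu> (space \<nu>) * indicator P h \<partial>m)"
    by (subst nn_integral_cmult_indicator[OF compactin_sets_m[OF P]]) (rule mult.commute)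
  also have "\<dots> = (\<integral>\<^sup>+ h. (\<integral>\<^sup>+ t. ennreal (f (h, t)) \<partial>\<nu>) \<partial>m)"
    by (intro nn_integral_cong) (auto simp: f_def indicator_def)
  also have "\<dots> = (\<integral>\<^sup>+ s. (\<integral>\<^sup>+ h. ennreal (f (inv h, \<alpha> h s)) \<partial>count_space (hitting_set G \<alpha> Z s)) \<partial>\<mu>)"
    using tm fm unfolding transverse_measure_def by (auto simp: f_def indicator_def intro!: exI[of _ 1])
  also have "\<dots> \<le> (\<integral>\<^sup>+ s. 1 \<partial>\<mu>)"
  proof (rule nn_integral_mono)
    fix s assume s: "s \<in> space \<mu>"
    show "(\<integral>\<^sup>+ h. ennreal (f (inv h, \<alpha> h s)) \<partial>count_space (hitting_set G \<alpha> Z s)) \<le> 1"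
    proof (cases "\<exists>h\<in>hitting_set G \<alpha> Z s. inv h \<in> P")
      case True
      then obtain h where h: "h \<in> hitting_set G \<alpha> Z s" "inv h \<in> P" by auto
      have uniq: "h' = h" if "h' \<in> hitting_set G \<alpha> Z s" "inv h' \<in> P" for h'
        using sep[of h' h s] sym[OF h(2)] sym[OF that(2)] h(1) that(1) s by (auto simp: hitting_set_def)
      have "(\<integral>\<^sup>+ h. ennreal (f (inv h, \<alpha> h s)) \<partial>count_space (hitting_set G \<alpha> Z s)) = 1"
      proof (intro nn_integral_count_space_unique[OF h(1)])
        fix h' assume h': "h' \<in> hitting_set G \<alpha> Z s"
        show "ennreal (f (inv h', \<alpha> h' s)) = (if h' = h then 1 else 0)"
        proof (cases "h' = h")
          case True
          then have "inv h' \<in> P" using h(2) by blast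
          then show ?thesis using True by (simp add: f_def)
        next
          case False
          then have "inv h' \<notin> P" using uniq[OF h'] by blast
          then show ?thesis using False by (simp add: f_def)
        qed
      qed
      then show ?thesis by simp
    next
      case False
      then have "(\<integral>\<^sup>+ h. ennreal (f (inv h, \<alpha> h s)) \<partial>count_space (hitting_set G \<alpha> Z s))
          = (\<integral>\<^sup>+ h. 0 \<partial>count_space (hitting_set G \<alpha> Z s))"
        by (intro nn_integral_cong) (auto simp: f_def)
      then show ?thesis by simp
    qed
  qed
  finally show ?thesis by simp
qed

text \<open>On a small box the action is injective, so that the transverse measure is a disintegration there.\<close>

lemma transverse_box:
  assumes tm: "transverse_measure G T m \<alpha> Z \<mu> \<nu>" and Z: "Z \<in> sets \<mu>" and P: "compactin T P"
    and act: "jointly_continuous_action G T X \<alpha>" and X: "polish_space X"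
    and sets: "sets \<mu> = sets (borel_of X)" and fin: "sigma_finite_measure \<nu>"
    and sep: "\<And>h h' s. h \<in> P \<Longrightarrow> h' \<in> P \<Longrightarrow> s \<in> space \<mu> \<Longrightarrow> \<alpha> h s \<in> Z \<Longrightarrow> \<alpha> h' s \<in> Z \<Longrightarrow> h = h'"
    and sym: "\<And>h. h \<in> P \<Longrightarrow> inv h \<in> P"
    and K: "compactin X K" "K \<subseteq> Z"
  shows "(\<lambda>(h, z). \<alpha> h z) \<in> m \<Otimes>\<^sub>M \<nu> \<rightarrow>\<^sub>M \<mu>"
    and "distr (density (m \<Otimes>\<^sub>M \<nu>) (indicator (P \<times> K))) \<mu> (\<lambda>(h, z). \<alpha> h z) = density \<mu> (indicator (hit \<alpha> X P K))"
proof -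
  interpret N: sigma_finite_measure \<nu> by (rule fin)
  have sc: "second_countable X" and Haus: "Hausdorff_space X"
    using X polish_imp_Hausdorff by (auto simp: polish_space_def)
  note act_simps = actionD(3-5)[OF act]
  have sp: "space \<mu> = topspace X" using sets_eq_imp_space_eq[OF sets] by simp
  have PG: "P \<subseteq> carrier G" using compactin_subset_topspace[OF P] topspace_eq by simp
  have setsn: "sets \<nu> = sets (restrict_space \<mu> Z)" using tm by (simp add: transverse_measure_def)
  have ZX: "Z \<subseteq> topspace X" using sets.sets_into_space[OF Z] sp by simp
  have spn: "space \<nu> = Z"
    using ZX sets_eq_imp_space_eq[OF setsn] by (auto simp: space_restrict_space sp)
  have idn: "(\<lambda>z. z) \<in> \<nu> \<rightarrow>\<^sub>M borel_of X"
    using measurable_restrict_space1[OF measurable_ident_sets[OF sets], of Z] setsn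
    by (simp add: id_def cong: measurable_cong_sets)
  have idp: "(\<lambda>p. (fst p, snd p)) \<in> m \<Otimes>\<^sub>M \<nu> \<rightarrow>\<^sub>M borel_of T \<Otimes>\<^sub>M borel_of X"
    by (intro measurable_Pair measurable_compose[OF measurable_fst measurable_ident_sets[OF sets_m]]
        measurable_compose[OF measurable_snd idn, unfolded comp_def])
  have "(\<lambda>(h, z). \<alpha> h z) \<in> borel_of T \<Otimes>\<^sub>M borel_of X \<rightarrow>\<^sub>M borel_of X"
    using continuous_map_measurable[OF actionD(2)[OF act]] sets_borel_of_prod[OF second_countable sc]
    by (simp cong: measurable_cong_sets)
  from measurable_compose[OF idp this]
  show meas: "(\<lambda>(h, z). \<alpha> h z) \<in> m \<Otimes>\<^sub>M \<nu> \<rightarrow>\<^sub>M \<mu>"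
    using sets by (simp add: case_prod_beta cong: measurable_cong_sets)
  have KS: "K \<in> sets \<nu>"
  proof -
    have "K \<in> sets \<mu>" using compactin_borel_of[OF Haus K(1)] sets by simp
    then show ?thesis
      using K(2) Z setsn by (auto simp: sets_restrict_space image_iff intro!: bexI[of _ K])
  qed
  have PK: "P \<times> K \<in> sets (m \<Otimes>\<^sub>M \<nu>)" using KS compactin_sets_m[OF P] by auto
  have hitS: "hit \<alpha> X P K \<in> sets \<mu>"
    using closedin_borel_of[OF closedin_hit[OF act P compactin_imp_closedin[OF Haus K(1)]]] sets by simp
  show "distr (density (m \<Otimes>\<^sub>M \<nu>) (indicator (P \<times> K))) \<mu> (\<lambda>(h, z). \<alpha> h z) = density \<mu> (indicator (hit \<alpha> X P K))"
  proof (rule measure_eqI)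
    fix E assume "E \<in> sets (distr (density (m \<Otimes>\<^sub>M \<nu>) (indicator (P \<times> K))) \<mu> (\<lambda>(h, z). \<alpha> h z))"
    then have E: "E \<in> sets \<mu>" by simp
    define B where "B = (\<lambda>(h, z). \<alpha> h z) -` E \<inter> space (m \<Otimes>\<^sub>M \<nu>)"
    have BS: "B \<in> sets (m \<Otimes>\<^sub>M \<nu>)" unfolding B_def by (rule measurable_sets[OF meas E])
    \<comment> \<open>The defining identity, tested on this indicator, computes the pushforward: for
      a return time \<open>h\<close> the pair \<open>(inv h, \<alpha> h s)\<close> counts exactly if
      \<open>inv h \<in> P\<close>, \<open>\<alpha> h s \<in> K\<close> and
      \<open>s \<in> E\<close>, because the action map sends the pair back to
      \<open>s\<close>.\<close>
    define f :: "'g \<times> 'a \<Rightarrow> real" where "f = indicator ((P \<times> K) \<inter> B)"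
    have fm: "f \<in> borel_measurable (borel_of T \<Otimes>\<^sub>M \<nu>)"
      unfolding f_def using PK BS sets_pair_measure_cong[OF sets_m refl, of \<nu>]
      by (intro borel_measurable_indicator) simp
    have "emeasure (distr (density (m \<Otimes>\<^sub>M \<nu>) (indicator (P \<times> K))) \<mu> (\<lambda>(h, z). \<alpha> h z)) E
        = emeasure (density (m \<Otimes>\<^sub>M \<nu>) (indicator (P \<times> K))) B"
      unfolding B_def by (subst emeasure_distr) (use meas E in auto)
    also have "\<dots> = emeasure (m \<Otimes>\<^sub>M \<nu>) ((P \<times> K) \<inter> B)"
      by (rule emeasure_restricted[OF PK BS])
    also have "\<dots> = (\<integral>\<^sup>+h. (\<integral>\<^sup>+t. indicator ((P \<times> K) \<inter> B) (h, t) \<partial>\<nu>) \<partial>m)"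
      by (rule N.emeasure_pair_measure) (use PK BS in auto)
    also have "\<dots> = (\<integral>\<^sup>+ h. (\<integral>\<^sup>+ t. ennreal (f (h, t)) \<partial>\<nu>) \<partial>m)"
      by (intro nn_integral_cong) (auto simp: f_def indicator_def)
    also have "\<dots> = (\<integral>\<^sup>+ s. (\<integral>\<^sup>+ h. ennreal (f (inv h, \<alpha> h s)) \<partial>count_space (hitting_set G \<alpha> Z s)) \<partial>\<mu>)"
      using tm fm unfolding transverse_measure_def by (auto simp: f_def indicator_def intro!: exI[of _ 1])
    also have "\<dots> = (\<integral>\<^sup>+ s. indicator (hit \<alpha> X P K \<inter> E) s \<partial>\<mu>)"
    proof (rule nn_integral_cong)
      fix s assume s: "s \<in> space \<mu>"
      then have sX: "s \<in> topspace X" by (simp add: sp)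
      have inv_act: "\<alpha> (inv h) (\<alpha> h s) = s" if "h \<in> carrier G" for h
        using act_simps(3)[of "inv h" h s] act_simps(2)[OF sX] that sX by simp
      have f_iff: "f (inv h, \<alpha> h s) = (if inv h \<in> P \<and> \<alpha> h s \<in> K \<and> s \<in> E then 1 else 0)"
        if h: "h \<in> hitting_set G \<alpha> Z s" for h
      proof -
        have hG: "h \<in> carrier G" "\<alpha> h s \<in> Z" using h by (auto simp: hitting_set_def)
        then have "(inv h, \<alpha> h s) \<in> B \<longleftrightarrow> s \<in> E"
          using inv_act[OF hG(1)] by (simp add: B_def space_pair_measure spn space_m)
        then show ?thesis by (auto simp: f_def indicator_def)
      qed
      show "(\<integral>\<^sup>+ h. ennreal (f (inv h, \<alpha> h s)) \<partial>count_space (hitting_set G \<alpha> Z s)) = indicator (hit \<alpha> X P K \<inter> E) s"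
      proof (cases "s \<in> hit \<alpha> X P K \<inter> E")
        case True
        then obtain h where h: "h \<in> P" "\<alpha> h s \<in> K" "s \<in> E" by (auto simp: hit_def)
        have hH: "h \<in> hitting_set G \<alpha> Z s" using h PG K(2) by (auto simp: hitting_set_def)
        have uniq: "h' = h" if "h' \<in> hitting_set G \<alpha> Z s" "inv h' \<in> P" for h'
          using sep[of h' h s] h(1) sym[OF that(2)] hH that(1) s by (auto simp: hitting_set_def)
        have "f (inv h', \<alpha> h' s) = (if h' = h then 1 else 0)" if h': "h' \<in> hitting_set G \<alpha> Z s" for h'
        proof (cases "h' = h")
          case True
          then have "inv h' \<in> P \<and> \<alpha> h' s \<in> K \<and> s \<in> E" using h sym[OF h(1)] by blast
          then show ?thesis unfolding f_iff[OF h'] using True by simp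
        next
          case False
          then have "inv h' \<notin> P" using uniq[OF h'] by blast
          then show ?thesis unfolding f_iff[OF h'] using False by simp
        qed
        then have "(\<integral>\<^sup>+ h. ennreal (f (inv h, \<alpha> h s)) \<partial>count_space (hitting_set G \<alpha> Z s)) = 1"
          by (intro nn_integral_count_space_unique[OF hH]) simp
        then show ?thesis using True by simp
      next
        case False
        have "f (inv h', \<alpha> h' s) = 0" if h': "h' \<in> hitting_set G \<alpha> Z s" for h'
        proof -
          have "inv (inv h') = h'" using h' by (auto simp: hitting_set_def)
          then show ?thesis using False sym[of "inv h'"] sX unfolding f_iff[OF h'] hit_def by auto
        qed
        then have "(\<integral>\<^sup>+ h. ennreal (f (inv h, \<alpha> h s)) \<partial>count_space (hitting_set G \<alpha> Z s))
            = (\<integral>\<^sup>+ h. 0 \<partial>count_space (hitting_set G \<alpha> Z s))"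
          by (intro nn_integral_cong) simp
        then show ?thesis using False by simp
      qed
    qed
    also have "\<dots> = emeasure (density \<mu> (indicator (hit \<alpha> X P K))) E"
      using hitS E by (simp add: emeasure_restricted)
    finally show "emeasure (distr (density (m \<Otimes>\<^sub>M \<nu>) (indicator (P \<times> K))) \<mu> (\<lambda>(h, z). \<alpha> h z)) E
        = emeasure (density \<mu> (indicator (hit \<alpha> X P K))) E" .
  qed simp
qed

text \<open>Continuity of \<open>a \<otimes> inv b\<close> at the identity. Intersecting with the
  inverse set gives symmetry, and the open set \<open>W\<close> inside guarantees positive Haar
  measure.\<close>

lemma symmetric_compact_nhd:
  assumes V: "openin T V" "\<one> \<in> V"
  obtains K W where "compactin T K" "openin T W" "\<one> \<in> W" "W \<subseteq> K" "\<And>a. a \<in> K \<Longrightarrow> inv a \<in> K"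
    "\<And>a b. a \<in> K \<Longrightarrow> b \<in> K \<Longrightarrow> a \<otimes> inv b \<in> V"
proof -
  let ?f = "\<lambda>p. fst p \<otimes> inv (snd p)"
  have "continuous_map (prod_topology T T) T ?f"
    by (intro continuous_map_multI continuous_map_invI continuous_map_fst continuous_map_snd)
  then have "openin (prod_topology T T) {p \<in> topspace (prod_topology T T). ?f p \<in> V}"
    by (rule openin_continuous_map_preimage) (rule V(1))
  moreover have "(\<one>, \<one>) \<in> {p \<in> topspace (prod_topology T T). ?f p \<in> V}"
    using V(2) by (simp add: topspace_eq)
  ultimately obtain A B where AB: "openin T A" "openin T B" "\<one> \<in> A" "\<one> \<in> B"
    "A \<times> B \<subseteq> {p \<in> topspace (prod_topology T T). ?f p \<in> V}"
    unfolding openin_prod_topology_alt by meson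
  obtain V0 K0 where K0: "openin T V0" "compactin T K0" "\<one> \<in> V0" "V0 \<subseteq> K0" "K0 \<subseteq> A \<inter> B"
    by (rule compact_nhd[of "A \<inter> B" \<one>]) (use AB in auto)
  have K0G: "K0 \<subseteq> carrier G" using compactin_subset_topspace[OF K0(2)] topspace_eq by simp
  define K where "K = K0 \<inter> {x \<in> topspace T. inv x \<in> K0}"
  define W where "W = V0 \<inter> {x \<in> topspace T. inv x \<in> V0}"
  show ?thesis
  proof (rule that[of K W])
    have "closedin T {x \<in> topspace T. inv x \<in> K0}"
      by (rule closedin_continuous_map_preimage[OF continuous_inv compactin_imp_closedin[OF Hausdorff K0(2)]])
    then show "compactin T K" unfolding K_def by (rule compact_Int_closedin[OF K0(2)])
    show "openin T W" unfolding W_def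
      by (intro openin_Int K0(1) openin_continuous_map_preimage[OF continuous_inv])
    show "\<one> \<in> W" using K0 by (simp add: W_def topspace_eq)
    show "W \<subseteq> K" using K0 by (auto simp: W_def K_def)
    show "inv a \<in> K" if "a \<in> K" for a using that K0G by (auto simp: K_def topspace_eq)
    show "a \<otimes> inv b \<in> V" if "a \<in> K" "b \<in> K" for a b
    proof -
      have "(a, b) \<in> A \<times> B" using that K0(5) by (auto simp: K_def)
      then have "(a, b) \<in> {p \<in> topspace (prod_topology T T). ?f p \<in> V}" using AB(5) by (rule subsetD[rotated])
      then show ?thesis by simp
    qed
  qed
qed

end

section \<open>Commensurable systems\<close>

lemma separatedE:
  assumes "separated_cross_section G T M \<alpha> C"
  obtains U where "openin T U" "\<one>\<^bsub>G\<^esub> \<in> U"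
    "\<And>h z. h \<in> carrier G \<Longrightarrow> h \<in> U \<Longrightarrow> z \<in> C \<Longrightarrow> \<alpha> h z \<in> C \<Longrightarrow> h = \<one>\<^bsub>G\<^esub>"
proof -
  obtain U where U: "openin T U" "\<one>\<^bsub>G\<^esub> \<in> U" "{h \<in> carrier G. \<alpha> h ` C \<inter> C \<noteq> {}} \<inter> U = {\<one>\<^bsub>G\<^esub>}"
    using assms unfolding separated_cross_section_def by auto
  show ?thesis
  proof (rule that[OF U(1,2)])
    fix h z assume "h \<in> carrier G" "h \<in> U" "z \<in> C" "\<alpha> h z \<in> C"
    then have "h \<in> {h \<in> carrier G. \<alpha> h ` C \<inter> C \<noteq> {}} \<inter> U" by blast
    then show "h = \<one>\<^bsub>G\<^esub>" unfolding U(3) by simp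
  qed
qed

lemma Int_stable_closedin: "Int_stable {C. closedin X C}"
  by (auto simp: Int_stable_def)

lemma borel_of_measure_eqI_closed:
  assumes "sets M = sets (borel_of X)" "sets N = sets (borel_of X)" "finite_measure M"
    and "\<And>C. closedin X C \<Longrightarrow> emeasure M C = emeasure N C"
  shows "M = N"
proof (rule measure_eqI_generator_eq[OF Int_stable_closedin[of X]])
  show "emeasure M (topspace X) \<noteq> \<infinity>" for i :: nat
    using finite_measure.emeasure_finite[OF assms(3)] by simp
qed (use assms in \<open>auto simp: sets_borel_of_closedin dest: closedin_subset\<close>)

text \<open>The data of the theorem, with unimodularity already turned into bi-invariance of
  \<open>m\<close>. The assumption \<open>haar\<close> gives positivity on open sets and finiteness
  on compact sets.\<close>

locale commensurable_system = bi_invariant_measure G T m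
  for G :: "'g monoid" (structure) and T :: "'g topology" and m :: "'g measure" +
  fixes r :: nat and X :: "nat \<Rightarrow> 's topology" and \<alpha> :: "nat \<Rightarrow> 'g \<Rightarrow> 's \<Rightarrow> 's"
    and Z :: "nat \<Rightarrow> 's set" and \<mu> \<nu> :: "nat \<Rightarrow> 's measure"
  assumes haar: "haar_measure G T m"
    and r: "r \<ge> 1"
    and polish: "k \<in> {1..r} \<Longrightarrow> polish_space (X k)"
    and act: "k \<in> {1..r} \<Longrightarrow> jointly_continuous_action G T (X k) (\<alpha> k)"
    and sep: "k \<in> {1..r} \<Longrightarrow> separated_cross_section G T (borel_of (X k)) (\<alpha> k) (Z k)"
    and sets_\<mu>: "k \<in> {1..r} \<Longrightarrow> sets (\<mu> k) = sets (borel_of (X k))"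
    and prob_\<mu>: "k \<in> {1..r} \<Longrightarrow> prob_space (\<mu> k)"
    and inv_\<mu>: "k \<in> {1..r} \<Longrightarrow> invariant_measure G (\<alpha> k) (\<mu> k)"
    and trans: "k \<in> {1..r} \<Longrightarrow> transverse_measure G T m (\<alpha> k) (Z k) (\<mu> k) (\<nu> k)"
    and comm: "commensurable r G T X \<alpha> Z"
begin

text \<open>Keeps the first index in the form \<open>1\<close>, as it occurs in
  \<open>{1..r}\<close> and in the case distinction of \<open>rest\<close>.\<close>

declare One_nat_def [simp del]

abbreviation XX :: "(nat \<Rightarrow> 's) topology" where "XX \<equiv> product_topology X {1..r}"

abbreviation diag :: "'g \<Rightarrow> (nat \<Rightarrow> 's) \<Rightarrow> (nat \<Rightarrow> 's)" where
  "diag \<equiv> multi_action {1..r} X \<alpha> (\<lambda>k g. g)"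

abbreviation full :: "(nat \<Rightarrow> 'g) \<Rightarrow> (nat \<Rightarrow> 's) \<Rightarrow> (nat \<Rightarrow> 's)" where
  "full \<equiv> multi_action {1..r} X \<alpha> (\<lambda>k n. n k)"

abbreviation H :: "(nat \<Rightarrow> 'g) monoid" where "H \<equiv> product_group {2..r} (\<lambda>_. G)"
abbreviation TH :: "(nat \<Rightarrow> 'g) topology" where "TH \<equiv> product_topology (\<lambda>_. T) {2..r}"

text \<open>\<open>H\<close> is the kernel \<open>N\<^sub>1\<close> with the trivial first coordinate dropped.\<close>

abbreviation rest :: "(nat \<Rightarrow> 'g) \<Rightarrow> (nat \<Rightarrow> 's) \<Rightarrow> (nat \<Rightarrow> 's)" where
  "rest \<equiv> multi_action {1..r} X \<alpha> (\<lambda>k n. if k = 1 then \<one> else n k)"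

abbreviation M :: "(nat \<Rightarrow> 's) measure" where "M \<equiv> PiM {1..r} \<mu>"

lemma polish_XX: "polish_space XX"
  using polish by (intro polish_space_product) auto

lemma second_countable_XX: "second_countable XX"
  using polish_XX by (simp add: polish_space_def)

lemma Hausdorff_XX: "Hausdorff_space XX"
  by (rule polish_imp_Hausdorff[OF polish_XX])

lemma diag_act: "jointly_continuous_action G T XX diag"
  by (rule jointly_continuous_multi_action[where G = G and T = T])
    (use act in \<open>auto simp: topspace_eq is_group hom_def\<close>)

lemma rest_act: "jointly_continuous_action H TH XX rest"
proof (rule jointly_continuous_multi_action[where G = G and T = T])
  show "group H" by (rule product_group) (rule is_group)
  fix k assume k: "k \<in> {1..r}"
  show "(\<lambda>n. if k = 1 then \<one> else n k) \<in> hom H G" using k by (auto simp: hom_def PiE_iff)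
  show "continuous_map TH T (\<lambda>n. if k = 1 then \<one> else n k)"
    using k by (cases "k = 1") (auto simp: topspace_eq intro: continuous_map_product_projection)
qed (use act in \<open>auto simp: topspace_eq is_group\<close>)

lemma full_act: "jointly_continuous_action (product_group {1..r} (\<lambda>_. G)) (product_topology (\<lambda>_. T) {1..r}) XX full"
proof (rule jointly_continuous_multi_action[where G = G and T = T])
  show "group (product_group {1..r} (\<lambda>_. G))" by (rule product_group) (rule is_group)
  fix k assume k: "k \<in> {1..r}"
  show "(\<lambda>n. n k) \<in> hom (product_group {1..r} (\<lambda>_. G)) G" using k by (auto simp: hom_def PiE_iff)
  show "continuous_map (product_topology (\<lambda>_. T) {1..r}) T (\<lambda>n. n k)"
    using k by (rule continuous_map_product_projection)
qed (use act in \<open>auto simp: topspace_eq is_group\<close>)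

lemma sets_M: "sets M = sets (borel_of XX)"
proof -
  have "sets (borel_of XX) = sets (PiM {1..r} (\<lambda>i. borel_of (X i)))"
    using polish by (intro sets_borel_of_product) (auto simp: polish_space_def)
  also have "\<dots> = sets M" using sets_\<mu> by (intro sets_PiM_cong) auto
  finally show ?thesis by simp
qed

lemma sigma_finite_\<mu>: "k \<in> {1..r} \<Longrightarrow> sigma_finite_measure (\<mu> k)"
  using prob_\<mu> by (auto simp: prob_space_def finite_measure_def)

lemma space_\<mu>: "k \<in> {1..r} \<Longrightarrow> space (\<mu> k) = topspace (X k)"
  using sets_eq_imp_space_eq[OF sets_\<mu>] by simp

lemma prob_M: "prob_space M"
proof (rule prob_spaceI)
  have "emeasure M (Pi\<^sub>E {1..r} (\<lambda>k. space (\<mu> k))) = (\<Prod>k\<in>{1..r}. emeasure (\<mu> k) (space (\<mu> k)))"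
    by (rule emeasure_PiM_on) (use sigma_finite_\<mu> in auto)
  also have "\<dots> = 1"
    by (intro prod.neutral ballI prob_space.emeasure_space_1 prob_\<mu>)
  finally show "emeasure M (space M) = 1" by (simp add: space_PiM)
qed

lemma invariant_M: "(\<And>k h. k \<in> {1..r} \<Longrightarrow> h \<in> carrier K \<Longrightarrow> \<psi> k h \<in> carrier G) \<Longrightarrow>
    invariant_measure K (multi_action {1..r} X \<alpha> \<psi>) M"
  by (rule invariant_measure_multi_action) (use sets_\<mu> prob_\<mu> inv_\<mu> in auto)

lemma multi_apply: "x \<in> topspace XX \<Longrightarrow> k \<in> {1..r} \<Longrightarrow> multi_action {1..r} X \<alpha> \<psi> h x k = \<alpha> k (\<psi> k h) (x k)"
  by (simp add: multi_action_def)

lemma XX_point: "x \<in> topspace XX \<Longrightarrow> k \<in> {1..r} \<Longrightarrow> x k \<in> topspace (X k)"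
  by (auto simp: PiE_iff)

lemma XX_eqI: "x \<in> topspace XX \<Longrightarrow> y \<in> topspace XX \<Longrightarrow> (\<And>k. k \<in> {1..r} \<Longrightarrow> x k = y k) \<Longrightarrow> x = y"
  by (metis PiE_ext topspace_product_topology)

lemma act_simps:
  assumes "k \<in> {1..r}" "x \<in> topspace (X k)"
  shows "g \<in> carrier G \<Longrightarrow> \<alpha> k g x \<in> topspace (X k)" "\<alpha> k \<one> x = x"
    "g \<in> carrier G \<Longrightarrow> h \<in> carrier G \<Longrightarrow> \<alpha> k g (\<alpha> k h x) = \<alpha> k (g \<otimes> h) x"
  using actionD(3-5)[OF act[OF assms(1)]] assms(2) by auto

lemma diag_apply: "x \<in> topspace XX \<Longrightarrow> k \<in> {1..r} \<Longrightarrow> diag g x k = \<alpha> k g (x k)"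
  by (rule multi_apply)

lemma full_apply: "x \<in> topspace XX \<Longrightarrow> k \<in> {1..r} \<Longrightarrow> full g x k = \<alpha> k (g k) (x k)"
  by (rule multi_apply)

lemma rest_apply_first: "x \<in> topspace XX \<Longrightarrow> rest n x 1 = x 1"
  using multi_apply[of x 1 "\<lambda>k n. if k = 1 then \<one> else n k" n] act_simps(2)[of 1 "x 1"] XX_point[of x 1] r
  by simp

lemma rest_apply: "x \<in> topspace XX \<Longrightarrow> k \<in> {2..r} \<Longrightarrow> rest n x k = \<alpha> k (n k) (x k)"
  using multi_apply[of x k "\<lambda>k n. if k = 1 then \<one> else n k" n] by simp

lemma diag_closed: "g \<in> carrier G \<Longrightarrow> x \<in> topspace XX \<Longrightarrow> diag g x \<in> topspace XX"
  by (rule actionD(3)[OF diag_act])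

lemma rest_closed: "n \<in> carrier H \<Longrightarrow> x \<in> topspace XX \<Longrightarrow> rest n x \<in> topspace XX"
  by (rule actionD(3)[OF rest_act])

lemma index_cases: "k \<in> {1..r} \<Longrightarrow> k = 1 \<or> k \<in> {2..r}"
  by auto

text \<open>The diagonal group normalises the kernel: in the coordinates from 2 on, \<open>n j
  \<otimes> a = a \<otimes> (inv a \<otimes> n j \<otimes> a)\<close>, while both sides move the
  first coordinate by \<open>a\<close>. The diagonal invariance of the induced measure rests on
  this.\<close>

lemma conj_rest:
  assumes x: "x \<in> topspace XX" and a: "a \<in> carrier G" and n: "n \<in> carrier H"
  shows "rest n (diag a x) = diag a (rest (\<lambda>j\<in>{2..r}. inv a \<otimes> n j \<otimes> a) x)"
proof (rule XX_eqI)
  let ?n = "\<lambda>j\<in>{2..r}. inv a \<otimes> n j \<otimes> a"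
  have n': "?n \<in> carrier H" using a n by auto
  show "rest n (diag a x) \<in> topspace XX" "diag a (rest ?n x) \<in> topspace XX"
    by (intro rest_closed diag_closed x a n n')+
  fix k assume k: "k \<in> {1..r}"
  note dx = diag_closed[OF a x] and rx = rest_closed[OF n' x]
  show "rest n (diag a x) k = diag a (rest ?n x) k"
  proof (cases "k = 1")
    case True
    have k1: "1 \<in> {1..r}" using r by simp
    show ?thesis
      by (simp only: True rest_apply_first[OF dx] diag_apply[OF x k1] diag_apply[OF rx k1] rest_apply_first[OF x])
  next
    case False
    then have k2: "k \<in> {2..r}" using index_cases[OF k] by blast
    then have nk: "n k \<in> carrier G" using n by auto
    have eq: "a \<otimes> (inv a \<otimes> n k \<otimes> a) = n k \<otimes> a"
      using nk a by (simp add: m_assoc[symmetric])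
    have "rest n (diag a x) k = \<alpha> k (n k) (\<alpha> k a (x k))"
      by (simp only: rest_apply[OF dx k2] diag_apply[OF x k])
    also have "\<dots> = \<alpha> k a (\<alpha> k (inv a \<otimes> n k \<otimes> a) (x k))"
      using act_simps(3)[OF k XX_point[OF x k]] nk a eq by simp
    also have "\<dots> = diag a (rest ?n x) k"
      using k2 by (simp only: diag_apply[OF rx k] rest_apply[OF x k2] restrict_apply if_True)
    finally show ?thesis .
  qed
qed

text \<open>Commensurability for \<open>k = 1\<close>, restated for the group indexed by
  \<open>{2..r}\<close>. An open set of the product topology contains a box around the identity, and
  the intersection of the sides of the box is one neighbourhood \<open>V\<close> that works in all
  coordinates.\<close>

lemma rest_separated:
  obtains V where "openin T V" "\<one> \<in> V"
    "\<And>n x. n \<in> carrier H \<Longrightarrow> (\<And>j. j \<in> {2..r} \<Longrightarrow> n j \<in> V) \<Longrightarrow> x \<in> simultaneous_hitting r G X \<alpha> Z \<Longrightarrow>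
      rest n x \<in> simultaneous_hitting r G X \<alpha> Z \<Longrightarrow> n = \<one>\<^bsub>H\<^esub>"
proof -
  let ?N = "coordinate_kernel r G 1"
  have N: "?N = {n \<in> Pi\<^sub>E {1..r} (\<lambda>_. carrier G). n 1 = \<one>}"
    by (simp add: coordinate_kernel_def kernel_def power_group_def)
  have "separated_cross_section ((power_group r G) \<lparr>carrier := ?N\<rparr>)
          (subtopology (product_topology (\<lambda>_. T) {1..r}) ?N)
          (borel_of (product_space r X)) (product_action r X \<alpha>) (simultaneous_hitting r G X \<alpha> Z)"
    using comm r unfolding commensurable_def by simp
  then obtain U where U: "openin (subtopology (product_topology (\<lambda>_. T) {1..r}) ?N) U" "(\<lambda>i\<in>{1..r}. \<one>) \<in> U"
    "\<And>n x. n \<in> ?N \<Longrightarrow> n \<in> U \<Longrightarrow> x \<in> simultaneous_hitting r G X \<alpha> Z \<Longrightarrow>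
      product_action r X \<alpha> n x \<in> simultaneous_hitting r G X \<alpha> Z \<Longrightarrow> n = (\<lambda>i\<in>{1..r}. \<one>)"
    by (rule separatedE) (simp add: power_group_def)
  obtain W where W: "openin (product_topology (\<lambda>_. T) {1..r}) W" "U = W \<inter> ?N"
    using U(1) unfolding openin_subtopology by auto
  obtain A where A: "\<And>i. i \<in> {1..r} \<Longrightarrow> openin T (A i)" "(\<lambda>i\<in>{1..r}. \<one>) \<in> Pi\<^sub>E {1..r} A" "Pi\<^sub>E {1..r} A \<subseteq> W"
    using W U(2) unfolding openin_product_topology_alt by (metis (no_types, lifting) Int_iff)
  define V where "V = (\<Inter>i\<in>{1..r}. A i)"
  show ?thesis
  proof (rule that[of V])
    show "openin T V" unfolding V_def by (rule openin_INT2) (use A r in auto)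
    show "\<one> \<in> V" using A(2) by (auto simp: V_def PiE_iff)
    fix n x
    assume n: "n \<in> carrier H" "\<And>j. j \<in> {2..r} \<Longrightarrow> n j \<in> V" and x: "x \<in> simultaneous_hitting r G X \<alpha> Z"
      "rest n x \<in> simultaneous_hitting r G X \<alpha> Z"
    \<comment> \<open>The element of the kernel that corresponds to \<open>n\<close>: the dropped
      first coordinate is filled in with the identity.\<close>
    define p where "p = (\<lambda>k\<in>{1..r}. if k = 1 then \<one> else n k)"
    have pG: "p k \<in> carrier G" if "k \<in> {1..r}" for k
    proof (cases "k = 1")
      case False
      then have "k \<in> {2..r}" using that by auto
      then show ?thesis using n(1) that by (auto simp: p_def PiE_iff)
    qed (use that in \<open>simp add: p_def\<close>)
    have pV: "p k \<in> V" if "k \<in> {1..r}" for k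
    proof (cases "k = 1")
      case False
      then have "k \<in> {2..r}" using that by auto
      then show ?thesis using n(2) that False by (simp add: p_def)
    qed (use that \<open>\<one> \<in> V\<close> in \<open>simp add: p_def\<close>)
    have pN: "p \<in> ?N" using pG r by (auto simp: N p_def)
    have "p \<in> Pi\<^sub>E {1..r} A"
    proof (rule PiE_I)
      show "p k \<in> A k" if "k \<in> {1..r}" for k using pV[OF that] that by (auto simp: V_def)
      show "p k = undefined" if "k \<notin> {1..r}" for k
        using that by (simp only: p_def restrict_apply if_False)
    qed
    then have "p \<in> U" using A(3) W(2) pN by auto
    moreover have "product_action r X \<alpha> p x = rest n x"
      by (auto simp: product_action_def product_space_def multi_action_def p_def fun_eq_iff)
    ultimately have p1: "p = (\<lambda>i\<in>{1..r}. \<one>)" using U(3)[OF pN] x by simp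
    have "n j = \<one>" if j: "j \<in> {2..r}" for j
    proof -
      have "p j = \<one>" using p1 j by simp
      then show ?thesis using j by (auto simp: p_def)
    qed
    then show "n = \<one>\<^bsub>H\<^esub>"
      using n(1) by (auto simp: PiE_iff extensional_def fun_eq_iff)
  qed
qed

end

section \<open>Finite transverse measures and the mass of thickened compact sets\<close>

context commensurable_system
begin

lemma Z_sets: "k \<in> {1..r} \<Longrightarrow> Z k \<in> sets (\<mu> k)"
  using sep sets_\<mu> by (auto simp: separated_cross_section_def cross_section_def)

lemma Z_subset: "k \<in> {1..r} \<Longrightarrow> Z k \<subseteq> topspace (X k)"
  using sets.sets_into_space[OF Z_sets] space_\<mu> by simp

lemma sets_\<nu>: "k \<in> {1..r} \<Longrightarrow> sets (\<nu> k) = sets (restrict_space (\<mu> k) (Z k))"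
  using trans by (simp add: transverse_measure_def)

lemma space_\<nu>: "k \<in> {1..r} \<Longrightarrow> space (\<nu> k) = Z k"
  using sets_eq_imp_space_eq[OF sets_\<nu>] Z_subset space_\<mu> by (auto simp: space_restrict_space)

lemma haar_compact_finite: "compactin T P \<Longrightarrow> emeasure m P < \<infinity>"
  using haar by (simp add: haar_measure_def)

text \<open>If \<open>\<alpha> k h s\<close> and \<open>\<alpha> k h' s\<close> both lie in
  \<open>Z k\<close>, then \<open>h' \<otimes> inv h\<close> moves a point of \<open>Z k\<close>
  into \<open>Z k\<close>. Quotients of elements of \<open>P\<close> lie in the separating
  neighbourhoods of all \<open>Z k\<close> at once, so return times in \<open>P\<close> are unique.
  The condition on \<open>W\<close> later controls quotients of times from different
  coordinates.\<close>

lemma small_compact_nhd: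
  assumes W: "openin T W" "\<one> \<in> W"
  obtains P where "compactin T P" "0 < emeasure m P" "\<And>a. a \<in> P \<Longrightarrow> inv a \<in> P"
    "\<And>a b. a \<in> P \<Longrightarrow> b \<in> P \<Longrightarrow> a \<otimes> inv b \<in> W"
    "\<And>k h h' s. k \<in> {1..r} \<Longrightarrow> h \<in> P \<Longrightarrow> h' \<in> P \<Longrightarrow> s \<in> space (\<mu> k) \<Longrightarrow> \<alpha> k h s \<in> Z k \<Longrightarrow>
      \<alpha> k h' s \<in> Z k \<Longrightarrow> h = h'"
proof -
  have "\<exists>U. openin T U \<and> \<one> \<in> U \<and>
      (\<forall>h z. h \<in> carrier G \<longrightarrow> h \<in> U \<longrightarrow> z \<in> Z k \<longrightarrow> \<alpha> k h z \<in> Z k \<longrightarrow> h = \<one>)" if "k \<in> {1..r}" for k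
    by (rule separatedE[OF sep[OF that]]) blast
  then obtain U where U: "\<And>k. k \<in> {1..r} \<Longrightarrow> openin T (U k)" "\<And>k. k \<in> {1..r} \<Longrightarrow> \<one> \<in> U k"
    "\<And>k h z. k \<in> {1..r} \<Longrightarrow> h \<in> carrier G \<Longrightarrow> h \<in> U k \<Longrightarrow> z \<in> Z k \<Longrightarrow> \<alpha> k h z \<in> Z k \<Longrightarrow> h = \<one>"
    by metis
  have V: "openin T (W \<inter> (\<Inter>k\<in>{1..r}. U k))" "\<one> \<in> W \<inter> (\<Inter>k\<in>{1..r}. U k)"
    using U W r by (auto intro!: openin_Int openin_INT2)
  obtain P O' where P: "compactin T P" "openin T O'" "\<one> \<in> O'" "O' \<subseteq> P" "\<And>a. a \<in> P \<Longrightarrow> inv a \<in> P"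
    "\<And>a b. a \<in> P \<Longrightarrow> b \<in> P \<Longrightarrow> a \<otimes> inv b \<in> W \<inter> (\<Inter>k\<in>{1..r}. U k)"
    by (rule symmetric_compact_nhd[OF V]) (rule that)
  have PG: "P \<subseteq> carrier G" using compactin_subset_topspace[OF P(1)] topspace_eq by simp
  show ?thesis
  proof (rule that[of P])
    have "0 < emeasure m O'" by (rule haar_open_pos[OF haar P(2)]) (use P(3) in auto)
    also have "\<dots> \<le> emeasure m P" using compactin_sets_m[OF P(1)] P(4) by (intro emeasure_mono)
    finally show "0 < emeasure m P" .
    show "a \<otimes> inv b \<in> W" if "a \<in> P" "b \<in> P" for a b using P(6)[OF that] by simp
    fix k h h' s
    assume k: "k \<in> {1..r}" and h: "h \<in> P" "h' \<in> P" and s: "s \<in> space (\<mu> k)" "\<alpha> k h s \<in> Z k" "\<alpha> k h' s \<in> Z k"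
    have hG: "h \<in> carrier G" "h' \<in> carrier G" using h PG by auto
    have sX: "s \<in> topspace (X k)" using s(1) space_\<mu>[OF k] by simp
    have "\<alpha> k (h' \<otimes> inv h) (\<alpha> k h s) = \<alpha> k (h' \<otimes> inv h \<otimes> h) s"
      using act_simps(3)[OF k sX] hG by simp
    also have "h' \<otimes> inv h \<otimes> h = h'" using hG by (simp add: m_assoc)
    finally have "\<alpha> k (h' \<otimes> inv h) (\<alpha> k h s) \<in> Z k" using s(3) by simp
    then have "h' \<otimes> inv h = \<one>"
      using U(3)[OF k _ _ s(2)] P(6)[OF h(2,1)] k hG by blast
    then show "h = h'" using hG by (metis inv_closed inv_equality inv_inv)
  qed (use P in auto)
qed

lemma finite_\<nu>:
  assumes k: "k \<in> {1..r}"
  shows "finite_measure (\<nu> k)"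
proof
  obtain P where P: "compactin T P" "0 < emeasure m P" "\<And>a. a \<in> P \<Longrightarrow> inv a \<in> P"
    "\<And>k h h' s. k \<in> {1..r} \<Longrightarrow> h \<in> P \<Longrightarrow> h' \<in> P \<Longrightarrow> s \<in> space (\<mu> k) \<Longrightarrow> \<alpha> k h s \<in> Z k \<Longrightarrow>
      \<alpha> k h' s \<in> Z k \<Longrightarrow> h = h'"
    by (rule small_compact_nhd[OF openin_topspace]) (use topspace_eq in \<open>auto intro: that\<close>)
  have "emeasure m P * emeasure (\<nu> k) (space (\<nu> k)) \<le> emeasure (\<mu> k) (space (\<mu> k))"
    by (rule transverse_measure_le[OF trans[OF k] Z_sets[OF k] P(1) P(4)[OF k] P(3)])
  also have "\<dots> = 1" by (rule prob_space.emeasure_space_1[OF prob_\<mu>[OF k]])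
  finally show "emeasure (\<nu> k) (space (\<nu> k)) \<noteq> \<infinity>"
    using P(2) by (auto simp: ennreal_mult_top top_unique split: if_splits)
qed

lemma sigma_finite_\<nu>: "k \<in> {1..r} \<Longrightarrow> sigma_finite_measure (\<nu> k)"
  using finite_\<nu> by (simp add: finite_measure_def)

lemma space_PiM_\<nu>: "space (PiM {1..r} \<nu>) = Pi\<^sub>E {1..r} Z"
  using space_\<nu> by (auto simp: space_PiM PiE_iff)

text \<open>Each \<open>\<nu> k\<close> carries the trace of the Borel sets on \<open>Z k\<close>;
  the inclusion into the whole space relates the two product sigma-algebras.\<close>

lemma measurable_\<nu>_ident: "(\<lambda>z. z) \<in> PiM {1..r} \<nu> \<rightarrow>\<^sub>M M"
proof -
  have id: "(\<lambda>z. z) \<in> \<nu> k \<rightarrow>\<^sub>M \<mu> k" if k: "k \<in> {1..r}" for k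
    using measurable_restrict_space1[OF measurable_ident_sets[OF refl], of "\<mu> k" "Z k"] sets_\<nu>[OF k]
    by (simp add: id_def cong: measurable_cong_sets)
  have "(\<lambda>x. \<lambda>k\<in>{1..r}. x k) \<in> PiM {1..r} \<nu> \<rightarrow>\<^sub>M M"
    using measurable_componentwise[of "{1..r}" "\<lambda>k z. z" \<nu> \<mu>] id by simp
  moreover have "(\<lambda>k\<in>{1..r}. x k) = x" if "x \<in> space (PiM {1..r} \<nu>)" for x
    using that by (auto simp: space_PiM PiE_iff extensional_restrict)
  ultimately show ?thesis by (simp cong: measurable_cong)
qed

text \<open>The set \<open>K\<close> need not be a product, whereas each \<open>\<nu> k\<close> is
  tied to \<open>\<mu> k\<close> in its own coordinate. The product \<open>?\<Xi>\<close> of the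
  measures \<open>m \<Otimes>\<^sub>M \<nu> k\<close> on the boxes \<open>P \<times> C k\<close>
  links the two: the action map sends it to \<open>M\<close> with a density at most 1, and the
  second projections send it to the product of the \<open>\<nu> k\<close> with a density that is
  constant and positive on \<open>K\<close>.\<close>

lemma hit_full_positive:
  assumes K: "compactin XX K" "K \<subseteq> Pi\<^sub>E {1..r} Z" "emeasure (PiM {1..r} \<nu>) K > 0"
    and P: "compactin T P" "0 < emeasure m P" "\<And>a. a \<in> P \<Longrightarrow> inv a \<in> P"
    "\<And>k h h' s. k \<in> {1..r} \<Longrightarrow> h \<in> P \<Longrightarrow> h' \<in> P \<Longrightarrow> s \<in> space (\<mu> k) \<Longrightarrow> \<alpha> k h s \<in> Z k \<Longrightarrow>
      \<alpha> k h' s \<in> Z k \<Longrightarrow> h = h'"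
  shows "emeasure M (hit full XX (Pi\<^sub>E {1..r} (\<lambda>_. P)) K) > 0"
proof -
  let ?I = "{1..r}"
  let ?S = "hit full XX (Pi\<^sub>E ?I (\<lambda>_. P)) K"
  let ?c = "emeasure m P"
  interpret m: sigma_finite_measure m by (rule sigma_finite_m)
  have fin: "finite ?I" by simp
  have PG: "P \<subseteq> carrier G" using compactin_subset_topspace[OF P(1)] topspace_eq by simp
  have PS: "P \<in> sets m" by (rule compactin_sets_m[OF P(1)])
  have cfin: "?c < \<infinity>" by (rule haar_compact_finite[OF P(1)])
  have SS: "?S \<in> sets M"
  proof -
    have "compactin (product_topology (\<lambda>_. T) ?I) (Pi\<^sub>E ?I (\<lambda>_. P))"
      using P(1) by (simp add: compactin_PiE)
    then have "closedin XX ?S"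
      by (rule closedin_hit[OF full_act _ compactin_imp_closedin[OF Hausdorff_XX K(1)]])
    then show ?thesis using closedin_borel_of sets_M by simp
  qed
  have KM: "K \<in> sets M" using compactin_borel_of[OF Hausdorff_XX K(1)] sets_M by simp
  have K\<nu>: "K \<in> sets (PiM ?I \<nu>)"
  proof -
    have "(\<lambda>z. z) -` K \<inter> space (PiM ?I \<nu>) \<in> sets (PiM ?I \<nu>)"
      by (rule measurable_sets[OF measurable_\<nu>_ident KM])
    moreover have "(\<lambda>z. z) -` K \<inter> space (PiM ?I \<nu>) = K" using K(2) space_PiM_\<nu> by auto
    ultimately show ?thesis by simp
  qed
  \<comment> \<open>The coordinate projections of \<open>K\<close> are compact subsets of the
    \<open>Z k\<close> whose product contains \<open>K\<close>.\<close>
  define C where "C k = (\<lambda>x. x k) ` K" for k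
  have C: "compactin (X k) (C k)" "C k \<subseteq> Z k" if k: "k \<in> ?I" for k
  proof -
    show "compactin (X k) (C k)"
      unfolding C_def by (rule image_compactin[OF K(1) continuous_map_product_projection[OF k]])
    show "C k \<subseteq> Z k" using K(2) k unfolding C_def by (auto dest!: subsetD PiE_mem)
  qed
  define a where "a k = (\<lambda>(h, z). \<alpha> k h z)" for k
  have a: "a k \<in> m \<Otimes>\<^sub>M \<nu> k \<rightarrow>\<^sub>M \<mu> k"
    "distr (density (m \<Otimes>\<^sub>M \<nu> k) (indicator (P \<times> C k))) (\<mu> k) (a k) = density (\<mu> k) (indicator (hit (\<alpha> k) (X k) P (C k)))"
    if k: "k \<in> ?I" for k
  proof -
    note box = transverse_box[OF trans[OF k] Z_sets[OF k] P(1) act[OF k] polish[OF k] sets_\<mu>[OF k] sigma_finite_\<nu>[OF k]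
        _ _ C[OF k]]
    show "a k \<in> m \<Otimes>\<^sub>M \<nu> k \<rightarrow>\<^sub>M \<mu> k"
      unfolding a_def by (rule box(1)) (use P(3) P(4)[OF k] in blast)+
    show "distr (density (m \<Otimes>\<^sub>M \<nu> k) (indicator (P \<times> C k))) (\<mu> k) (a k) = density (\<mu> k) (indicator (hit (\<alpha> k) (X k) P (C k)))"
      unfolding a_def by (rule box(2)) (use P(3) P(4)[OF k] in blast)+
  qed
  have CS: "C k \<in> sets (\<nu> k)" if k: "k \<in> ?I" for k
  proof -
    have "C k \<in> sets (\<mu> k)"
      using compactin_borel_of[OF polish_imp_Hausdorff[OF polish[OF k]] C(1)[OF k]] sets_\<mu>[OF k] by simp
    then show ?thesis
      using C(2)[OF k] sets_\<nu>[OF k] by (auto simp: sets_restrict_space image_iff intro!: bexI[of _ "C k"])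
  qed
  have PC: "P \<times> C k \<in> sets (m \<Otimes>\<^sub>M \<nu> k)" if "k \<in> ?I" for k
    by (rule pair_measureI[OF PS CS[OF that]])
  define \<xi> where "\<xi> k = density (m \<Otimes>\<^sub>M \<nu> k) (indicator (P \<times> C k))" for k
  have sf_pair: "sigma_finite_measure (m \<Otimes>\<^sub>M \<nu> k)" if "k \<in> ?I" for k
    by (rule sigma_finite_pair_measure[OF sigma_finite_m sigma_finite_\<nu>[OF that]])
  have fin_\<xi>: "finite_measure (\<xi> k)" if k: "k \<in> ?I" for k
  proof
    interpret N: sigma_finite_measure "\<nu> k" by (rule sigma_finite_\<nu>[OF k])
    interpret F: finite_measure "\<nu> k" by (rule finite_\<nu>[OF k])
    have "emeasure (\<xi> k) (space (\<xi> k)) = emeasure (m \<Otimes>\<^sub>M \<nu> k) ((P \<times> C k) \<inter> space (m \<Otimes>\<^sub>M \<nu> k))"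
      unfolding \<xi>_def using PC[OF k] by (simp add: emeasure_restricted)
    also have "\<dots> = ?c * emeasure (\<nu> k) (C k)"
      using sets.sets_into_space[OF PC[OF k]] N.emeasure_pair_measure_Times[OF PS CS[OF k]]
      by (simp add: Int_absorb2)
    also have "\<dots> \<noteq> \<infinity>"
      using cfin F.emeasure_finite[of "C k"] by (simp add: ennreal_mult_eq_top_iff less_top)
    finally show "emeasure (\<xi> k) (space (\<xi> k)) \<noteq> \<infinity>" .
  qed
  have sf_\<xi>: "sigma_finite_measure (\<xi> k)" if "k \<in> ?I" for k
    using fin_\<xi>[OF that] by (simp add: finite_measure_def)
  have sets_\<xi>: "sets (\<xi> k) = sets (m \<Otimes>\<^sub>M \<nu> k)" for k by (simp add: \<xi>_def)
  have a_\<xi>: "a k \<in> \<xi> k \<rightarrow>\<^sub>M \<mu> k" if "k \<in> ?I" for k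
    using a(1)[OF that] by (simp add: \<xi>_def)
  have snd_\<xi>: "snd \<in> \<xi> k \<rightarrow>\<^sub>M \<nu> k" for k by (simp add: \<xi>_def)
  have distr_snd: "distr (\<xi> k) (\<nu> k) snd = density (\<nu> k) (\<lambda>z. ?c * indicator (C k) z)" if k: "k \<in> ?I" for k
  proof (rule measure_eqI)
    interpret N: sigma_finite_measure "\<nu> k" by (rule sigma_finite_\<nu>[OF k])
    fix E assume "E \<in> sets (distr (\<xi> k) (\<nu> k) snd)"
    then have E: "E \<in> sets (\<nu> k)" by simp
    have "emeasure (distr (\<xi> k) (\<nu> k) snd) E = emeasure (\<xi> k) (snd -` E \<inter> space (m \<Otimes>\<^sub>M \<nu> k))"
      using E snd_\<xi> by (subst emeasure_distr) (auto simp: \<xi>_def)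
    also have "\<dots> = emeasure (m \<Otimes>\<^sub>M \<nu> k) ((P \<times> C k) \<inter> (snd -` E \<inter> space (m \<Otimes>\<^sub>M \<nu> k)))"
      unfolding \<xi>_def by (rule emeasure_restricted[OF PC[OF k]]) (rule measurable_sets[OF measurable_snd E])
    also have "(P \<times> C k) \<inter> (snd -` E \<inter> space (m \<Otimes>\<^sub>M \<nu> k)) = P \<times> (C k \<inter> E)"
      using sets.sets_into_space[OF PC[OF k]] by auto
    also have "emeasure (m \<Otimes>\<^sub>M \<nu> k) (P \<times> (C k \<inter> E)) = ?c * emeasure (\<nu> k) (C k \<inter> E)"
      by (rule N.emeasure_pair_measure_Times[OF PS]) (use CS[OF k] E in auto)
    also have "\<dots> = emeasure (density (\<nu> k) (\<lambda>z. ?c * indicator (C k) z)) E"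
    proof -
      have "emeasure (density (\<nu> k) (\<lambda>z. ?c * indicator (C k) z)) E = (\<integral>\<^sup>+z. ?c * indicator (C k) z * indicator E z \<partial>\<nu> k)"
        using CS[OF k] E by (intro emeasure_density) auto
      also have "\<dots> = (\<integral>\<^sup>+z. ?c * indicator (C k \<inter> E) z \<partial>\<nu> k)"
        by (intro nn_integral_cong) (auto simp: indicator_def)
      also have "\<dots> = ?c * emeasure (\<nu> k) (C k \<inter> E)"
        using CS[OF k] E by (intro nn_integral_cmult_indicator) auto
      finally show ?thesis by simp
    qed
    finally show "emeasure (distr (\<xi> k) (\<nu> k) snd) E = emeasure (density (\<nu> k) (\<lambda>z. ?c * indicator (C k) z)) E" .
  qed simp
  let ?\<Xi> = "PiM ?I \<xi>"
  \<comment> \<open>On \<open>B1\<close> the moved point lies in the thickening of \<open>K\<close>,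
    on \<open>B2\<close> the base point lies in \<open>K\<close>. Positivity passes from
    \<open>K\<close> to \<open>B2\<close>, from there to \<open>B1\<close>, and then to the
    thickening.\<close>
  define B1 where "B1 = (\<lambda>\<omega>. \<lambda>k\<in>?I. a k (\<omega> k)) -` ?S \<inter> space ?\<Xi>"
  define B2 where "B2 = (\<lambda>\<omega>. \<lambda>k\<in>?I. snd (\<omega> k)) -` K \<inter> space ?\<Xi>"
  have comp_a: "(\<lambda>\<omega>. \<lambda>k\<in>?I. a k (\<omega> k)) \<in> ?\<Xi> \<rightarrow>\<^sub>M M"
    by (rule measurable_componentwise[OF a_\<xi>])
  have comp_snd: "(\<lambda>\<omega>. \<lambda>k\<in>?I. snd (\<omega> k)) \<in> ?\<Xi> \<rightarrow>\<^sub>M PiM ?I \<nu>"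
    by (rule measurable_componentwise[OF snd_\<xi>])
  have B: "B1 \<in> sets ?\<Xi>" "B2 \<in> sets ?\<Xi>"
    unfolding B1_def B2_def using measurable_sets[OF comp_a SS] measurable_sets[OF comp_snd K\<nu>] by auto
  have "emeasure ?\<Xi> B1 \<le> emeasure M ?S"
  proof -
    let ?f = "\<lambda>k. indicator (hit (\<alpha> k) (X k) P (C k)) :: 's \<Rightarrow> ennreal"
    have fin_d: "finite_measure (distr (\<xi> k) (\<mu> k) (a k))" if "k \<in> ?I" for k
      by (rule finite_measure.finite_measure_distr[OF fin_\<xi>[OF that] a_\<xi>[OF that]])
    have hitS: "hit (\<alpha> k) (X k) P (C k) \<in> sets (\<mu> k)" if k: "k \<in> ?I" for k
      using closedin_borel_of[OF closedin_hit[OF act[OF k] P(1) compactin_imp_closedin[OF polish_imp_Hausdorff[OF polish[OF k]] C(1)[OF k]]]]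
        sets_\<mu>[OF k] by simp
    have "emeasure ?\<Xi> B1 = emeasure (distr ?\<Xi> M (\<lambda>\<omega>. \<lambda>k\<in>?I. a k (\<omega> k))) ?S"
      unfolding B1_def by (rule emeasure_distr[OF comp_a SS, symmetric])
    also have "distr ?\<Xi> M (\<lambda>\<omega>. \<lambda>k\<in>?I. a k (\<omega> k)) = PiM ?I (\<lambda>k. distr (\<xi> k) (\<mu> k) (a k))"
      by (rule distr_PiM_componentwise[OF fin sf_\<xi> a_\<xi>]) (use fin_d in \<open>auto simp: finite_measure_def\<close>)
    also have "\<dots> = PiM ?I (\<lambda>k. density (\<mu> k) (?f k))"
      using a(2) by (intro PiM_cong) (auto simp: \<xi>_def)
    also have "\<dots> = density M (\<lambda>x. \<Prod>k\<in>?I. ?f k (x k))"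
    proof (rule PiM_density[symmetric, OF fin sigma_finite_\<mu>])
      show "?f k \<in> borel_measurable (\<mu> k)" if "k \<in> ?I" for k using hitS[OF that] by simp
      show "sigma_finite_measure (density (\<mu> k) (?f k))" if "k \<in> ?I" for k
        using fin_d[OF that] a(2)[OF that] by (simp add: \<xi>_def finite_measure_def)
    qed
    also have "emeasure (density M (\<lambda>x. \<Prod>k\<in>?I. ?f k (x k))) ?S = (\<integral>\<^sup>+x. (\<Prod>k\<in>?I. ?f k (x k)) * indicator ?S x \<partial>M)"
    proof (rule emeasure_density[OF _ SS])
      show "(\<lambda>x. \<Prod>k\<in>?I. ?f k (x k)) \<in> borel_measurable M"
        by (intro borel_measurable_prod_ennreal measurable_component) (use hitS in auto)
    qed
    also have "\<dots> \<le> (\<integral>\<^sup>+x. indicator ?S x \<partial>M)"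
    proof (rule nn_integral_mono)
      fix x
      have "(\<Prod>k\<in>?I. ?f k (x k)) \<le> 1"
      proof (cases "\<forall>k\<in>?I. x k \<in> hit (\<alpha> k) (X k) P (C k)")
        case True
        then have "(\<Prod>k\<in>?I. ?f k (x k)) = 1" by (intro prod.neutral) auto
        then show ?thesis by simp
      next
        case False
        then obtain k where k: "k \<in> ?I" "x k \<notin> hit (\<alpha> k) (X k) P (C k)" by blast
        then have zero: "(\<Prod>k\<in>?I. ?f k (x k)) = 0" by (intro prod_zero[OF fin] bexI[of _ k]) auto
        show ?thesis unfolding zero by simp
      qed
      then show "(\<Prod>k\<in>?I. ?f k (x k)) * indicator ?S x \<le> indicator ?S x"
        by (auto simp: indicator_def)
    qed
    also have "\<dots> = emeasure M ?S" using SS by simp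
    finally show ?thesis .
  qed
  moreover have "emeasure ?\<Xi> B2 \<le> emeasure ?\<Xi> B1"
  proof -
    let ?f = "\<lambda>k. indicator (P \<times> C k) :: 'g \<times> 's \<Rightarrow> ennreal"
    let ?F = "\<lambda>\<omega>. \<Prod>k\<in>?I. ?f k (\<omega> k)"
    let ?L = "PiM ?I (\<lambda>k. m \<Otimes>\<^sub>M \<nu> k)"
    have \<Xi>: "?\<Xi> = density ?L ?F"
      unfolding \<xi>_def
    proof (rule PiM_density[symmetric, OF fin sf_pair])
      show "?f k \<in> borel_measurable (m \<Otimes>\<^sub>M \<nu> k)" if "k \<in> ?I" for k using PC[OF that] by simp
      show "sigma_finite_measure (density (m \<Otimes>\<^sub>M \<nu> k) (?f k))" if "k \<in> ?I" for k
        using sf_\<xi>[OF that] by (simp add: \<xi>_def)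
    qed
    have F: "?F \<in> borel_measurable ?L"
      by (intro borel_measurable_prod_ennreal measurable_component) (use PC in auto)
    have em: "emeasure ?\<Xi> B = (\<integral>\<^sup>+\<omega>. ?F \<omega> * indicator B \<omega> \<partial>?L)" if "B \<in> sets ?\<Xi>" for B
      using that unfolding \<Xi> by (intro emeasure_density[OF F]) simp
    \<comment> \<open>Where the weight does not vanish, every time \<open>fst (\<omega> k)\<close>
      lies in \<open>P\<close>, and its inverse, again in \<open>P\<close>, carries the moved point
      back to the base point in \<open>K\<close>.\<close>
    have "?F \<omega> * indicator B2 \<omega> \<le> ?F \<omega> * indicator B1 \<omega>" if \<omega>: "\<omega> \<in> space ?L" for \<omega>
    proof (cases "?F \<omega> = 0 \<or> \<omega> \<notin> B2")
      case False
      have "\<omega> k \<in> P \<times> C k" if "k \<in> ?I" for k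
      proof (rule ccontr)
        assume "\<omega> k \<notin> P \<times> C k"
        then have "?F \<omega> = 0" using that by (intro prod_zero[OF fin] bexI[of _ k]) auto
        then show False using False by blast
      qed
      then have hz: "fst (\<omega> k) \<in> P" "snd (\<omega> k) \<in> C k" if "k \<in> ?I" for k using that by (auto simp: mem_Times_iff)
      let ?x = "\<lambda>k\<in>?I. a k (\<omega> k)"
      let ?g = "\<lambda>k\<in>?I. inv (fst (\<omega> k))"
      have zK: "(\<lambda>k\<in>?I. snd (\<omega> k)) \<in> K" and \<omega>\<Xi>: "\<omega> \<in> space ?\<Xi>" using False by (auto simp: B2_def)
      have zX: "snd (\<omega> k) \<in> topspace (X k)" if "k \<in> ?I" for k
        using hz(2)[OF that] C(2)[OF that] Z_subset[OF that] by auto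
      have hG: "fst (\<omega> k) \<in> carrier G" if "k \<in> ?I" for k using hz(1)[OF that] PG by auto
      have ax: "a k (\<omega> k) = \<alpha> k (fst (\<omega> k)) (snd (\<omega> k))" for k by (simp add: a_def case_prod_beta)
      have xX: "?x \<in> topspace XX"
        using act_simps(1)[OF _ zX hG] by (simp add: ax)
      have "full ?g ?x = (\<lambda>k\<in>?I. snd (\<omega> k))"
      proof (rule XX_eqI)
        have gP: "?g \<in> carrier (product_group ?I (\<lambda>_. G))" using hG by simp
        show "full ?g ?x \<in> topspace XX" by (rule actionD(3)[OF full_act gP xX])
        show "(\<lambda>k\<in>?I. snd (\<omega> k)) \<in> topspace XX" using zX by simp
        fix k assume k: "k \<in> ?I"
        have "full ?g ?x k = \<alpha> k (inv (fst (\<omega> k))) (\<alpha> k (fst (\<omega> k)) (snd (\<omega> k)))"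
        proof -
          have "full ?g ?x k = \<alpha> k (?g k) (?x k)" by (rule full_apply[OF xX k])
          moreover have "?g k = inv (fst (\<omega> k))" "?x k = \<alpha> k (fst (\<omega> k)) (snd (\<omega> k))" using k ax by simp_all
          ultimately show ?thesis by simp
        qed
        also have "\<dots> = snd (\<omega> k)"
          using act_simps(2,3)[OF k zX[OF k]] hG[OF k] by simp
        finally show "full ?g ?x k = (\<lambda>k\<in>?I. snd (\<omega> k)) k" using k by simp
      qed
      then have "?x \<in> ?S" using zK xX hz(1) P(3) by (auto simp: hit_def intro!: bexI[of _ ?g])
      then have "\<omega> \<in> B1" using \<omega>\<Xi> by (simp add: B1_def)
      then show ?thesis by (simp add: indicator_def)
    qed (auto simp: indicator_def)
    then show ?thesis unfolding em[OF B(1)] em[OF B(2)] by (rule nn_integral_mono)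
  qed
  moreover have "emeasure ?\<Xi> B2 > 0"
  proof -
    let ?f = "\<lambda>k z. ?c * indicator (C k) z :: ennreal"
    have fin_d: "finite_measure (distr (\<xi> k) (\<nu> k) snd)" if "k \<in> ?I" for k
      by (rule finite_measure.finite_measure_distr[OF fin_\<xi>[OF that] snd_\<xi>])
    have fm: "?f k \<in> borel_measurable (\<nu> k)" if "k \<in> ?I" for k using CS[OF that] by simp
    have "emeasure ?\<Xi> B2 = emeasure (distr ?\<Xi> (PiM ?I \<nu>) (\<lambda>\<omega>. \<lambda>k\<in>?I. snd (\<omega> k))) K"
      unfolding B2_def by (rule emeasure_distr[OF comp_snd K\<nu>, symmetric])
    also have "distr ?\<Xi> (PiM ?I \<nu>) (\<lambda>\<omega>. \<lambda>k\<in>?I. snd (\<omega> k)) = PiM ?I (\<lambda>k. distr (\<xi> k) (\<nu> k) snd)"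
      by (rule distr_PiM_componentwise[OF fin sf_\<xi> snd_\<xi>]) (use fin_d in \<open>auto simp: finite_measure_def\<close>)
    also have "\<dots> = PiM ?I (\<lambda>k. density (\<nu> k) (?f k))"
      by (intro PiM_cong refl distr_snd)
    also have "\<dots> = density (PiM ?I \<nu>) (\<lambda>x. \<Prod>k\<in>?I. ?f k (x k))"
    proof (rule PiM_density[symmetric, OF fin sigma_finite_\<nu> fm])
      show "sigma_finite_measure (density (\<nu> k) (?f k))" if "k \<in> ?I" for k
        using fin_d[OF that] distr_snd[OF that] by (simp add: finite_measure_def)
    qed
    also have "emeasure (density (PiM ?I \<nu>) (\<lambda>x. \<Prod>k\<in>?I. ?f k (x k))) K = (\<integral>\<^sup>+x. (\<Prod>k\<in>?I. ?f k (x k)) * indicator K x \<partial>PiM ?I \<nu>)"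
      by (intro emeasure_density K\<nu> borel_measurable_prod_ennreal measurable_component fm) auto
    also have "\<dots> = (\<integral>\<^sup>+x. ?c ^ card ?I * indicator K x \<partial>PiM ?I \<nu>)"
    proof (rule nn_integral_cong)
      fix x
      show "(\<Prod>k\<in>?I. ?f k (x k)) * indicator K x = ?c ^ card ?I * indicator K x"
      proof (cases "x \<in> K")
        case True
        then have "?f k (x k) = ?c" for k by (auto simp: C_def)
        then show ?thesis by simp
      qed simp
    qed
    also have "\<dots> = ?c ^ card ?I * emeasure (PiM ?I \<nu>) K"
      by (rule nn_integral_cmult_indicator[OF K\<nu>])
    finally have eq: "emeasure ?\<Xi> B2 = ?c ^ card ?I * emeasure (PiM ?I \<nu>) K" .
    have "?c \<noteq> 0" "emeasure (PiM ?I \<nu>) K \<noteq> 0" using P(2) K(3) by (simp_all only: zero_less_iff_neq_zero not_False_eq_True)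
    then have "?c ^ card ?I * emeasure (PiM ?I \<nu>) K \<noteq> 0" by (metis mult_eq_0_iff power_not_zero)
    then show ?thesis unfolding eq by (rule iffD2[OF zero_less_iff_neq_zero])
  qed
  ultimately show ?thesis by (blast intro: order.strict_trans2)
qed

end

section \<open>The measure induced on orbits\<close>

context commensurable_system
begin

abbreviation orbit_of :: "(nat \<Rightarrow> 's) set \<Rightarrow> (nat \<Rightarrow> 's) set" where
  "orbit_of K \<equiv> hit diag XX (carrier G) K"

lemma orbit_of_invariant:
  assumes a: "a \<in> carrier G" and x: "x \<in> topspace XX"
  shows "diag a x \<in> orbit_of K \<longleftrightarrow> x \<in> orbit_of K"
proof
  assume "diag a x \<in> orbit_of K"
  then obtain g where "g \<in> carrier G" "diag g (diag a x) \<in> K" by (auto simp: hit_def)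
  then show "x \<in> orbit_of K"
    using actionD(5)[OF diag_act, of g a x] a x unfolding hit_def by (intro CollectI conjI bexI[of _ "g \<otimes> a"]) auto
next
  assume "x \<in> orbit_of K"
  then obtain g where g: "g \<in> carrier G" "diag g x \<in> K" by (auto simp: hit_def)
  have "g \<otimes> inv a \<otimes> a = g" using g a by (simp add: m_assoc)
  then have "diag (g \<otimes> inv a) (diag a x) = diag g x"
    using actionD(5)[OF diag_act, of "g \<otimes> inv a" a x] g a x by simp
  then show "diag a x \<in> orbit_of K"
    using g a diag_closed[OF a x] unfolding hit_def by (intro CollectI conjI bexI[of _ "g \<otimes> inv a"]) auto
qed

text \<open>By sigma-compactness of \<open>G\<close> the orbit is a countable union of hits with
  compact windows, each of them closed.\<close>

lemma fsigma_orbit_of: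
  assumes "compactin XX K"
  shows "fsigma_in XX (orbit_of K)"
proof -
  obtain L :: "nat \<Rightarrow> 'g set" where L: "\<And>n. compactin T (L n)" "(\<Union>n. L n) = carrier G"
    by (rule sigma_compact) (rule that)
  show ?thesis
    unfolding L(2)[symmetric] hit_UN_left
    by (intro fsigma_in_UN closed_imp_fsigma_in closedin_hit[OF diag_act L(1)]
        compactin_imp_closedin[OF Hausdorff_XX assms])
qed

text \<open>The measure is the transverse measure of \<open>M\<close> for the action of the kernel \<open>N\<^sub>1\<close>, restricted to
  the orbit of \<open>K\<close>. Its invariance comes from the conjugation invariance of Haar measure.\<close>

lemma induced_measure:
  assumes K: "compactin XX K" "K \<subseteq> Pi\<^sub>E {1..r} Z" "emeasure (PiM {1..r} \<nu>) K > 0"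
  obtains \<sigma> where "sets \<sigma> = sets (borel_of XX)" "finite_measure \<sigma>" "invariant_measure G diag \<sigma>"
    "emeasure \<sigma> (orbit_of K) > 0"
proof -
  let ?J = "{2..r}"
  interpret M: prob_space M by (rule prob_M)
  interpret HH: bi_invariant_measure H TH "PiM ?J (\<lambda>_. m)"
    by (rule bi_invariant_product) simp
  obtain V where V: "openin T V" "\<one> \<in> V"
    "\<And>n x. n \<in> carrier H \<Longrightarrow> (\<And>j. j \<in> ?J \<Longrightarrow> n j \<in> V) \<Longrightarrow> x \<in> simultaneous_hitting r G X \<alpha> Z \<Longrightarrow>
      rest n x \<in> simultaneous_hitting r G X \<alpha> Z \<Longrightarrow> n = \<one>\<^bsub>H\<^esub>"
    by (rule rest_separated) blast
  \<comment> \<open>Quotients of elements of \<open>U0\<close> lie in \<open>V\<close>, which makes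
    returns through the window \<open>U\<close> unique. Below, quotients of elements of
    \<open>P\<close> lie in \<open>W\<close>, hence in \<open>U0\<close>, so that the thickening of
    \<open>K\<close> by \<open>P\<close> is seen through the window.\<close>
  obtain U0 W where U0: "compactin T U0" "openin T W" "\<one> \<in> W" "W \<subseteq> U0" "\<And>a. a \<in> U0 \<Longrightarrow> inv a \<in> U0"
    "\<And>a b. a \<in> U0 \<Longrightarrow> b \<in> U0 \<Longrightarrow> a \<otimes> inv b \<in> V"
    by (rule symmetric_compact_nhd[OF V(1,2)]) (rule that)
  obtain P where P: "compactin T P" "0 < emeasure m P" "\<And>a. a \<in> P \<Longrightarrow> inv a \<in> P"
    "\<And>a b. a \<in> P \<Longrightarrow> b \<in> P \<Longrightarrow> a \<otimes> inv b \<in> W"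
    "\<And>k h h' s. k \<in> {1..r} \<Longrightarrow> h \<in> P \<Longrightarrow> h' \<in> P \<Longrightarrow> s \<in> space (\<mu> k) \<Longrightarrow> \<alpha> k h s \<in> Z k \<Longrightarrow>
      \<alpha> k h' s \<in> Z k \<Longrightarrow> h = h'"
    by (rule small_compact_nhd[OF U0(2,3)]) blast
  have U0G: "U0 \<subseteq> carrier G" and PG: "P \<subseteq> carrier G"
    using compactin_subset_topspace[OF U0(1)] compactin_subset_topspace[OF P(1)] topspace_eq by auto
  define U where "U = Pi\<^sub>E ?J (\<lambda>_. U0)"
  have Uc: "compactin TH U" unfolding U_def using U0(1) by (simp add: compactin_PiE)
  have UH: "U \<subseteq> carrier H" using U0G unfolding U_def by (auto intro!: PiE_mono)
  have U_mem: "n j \<in> U0" if "n \<in> U" "j \<in> ?J" for n j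
    by (rule PiE_mem[OF that(1)[unfolded U_def] that(2)])
  define Y where "Y = orbit_of K"
  have YX: "Y \<subseteq> topspace XX" by (auto simp: Y_def hit_def)
  have fY: "fsigma_in XX Y" unfolding Y_def by (rule fsigma_orbit_of[OF K(1)])
  have Y_inv: "diag a x \<in> Y \<longleftrightarrow> x \<in> Y" if "a \<in> carrier G" "x \<in> topspace XX" for a x
    unfolding Y_def by (rule orbit_of_invariant[OF that])
  \<comment> \<open>Here the inclusion of \<open>K\<close> in the product of the \<open>Z k\<close>
    enters: it places the orbit inside the set whose return times commensurability
    separates.\<close>
  have Y_SH: "Y \<subseteq> simultaneous_hitting r G X \<alpha> Z"
  proof
    fix x assume "x \<in> Y"
    then obtain g where x: "x \<in> topspace XX" and g: "g \<in> carrier G" "diag g x \<in> K"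
      by (auto simp: Y_def hit_def)
    have "\<alpha> k g (x k) \<in> Z k" if "k \<in> {1..r}" for k
      using subsetD[OF K(2) g(2)] PiE_mem[of "diag g x" "{1..r}" Z k] that diag_apply[OF x that, of g] by simp
    then show "x \<in> simultaneous_hitting r G X \<alpha> Z"
      unfolding simultaneous_hitting_def product_space_def using x g(1) by blast
  qed
  have uniq: "n = n'" if n: "x \<in> topspace XX" "n \<in> U" "n' \<in> U" "rest n x \<in> Y" "rest n' x \<in> Y" for x n n'
  proof -
    have nH: "n \<in> carrier H" "n' \<in> carrier H" using n UH by auto
    define p where "p = n' \<otimes>\<^bsub>H\<^esub> inv\<^bsub>H\<^esub> n"
    have pH: "p \<in> carrier H" unfolding p_def by (intro HH.m_closed HH.inv_closed nH)
    have pV: "p j \<in> V" if j: "j \<in> ?J" for j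
    proof -
      have "inv\<^bsub>H\<^esub> n = (\<lambda>i\<in>?J. inv (n i))"
        by (rule inv_product_group) (use nH is_group in auto)
      then have "p j = n' j \<otimes> inv (n j)" using j by (simp add: p_def)
      then show ?thesis using U0(6)[OF U_mem[OF n(3) j] U_mem[OF n(2) j]] by simp
    qed
    have pn: "p \<otimes>\<^bsub>H\<^esub> n = n'"
      unfolding p_def by (simp only: HH.m_assoc[OF nH(2) HH.inv_closed[OF nH(1)] nH(1)] HH.l_inv[OF nH(1)] HH.r_one[OF nH(2)])
    have "rest p (rest n x) = rest n' x"
      using actionD(5)[OF rest_act pH nH(1) n(1)] pn by simp
    then have "p = \<one>\<^bsub>H\<^esub>"
      using V(3)[OF pH pV, of "rest n x"] subsetD[OF Y_SH n(4)] subsetD[OF Y_SH n(5)] by simp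
    then show ?thesis using pn HH.l_one[OF nH(1)] by simp
  qed
  define D where "D = hit rest XX U Y"
  have hitM: "hit rest XX U (A \<inter> Y) \<in> sets M" if "closedin XX A" for A
    using fsigma_in_borel_of[OF fsigma_in_hit[OF rest_act Uc fsigma_in_Int[OF closed_imp_fsigma_in[OF that] fY]]] sets_M
    by simp
  have DM: "D \<in> sets M"
    using fsigma_in_borel_of[OF fsigma_in_hit[OF rest_act Uc fY]] sets_M by (simp add: D_def)
  \<comment> \<open>The return map to \<open>Y\<close> through the window \<open>U\<close>;
    \<open>uniq\<close> justifies the description. The image of \<open>M\<close> restricted to
    \<open>D\<close> under it is the transverse measure on \<open>Y\<close>, scaled by the Haar
    measure of \<open>U\<close>.\<close>
  define R where "R x = rest (THE n. n \<in> U \<and> rest n x \<in> Y) x" for x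
  have R_eq: "R x = rest n x" if n: "x \<in> topspace XX" "n \<in> U" "rest n x \<in> Y" for x n
  proof -
    have "(THE n. n \<in> U \<and> rest n x \<in> Y) = n"
      by (rule the_equality) (use n uniq[OF n(1)] in auto)
    then show ?thesis by (simp add: R_def)
  qed
  have R_pre: "{x \<in> D. R x \<in> A} = hit rest XX U (A \<inter> Y)" for A
  proof (intro equalityI subsetI)
    fix x assume "x \<in> {x \<in> D. R x \<in> A}"
    then obtain n where n: "x \<in> topspace XX" "n \<in> U" "rest n x \<in> Y" "R x \<in> A" by (auto simp: D_def hit_def)
    then show "x \<in> hit rest XX U (A \<inter> Y)" using R_eq[OF n(1-3)] by (auto simp: hit_def)
  next
    fix x assume "x \<in> hit rest XX U (A \<inter> Y)"
    then obtain n where n: "x \<in> topspace XX" "n \<in> U" "rest n x \<in> Y" "rest n x \<in> A" by (auto simp: hit_def)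
    then show "x \<in> {x \<in> D. R x \<in> A}" using R_eq[OF n(1-3)] by (auto simp: D_def hit_def)
  qed
  have spD: "space (restrict_space M D) = D"
    using sets.sets_into_space[OF DM] by (auto simp: space_restrict_space)
  have R: "R \<in> restrict_space M D \<rightarrow>\<^sub>M borel_of XX"
  proof (rule measurable_sigma_sets[OF sets_borel_of_closedin])
    show "R \<in> space (restrict_space M D) \<rightarrow> topspace XX"
      unfolding spD using R_eq YX by (fastforce simp: D_def hit_def)
    fix A assume "A \<in> {C. closedin XX C}"
    then have A: "closedin XX A" by simp
    have "R -` A \<inter> space (restrict_space M D) = hit rest XX U (A \<inter> Y)"
      unfolding spD using R_pre[of A] by auto
    moreover have "hit rest XX U (A \<inter> Y) \<subseteq> D" by (auto simp: D_def hit_def)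
    ultimately show "R -` A \<inter> space (restrict_space M D) \<in> sets (restrict_space M D)"
      using hitM[OF A] sets_restrict_space_iff[of D M] DM sets.sets_into_space[OF DM] by (simp add: Int_absorb2)
  qed (use closedin_subset in blast)
  define \<sigma> where "\<sigma> = distr (restrict_space M D) (borel_of XX) R"
  have sets: "sets \<sigma> = sets (borel_of XX)" by (simp add: \<sigma>_def)
  have sp: "space \<sigma> = topspace XX" by (simp add: \<sigma>_def)
  have em: "emeasure \<sigma> A = emeasure M (hit rest XX U (A \<inter> Y))" if A: "A \<in> sets (borel_of XX)" for A
  proof -
    have "emeasure \<sigma> A = emeasure (restrict_space M D) (R -` A \<inter> space (restrict_space M D))"
      unfolding \<sigma>_def by (rule emeasure_distr[OF R A])
    also have "R -` A \<inter> space (restrict_space M D) = hit rest XX U (A \<inter> Y)"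
      unfolding spD using R_pre[of A] by auto
    also have "emeasure (restrict_space M D) \<dots> = emeasure M (hit rest XX U (A \<inter> Y))"
      by (rule emeasure_restrict_space) (use DM in \<open>auto simp: D_def hit_def\<close>)
    finally show ?thesis .
  qed
  have fin: "finite_measure \<sigma>"
    by (rule finite_measureI) (simp only: sp em[OF openin_borel_of[OF openin_topspace]] M.emeasure_finite, simp)
  have invM: "invariant_measure G diag M" "invariant_measure H rest M"
    by (rule invariant_M; auto)+
  let ?l = "emeasure (PiM ?J (\<lambda>_. m))"
  have lU: "?l U = emeasure m U0 ^ card ?J"
    unfolding U_def using emeasure_PiM_on[of ?J "\<lambda>_. m" "\<lambda>_. U0"] sigma_finite_m compactin_sets_m[OF U0(1)] by simp
  have mU0: "0 < emeasure m U0" "emeasure m U0 < \<infinity>"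
  proof -
    have "0 < emeasure m W" by (rule haar_open_pos[OF haar U0(2)]) (use U0(3) in auto)
    also have "\<dots> \<le> emeasure m U0" using compactin_sets_m[OF U0(1)] U0(4) by (intro emeasure_mono)
    finally show "0 < emeasure m U0" .
  qed (rule haar_compact_finite[OF U0(1)])
  have lU': "?l U \<noteq> 0" "?l U \<noteq> \<top>"
    using mU0 unfolding lU by (auto simp: power_eq_top_ennreal)
  have inv: "invariant_measure G diag \<sigma>"
    unfolding invariant_measure_def
  proof (intro ballI conjI)
    fix a assume a: "a \<in> carrier G"
    have cont: "continuous_map XX XX (diag a)"
      by (rule action_continuous_element[OF diag_act]) (simp add: a topspace_eq)
    have da: "diag a \<in> borel_of XX \<rightarrow>\<^sub>M borel_of XX" by (rule continuous_map_measurable[OF cont])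
    then show da\<sigma>: "diag a \<in> \<sigma> \<rightarrow>\<^sub>M \<sigma>" using sets by (simp cong: measurable_cong_sets)
    let ?cj = "\<lambda>n. \<lambda>j\<in>?J. inv a \<otimes> n j \<otimes> a"
    \<comment> \<open>The window \<open>U0\<close> conjugated by \<open>a\<close>; by bi-invariance
      it keeps its Haar measure.\<close>
    define Ca where "Ca = {x \<in> carrier G. inv a \<otimes> x \<otimes> a \<in> U0}"
    have cj_inv: "inv a \<otimes> (a \<otimes> x \<otimes> inv a) \<otimes> a = x" "a \<otimes> (inv a \<otimes> x \<otimes> a) \<otimes> inv a = x" if "x \<in> carrier G" for x
      using a that by (simp_all add: m_assoc, simp_all add: m_assoc[symmetric])
    have Ca_image: "Ca = (\<lambda>x. a \<otimes> x \<otimes> inv a) ` U0"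
    proof (intro equalityI subsetI)
      fix x assume "x \<in> Ca"
      then show "x \<in> (\<lambda>x. a \<otimes> x \<otimes> inv a) ` U0"
        using cj_inv(2)[of x] by (intro image_eqI[of _ _ "inv a \<otimes> x \<otimes> a"]) (auto simp: Ca_def)
    next
      fix x assume "x \<in> (\<lambda>x. a \<otimes> x \<otimes> inv a) ` U0"
      then obtain y where "y \<in> U0" "x = a \<otimes> y \<otimes> inv a" by auto
      then show "x \<in> Ca" using cj_inv(1)[of y] U0G a by (auto simp: Ca_def)
    qed
    have "continuous_map T T (\<lambda>x. a \<otimes> x \<otimes> inv a)"
      using a by (intro continuous_map_multI) (auto simp: topspace_eq)
    then have Cac: "compactin T Ca" unfolding Ca_image by (rule image_compactin[OF U0(1)])
    have mCa: "emeasure m Ca = emeasure m U0"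
    proof -
      let ?E = "{y \<in> carrier G. y \<otimes> a \<in> U0}"
      have "?E = (\<lambda>y. y \<otimes> a) -` U0 \<inter> space m" by (auto simp: space_m)
      also have "\<dots> \<in> sets m"
        using measurable_sets[OF continuous_map_measurable[OF continuous_map_right_mult[OF a]], of U0] compactin_sets_m[OF U0(1)] sets_m
        by (simp add: space_m topspace_eq)
      finally have E: "?E \<in> sets m" .
      have "Ca = {x \<in> carrier G. inv a \<otimes> x \<in> ?E}" using a by (auto simp: Ca_def)
      then have "emeasure m Ca = emeasure m ?E" using left_invariant[OF inv_closed[OF a] E] by simp
      also have "\<dots> = emeasure m U0" by (rule right_invariant[OF a compactin_sets_m[OF U0(1)]])
      finally show ?thesis .
    qed
    define Ua where "Ua = Pi\<^sub>E ?J (\<lambda>_. Ca)"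
    have Uac: "compactin TH Ua" unfolding Ua_def using Cac by (simp add: compactin_PiE)
    have UaH: "Ua \<subseteq> carrier H" unfolding Ua_def by (auto intro!: PiE_mono simp: Ca_def)
    have cjU: "?cj n \<in> U" if "n \<in> Ua" for n using that by (auto simp: Ua_def U_def Ca_def PiE_iff)
    have cj_inj: "n = n'" if n: "n \<in> Ua" "n' \<in> Ua" "?cj n = ?cj n'" for n n'
    proof (rule PiE_ext[of _ ?J "\<lambda>_. carrier G"])
      fix j assume j: "j \<in> ?J"
      have "inv a \<otimes> n j \<otimes> a = inv a \<otimes> n' j \<otimes> a" using fun_cong[OF n(3), of j] j by simp
      moreover have "n j \<in> carrier G" "n' j \<in> carrier G" using n(1,2) j by (auto simp: Ua_def Ca_def PiE_iff)
      ultimately show "n j = n' j" using cj_inv(2) by metis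
    qed (use n UaH in auto)
    \<comment> \<open>The comparison of windows measures the second one through inverses;
      \<open>Ua\<close> is symmetric because \<open>U0\<close> is.\<close>
    have lUa: "?l {b \<in> carrier H. inv\<^bsub>H\<^esub> b \<in> Ua} = ?l U"
    proof -
      have Ca_inv: "inv x \<in> Ca" if "x \<in> Ca" for x
      proof -
        have x: "x \<in> carrier G" "inv a \<otimes> x \<otimes> a \<in> U0" using that by (auto simp: Ca_def)
        have "inv (inv a \<otimes> x \<otimes> a) = inv a \<otimes> inv x \<otimes> a" using a x(1) by (simp add: inv_mult_group m_assoc)
        then show ?thesis using U0(5)[OF x(2)] x(1) by (simp add: Ca_def)
      qed
      have "{b \<in> carrier H. inv\<^bsub>H\<^esub> b \<in> Ua} = Ua"
      proof (intro equalityI subsetI)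
        fix b assume "b \<in> {b \<in> carrier H. inv\<^bsub>H\<^esub> b \<in> Ua}"
        then have b: "b \<in> Pi\<^sub>E ?J (\<lambda>_. carrier G)" "(\<lambda>j\<in>?J. inv (b j)) \<in> Ua"
          using inv_product_group[of b ?J "\<lambda>_. G"] is_group by auto
        show "b \<in> Ua"
          unfolding Ua_def
        proof (rule PiE_I)
          fix j assume j: "j \<in> ?J"
          have "inv (b j) \<in> Ca" using PiE_mem[OF b(2)[unfolded Ua_def] j] j by simp
          then show "b j \<in> Ca" using Ca_inv[of "inv (b j)"] PiE_mem[OF b(1) j] by simp
        next
          fix j assume "j \<notin> ?J"
          then show "b j = undefined" by (rule PiE_arb[OF b(1)])
        qed
      next
        fix b assume b: "b \<in> Ua"
        then have bH: "b \<in> Pi\<^sub>E ?J (\<lambda>_. carrier G)" using UaH by auto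
        have "inv\<^bsub>H\<^esub> b = (\<lambda>j\<in>?J. inv (b j))" by (rule inv_product_group[OF bH is_group])
        also have "\<dots> \<in> Ua"
          unfolding Ua_def restrict_PiE_iff using Ca_inv PiE_mem[OF b[unfolded Ua_def]] by blast
        finally show "b \<in> {b \<in> carrier H. inv\<^bsub>H\<^esub> b \<in> Ua}" using bH by simp
      qed
      then have "?l {b \<in> carrier H. inv\<^bsub>H\<^esub> b \<in> Ua} = emeasure m Ca ^ card ?J"
        unfolding Ua_def using emeasure_PiM_on[of ?J "\<lambda>_. m" "\<lambda>_. Ca"] sigma_finite_m compactin_sets_m[OF Cac] by simp
      then show ?thesis by (simp add: mCa lU)
    qed
    show "distr \<sigma> \<sigma> (diag a) = \<sigma>"
    proof (rule borel_of_measure_eqI_closed)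
      show "finite_measure (distr \<sigma> \<sigma> (diag a))" by (rule finite_measure.finite_measure_distr[OF fin da\<sigma>])
      fix A assume A: "closedin XX A"
      define Aa where "Aa = {x \<in> topspace XX. diag a x \<in> A}"
      have Aac: "closedin XX Aa" unfolding Aa_def by (rule closedin_continuous_map_preimage[OF cont A])
      have fA: "fsigma_in XX (A \<inter> Y)" by (rule fsigma_in_Int[OF closed_imp_fsigma_in[OF A] fY])
      have rest_diag: "rest n (diag a x) = diag a (rest (?cj n) x)" if "n \<in> Ua" "x \<in> topspace XX" for n x
        using conj_rest[OF that(2) a] that(1) UaH by auto
      \<comment> \<open>Hitting the translated set through \<open>U\<close> amounts to translating
        diagonally by \<open>a\<close> and then hitting the original set through the conjugated
        window.\<close>
      have shift: "hit rest XX U (Aa \<inter> Y) = {x \<in> topspace XX. diag a x \<in> hit rest XX Ua (A \<inter> Y)}"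
      proof (intro equalityI subsetI)
        fix x assume "x \<in> hit rest XX U (Aa \<inter> Y)"
        then obtain n where n: "x \<in> topspace XX" "n \<in> U" "rest n x \<in> Aa" "rest n x \<in> Y" by (auto simp: hit_def)
        define n2 where "n2 = (\<lambda>j\<in>?J. a \<otimes> n j \<otimes> inv a)"
        have nj: "n j \<in> U0" if "j \<in> ?J" for j using U_mem[OF n(2) that] .
        have n2: "n2 \<in> Ua" using nj by (auto simp: n2_def Ua_def Ca_image)
        have "?cj n2 = n"
        proof (rule PiE_ext[of _ ?J "\<lambda>_. carrier G"])
          show "?cj n2 \<in> Pi\<^sub>E ?J (\<lambda>_. carrier G)"
            using subsetD[OF UH cjU[OF n2]] by (simp only: carrier_product_group)
          show "n \<in> Pi\<^sub>E ?J (\<lambda>_. carrier G)" using subsetD[OF UH n(2)] by (simp only: carrier_product_group)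
          fix j assume j: "j \<in> ?J"
          then show "?cj n2 j = n j" using cj_inv(1)[of "n j"] nj[OF j] U0G by (auto simp: n2_def)
        qed
        then have "rest n2 (diag a x) = diag a (rest n x)" using rest_diag[OF n2 n(1)] by simp
        moreover have "diag a (rest n x) \<in> A \<inter> Y"
          using n(3,4) Y_inv[OF a] YX by (auto simp: Aa_def)
        ultimately show "x \<in> {x \<in> topspace XX. diag a x \<in> hit rest XX Ua (A \<inter> Y)}"
        proof -
          assume eq: "rest n2 (diag a x) = diag a (rest n x)" and AY: "diag a (rest n x) \<in> A \<inter> Y"
          have "rest n2 (diag a x) \<in> A \<inter> Y" unfolding eq by (rule AY)
          then have "diag a x \<in> hit rest XX Ua (A \<inter> Y)"
            unfolding hit_def mem_Collect_eq by (intro conjI bexI[of _ n2] diag_closed a n(1) n2)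
          then show ?thesis using n(1) by (intro CollectI conjI)
        qed
      next
        fix x assume "x \<in> {x \<in> topspace XX. diag a x \<in> hit rest XX Ua (A \<inter> Y)}"
        then obtain n where n: "x \<in> topspace XX" "n \<in> Ua" "rest n (diag a x) \<in> A \<inter> Y" by (auto simp: hit_def)
        have rX: "rest (?cj n) x \<in> topspace XX" using rest_closed cjU[OF n(2)] UH n(1) by blast
        have "rest (?cj n) x \<in> Aa \<inter> Y"
          using n(3) rX Y_inv[OF a rX] unfolding rest_diag[OF n(2,1)] Aa_def by auto
        then show "x \<in> hit rest XX U (Aa \<inter> Y)"
          using n(1) cjU[OF n(2)] unfolding hit_def by blast
      qed
      have "emeasure (distr \<sigma> \<sigma> (diag a)) A = emeasure \<sigma> Aa"
        using closedin_borel_of[OF A] sets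
        by (subst emeasure_distr[OF da\<sigma>]) (auto simp: sp Aa_def intro!: arg_cong[where f = "emeasure \<sigma>"])
      also have "\<dots> = emeasure M (hit rest XX U (Aa \<inter> Y))" by (rule em[OF closedin_borel_of[OF Aac]])
      also have "\<dots> = emeasure M (hit rest XX Ua (A \<inter> Y))"
        unfolding shift
        by (rule emeasure_action_preimage[OF invM(1) sets_M a])
          (use fsigma_in_borel_of[OF fsigma_in_hit[OF rest_act Uac fA]] sets_M in simp)
      \<comment> \<open>Both windows allow at most one return and have the same positive finite Haar
        measure, which therefore cancels in \<open>hit_measure_ratio\<close>.\<close>
      also have "\<dots> = emeasure M (hit rest XX U (A \<inter> Y))"
      proof -
        have uniq_a: "n = n'" if n: "y \<in> topspace XX" "n \<in> Ua" "n' \<in> Ua" "rest n y \<in> A \<inter> Y" "rest n' y \<in> A \<inter> Y" for y n n'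
        proof -
          define x where "x = diag (inv a) y"
          have x: "x \<in> topspace XX" unfolding x_def by (rule diag_closed) (use a n(1) in auto)
          have y: "y = diag a x"
            using actionD(5)[OF diag_act a inv_closed[OF a] n(1)] actionD(4)[OF diag_act n(1)] a by (simp add: x_def)
          have "rest (?cj n) x \<in> Y" "rest (?cj n') x \<in> Y"
            using n(4,5) Y_inv[OF a rest_closed[OF _ x]] cjU[OF n(2)] cjU[OF n(3)] UH
            unfolding y rest_diag[OF n(2) x] rest_diag[OF n(3) x] by blast+
          then have "?cj n = ?cj n'" using uniq[OF x cjU[OF n(2)] cjU[OF n(3)]] by blast
          then show ?thesis by (rule cj_inj[OF n(2,3)])
        qed
        have "emeasure M (hit rest XX U (A \<inter> Y)) * ?l {b \<in> carrier H. inv\<^bsub>H\<^esub> b \<in> Ua} = emeasure M (hit rest XX Ua (A \<inter> Y)) * ?l U"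
          by (rule HH.hit_measure_ratio[OF rest_act second_countable_XX sets_M M.finite_measure_axioms invM(2) fA Uc Uac])
            (use uniq uniq_a in blast)+
        then have "?l U * emeasure M (hit rest XX Ua (A \<inter> Y)) = ?l U * emeasure M (hit rest XX U (A \<inter> Y))"
          unfolding lUa by (simp add: mult.commute)
        then show ?thesis using lU' by (simp add: ennreal_mult_cancel_left)
      qed
      also have "\<dots> = emeasure \<sigma> A" by (rule em[OF closedin_borel_of[OF A], symmetric])
      finally show "emeasure (distr \<sigma> \<sigma> (diag a)) A = emeasure \<sigma> A" .
    qed (use sets in auto)
  qed
  have "emeasure \<sigma> Y > 0"
  proof -
    \<comment> \<open>If the tuple \<open>g\<close> moves \<open>x\<close> into \<open>K\<close>,
      the kernel part \<open>inv (g 1) \<otimes> g j\<close> lies in the window, and the diagonal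
      translation by \<open>g 1\<close> then completes the move. So the kernel part already lands on
      the orbit of \<open>K\<close>.\<close>
    have "hit full XX (Pi\<^sub>E {1..r} (\<lambda>_. P)) K \<subseteq> hit rest XX U (Y \<inter> Y)"
    proof
      fix x assume "x \<in> hit full XX (Pi\<^sub>E {1..r} (\<lambda>_. P)) K"
      then obtain g where x: "x \<in> topspace XX" and g: "g \<in> Pi\<^sub>E {1..r} (\<lambda>_. P)" "full g x \<in> K" by (auto simp: hit_def)
      have gP: "g k \<in> P" if "k \<in> {1..r}" for k by (rule PiE_mem[OF g(1) that])
      have gG: "g k \<in> carrier G" if "k \<in> {1..r}" for k using gP[OF that] PG by auto
      have k1: "1 \<in> {1..r}" using r by simp
      define n where "n = (\<lambda>j\<in>?J. inv (g 1) \<otimes> g j)"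
      have nj: "inv (g 1) \<otimes> g j \<in> U0" if "j \<in> ?J" for j
      proof -
        have j: "j \<in> {1..r}" using that by auto
        have "inv (g 1) \<otimes> inv (inv (g j)) \<in> W" by (rule P(4)[OF P(3)[OF gP[OF k1]] P(3)[OF gP[OF j]]])
        then show ?thesis using U0(4) gG[OF j] by auto
      qed
      have nU: "n \<in> U" using nj by (auto simp: n_def U_def)
      have rX: "rest n x \<in> topspace XX" using rest_closed nU UH x by blast
      have fX: "full g x \<in> topspace XX" using compactin_subset_topspace[OF K(1)] g(2) by auto
      have "diag (g 1) (rest n x) = full g x"
      proof (rule XX_eqI[OF diag_closed[OF gG[OF k1] rX] fX])
        fix k assume k: "k \<in> {1..r}"
        show "diag (g 1) (rest n x) k = full g x k"
        proof (cases "k = 1")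
          case True
          show ?thesis unfolding True diag_apply[OF rX k1] rest_apply_first[OF x] full_apply[OF x k1] by simp
        next
          case False
          then have k2: "k \<in> ?J" using index_cases[OF k] by blast
          have "g 1 \<otimes> (inv (g 1) \<otimes> g k) = g k" using gG[OF k1] gG[OF k] by (simp add: m_assoc[symmetric])
          then show ?thesis
            unfolding diag_apply[OF rX k] rest_apply[OF x k2] full_apply[OF x k]
            using act_simps(3)[OF k XX_point[OF x k], of "g 1" "inv (g 1) \<otimes> g k"] gG[OF k1] gG[OF k] k2 by (simp add: n_def)
        qed
      qed
      then have "diag (g 1) (rest n x) \<in> K" using g(2) by simp
      then have "rest n x \<in> Y"
        unfolding Y_def hit_def mem_Collect_eq by (intro conjI bexI[of _ "g 1"] rX gG[OF k1])
      then show "x \<in> hit rest XX U (Y \<inter> Y)" using x nU by (auto simp: hit_def)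
    qed
    then have "emeasure M (hit full XX (Pi\<^sub>E {1..r} (\<lambda>_. P)) K) \<le> emeasure M (hit rest XX U (Y \<inter> Y))"
      using DM by (intro emeasure_mono) (simp_all add: D_def)
    also have "\<dots> = emeasure \<sigma> Y" by (rule em[OF fsigma_in_borel_of[OF fY], symmetric])
    finally show ?thesis using hit_full_positive[OF K P(1-3) P(5)] by (rule order.strict_trans2[rotated])
  qed
  then show ?thesis using that[of \<sigma>] sets fin inv by (simp add: Y_def)
qed

end

section \<open>Convenient sequences\<close>

text \<open>By the Hausdorff property a point is determined by the basic open sets that contain it,
  that is, by a set of natural numbers, and there are as many of these as real numbers.\<close>

lemma polish_space_inj_real:
  assumes "polish_space X"
  obtains \<iota> :: "'a \<Rightarrow> real" where "inj_on \<iota> (topspace X)"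
proof -
  obtain \<B> where B: "countable \<B>" "\<And>V. V \<in> \<B> \<Longrightarrow> openin X V"
    "\<And>U x. openin X U \<Longrightarrow> x \<in> U \<Longrightarrow> \<exists>V\<in>\<B>. x \<in> V \<and> V \<subseteq> U"
    using assms unfolding polish_space_def second_countable_def by metis
  obtain b :: "nat set \<Rightarrow> real" where b: "bij b"
    using nat_sets_eqpoll_reals unfolding eqpoll_def by auto
  define c where "c x = {n. x \<in> from_nat_into \<B> n}" for x
  have "inj_on (b \<circ> c) (topspace X)"
  proof (rule inj_onI)
    fix x y assume xy: "x \<in> topspace X" "y \<in> topspace X" "(b \<circ> c) x = (b \<circ> c) y"
    then have c: "c x = c y" using b by (simp add: bij_def inj_eq)
    show "x = y"
    proof (rule ccontr)
      assume "x \<noteq> y"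
      then obtain U V where UV: "openin X U" "x \<in> U" "disjnt U V" "y \<in> V"
        using polish_imp_Hausdorff[OF assms, unfolded Hausdorff_space_def] xy(1,2) by blast
      obtain W where W: "W \<in> \<B>" "x \<in> W" "W \<subseteq> U" using B(3)[OF UV(1,2)] by auto
      then have "from_nat_into \<B> (to_nat_on \<B> W) = W" using B(1) by simp
      then have "to_nat_on \<B> W \<in> c x" "to_nat_on \<B> W \<notin> c y"
        using W UV by (auto simp: c_def disjnt_iff)
      then show False using c by simp
    qed
  qed
  then show ?thesis by (rule that)
qed

text \<open>Closure under a group gives equality of \<open>A\<close> with its translates, as
  \<open>x\<close> is the image under \<open>h\<close> of its translate by
  \<open>inv h\<close>.\<close>

lemma invariant_setI:
  assumes G: "group G" and act: "group_action G S \<alpha>" and A: "A \<subseteq> S"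
    and closed: "\<And>h x. h \<in> carrier G \<Longrightarrow> x \<in> A \<Longrightarrow> \<alpha> h x \<in> A"
  shows "invariant_set G \<alpha> A"
  unfolding invariant_set_def
proof (intro ballI equalityI subsetI)
  interpret group_action G S \<alpha> by (rule act)
  interpret G: group G by (rule G)
  fix h assume h: "h \<in> carrier G"
  show "x \<in> A" if "x \<in> \<alpha> h ` A" for x using that closed[OF h] by auto
  fix x assume x: "x \<in> A"
  have "\<alpha> h (\<alpha> (inv\<^bsub>G\<^esub> h) x) = \<alpha> (h \<otimes>\<^bsub>G\<^esub> inv\<^bsub>G\<^esub> h) x"
    using composition_rule[of x h "inv\<^bsub>G\<^esub> h"] h x A by auto
  also have "\<dots> = x" using h x A id_eq_one G.r_inv[OF h] by (metis restrict_apply' subsetD)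
  finally have "\<alpha> h (\<alpha> (inv\<^bsub>G\<^esub> h) x) = x" .
  moreover have "\<alpha> (inv\<^bsub>G\<^esub> h) x \<in> A" by (rule closed[OF G.inv_closed[OF h] x])
  ultimately show "x \<in> \<alpha> h ` A" by (metis imageI)
qed

text \<open>The defining property of convenient sequences only speaks about standard Borel structures on sets
  of reals; it is transported along an injection into the reals.\<close>

lemma (in lcsc_group) convenient_ergodicityD:
  fixes X :: "'a topology"
  assumes conv: "convenient_ergodicity G T m F" and X: "polish_space X"
    and act: "jointly_continuous_action G T X a" and sets_m: "sets m = sets (borel_of T)"
    and f: "f \<in> borel_measurable (borel_of X)" and bdd: "\<And>x. x \<in> topspace X \<Longrightarrow> \<bar>f x\<bar> \<le> B"
  shows "{x \<in> topspace X. \<exists>l>0. (ergodic_average m F a f x \<longlongrightarrow> l) at_top} \<in> sets (borel_of X)"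
    and "sets \<sigma> = sets (borel_of X) \<Longrightarrow> prob_space \<sigma> \<Longrightarrow> invariant_measure G a \<sigma> \<Longrightarrow> ergodic_measure G a \<sigma> \<Longrightarrow>
      \<exists>E\<in>sets \<sigma>. invariant_set G a E \<and> emeasure \<sigma> (space \<sigma> - E) = 0 \<and>
        (\<forall>x\<in>E. (ergodic_average m F a f x \<longlongrightarrow> (LINT y|\<sigma>. f y)) at_top)"
proof -
  note act_simps = actionD(3-5)[OF act]
  obtain \<iota> :: "'a \<Rightarrow> real" where inj: "inj_on \<iota> (topspace X)" by (rule polish_space_inj_real[OF X])
  define Yr where "Yr = \<iota> ` topspace X"
  define \<kappa> where "\<kappa> = inv_into (topspace X) \<iota>"
  have \<kappa>\<iota>: "\<kappa> (\<iota> x) = x" if "x \<in> topspace X" for x using inj that by (simp add: \<kappa>_def)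
  have \<iota>\<kappa>: "\<iota> (\<kappa> y) = y" "\<kappa> y \<in> topspace X" if "y \<in> Yr" for y
    using that by (auto simp: Yr_def \<kappa>\<iota>)
  \<comment> \<open>The topology of \<open>X\<close> carried over to its copy in the reals. It makes
    \<open>\<iota>\<close> a homeomorphism, so the copy is Polish and the transported action is
    jointly continuous.\<close>
  define T' where "T' = pullback_topology Yr \<kappa> X"
  have top': "topspace T' = Yr" using \<iota>\<kappa> by (auto simp: T'_def topspace_pullback_topology)
  have c\<kappa>: "continuous_map T' X \<kappa>"
    using continuous_map_pullback[OF continuous_map_id, of Yr \<kappa> X] by (simp add: T'_def)
  have c\<iota>: "continuous_map X T' \<iota>"
    unfolding T'_def
  proof (rule continuous_map_pullback')
    show "continuous_map X X (\<kappa> \<circ> \<iota>)" by (rule continuous_map_eq[OF continuous_map_id]) (simp add: \<kappa>\<iota>)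
  qed (auto simp: Yr_def)
  have "X homeomorphic_space T'"
    unfolding homeomorphic_space_def homeomorphic_maps_def using c\<kappa> c\<iota> \<kappa>\<iota> \<iota>\<kappa> top' by blast
  then have pol': "polish_space T'"
    using X unfolding polish_space_def
    by (metis homeomorphic_completely_metrizable_space homeomorphic_space_second_countability)
  define M where "M = borel_of T'"
  have spM: "space M = Yr" by (simp add: M_def top')
  have std: "standard_borel M" unfolding standard_borel_def M_def using pol' by blast
  define a' where "a' g = (\<lambda>y\<in>Yr. \<iota> (a g (\<kappa> y)))" for g
  have a'\<iota>: "a' g (\<iota> x) = \<iota> (a g x)" if "x \<in> topspace X" for g x
    using that by (simp add: a'_def \<kappa>\<iota> Yr_def)
  have act': "jointly_continuous_action G T T' a'"
    unfolding jointly_continuous_action_def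
  proof
    show "group_action G (topspace T') a'"
    proof (rule group_actionI)
      show "group G" by (rule is_group)
      fix g y assume g: "g \<in> carrier G" and y: "y \<in> topspace T'"
      show "a' g y \<in> topspace T'" using act_simps(1)[OF g \<iota>\<kappa>(2)] y top' by (simp add: a'_def Yr_def)
    next
      fix g assume "g \<in> carrier G" show "a' g \<in> extensional (topspace T')" by (simp add: a'_def top')
    next
      fix y assume y: "y \<in> topspace T'"
      show "a' \<one> y = y" using act_simps(2)[OF \<iota>\<kappa>(2)] \<iota>\<kappa>(1) y top' by (simp add: a'_def)
    next
      fix g h y assume gh: "g \<in> carrier G" "h \<in> carrier G" and y: "y \<in> topspace T'"
      have y': "\<kappa> y \<in> topspace X" using \<iota>\<kappa>(2) y top' by simp
      show "a' (g \<otimes> h) y = a' g (a' h y)"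
        using act_simps(3)[OF gh y'] a'\<iota>[OF act_simps(1)[OF gh(2) y'], of g] a'\<iota>[OF y'] \<iota>\<kappa>(1)[of y] y top'
        by simp
    qed
    have "continuous_map (prod_topology T T') (prod_topology T X) (\<lambda>p. (fst p, \<kappa> (snd p)))"
      by (intro continuous_map_pairedI continuous_map_fst continuous_map_compose[OF continuous_map_snd c\<kappa>, unfolded comp_def])
    from continuous_map_compose[OF continuous_map_compose[OF this actionD(2)[OF act]] c\<iota>]
    have "continuous_map (prod_topology T T') T' (\<lambda>p. \<iota> (a (fst p) (\<kappa> (snd p))))" by (simp add: comp_def)
    then show "continuous_map (prod_topology T T') T' (\<lambda>(g, x). a' g x)"
      by (rule continuous_map_eq) (auto simp: a'_def top')
  qed
  have sc': "second_countable T'" using pol' by (simp add: polish_space_def)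
  have bact: "borel_action G T M a'"
    unfolding borel_action_def
  proof
    show "group_action G (space M) a'" using actionD(1)[OF act'] by (simp add: spM top')
    show "(\<lambda>(h, s). a' h s) \<in> borel_of T \<Otimes>\<^sub>M M \<rightarrow>\<^sub>M M"
      using continuous_map_measurable[OF actionD(2)[OF act']] sets_borel_of_prod[OF second_countable sc']
      unfolding M_def by (simp cong: measurable_cong_sets)
  qed
  have m\<kappa>: "\<kappa> \<in> M \<rightarrow>\<^sub>M borel_of X" unfolding M_def by (rule continuous_map_measurable[OF c\<kappa>])
  have m\<iota>: "\<iota> \<in> borel_of X \<rightarrow>\<^sub>M M" unfolding M_def by (rule continuous_map_measurable[OF c\<iota>])
  define f' where "f' y = f (\<kappa> y)" for y
  have f': "f' \<in> borel_measurable M" unfolding f'_def by (rule measurable_compose[OF m\<kappa> f])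
  have bdd': "\<exists>B. \<forall>y\<in>space M. \<bar>f' y\<bar> \<le> B"
    using bdd \<iota>\<kappa>(2) by (intro exI[of _ B]) (simp add: f'_def spM)
  have spm: "space m = carrier G" using sets_eq_imp_space_eq[OF sets_m] topspace_eq by simp
  have ea: "ergodic_average m F a' f' (\<iota> x) = ergodic_average m F a f x" if x: "x \<in> topspace X" for x
  proof
    fix t
    have "(LINT g:F t|m. f' (a' g (\<iota> x))) = (LINT g:F t|m. f (a g x))"
      unfolding set_lebesgue_integral_def
      by (rule Bochner_Integration.integral_cong) (use x act_simps(1)[OF _ x] in \<open>auto simp: spm a'\<iota> f'_def \<kappa>\<iota>\<close>)
    then show "ergodic_average m F a' f' (\<iota> x) t = ergodic_average m F a f x t"
      by (simp add: ergodic_average_def)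
  qed
  let ?C = "convergence_set M m F a' f'"
  note main = conv[unfolded convenient_ergodicity_def, THEN spec[of _ M], THEN spec[of _ a'], THEN spec[of _ f'],
      THEN mp, OF std, THEN mp, OF bact, THEN mp, OF f', THEN mp, OF bdd']
  note C = main[THEN conjunct1] and la = main[THEN conjunct2, THEN conjunct1]
  note generic = main[THEN conjunct2, THEN conjunct2, THEN conjunct2, THEN spec]
  \<comment> \<open>The value \<open>limit_average\<close> is given by a description and has the
    meaning of a limit on the convergence set, so the two conditions are kept together.\<close>
  have lim_iff: "(ergodic_average m F a f x \<longlongrightarrow> l) at_top \<longleftrightarrow> \<iota> x \<in> ?C \<and> limit_average m F a' f' (\<iota> x) = l"
    if x: "x \<in> topspace X" for x l
  proof
    assume l: "(ergodic_average m F a f x \<longlongrightarrow> l) at_top"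
    then have "\<iota> x \<in> ?C" using x by (auto simp: convergence_set_def ea[OF x] spM Yr_def)
    moreover have "limit_average m F a' f' (\<iota> x) = l"
      unfolding limit_average_def ea[OF x] by (rule tendsto_Lim[OF trivial_limit_at_top_linorder l])
    ultimately show "\<iota> x \<in> ?C \<and> limit_average m F a' f' (\<iota> x) = l" by simp
  next
    assume "\<iota> x \<in> ?C \<and> limit_average m F a' f' (\<iota> x) = l"
    then obtain l' where l': "(ergodic_average m F a f x \<longlongrightarrow> l') at_top" "limit_average m F a' f' (\<iota> x) = l"
      by (auto simp: convergence_set_def ea[OF x])
    have "Lim at_top (ergodic_average m F a f x) = l'" by (rule tendsto_Lim[OF trivial_limit_at_top_linorder l'(1)])
    then show "(ergodic_average m F a f x \<longlongrightarrow> l) at_top" using l' by (simp add: limit_average_def ea[OF x])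
  qed
  let ?P = "{y \<in> space (restrict_space M ?C). 0 < limit_average m F a' f' y}"
  have "?P \<in> sets (restrict_space M ?C)"
    by (rule borel_measurable_less[OF borel_measurable_const la])
  then have P: "?P \<in> sets M"
    using C by (subst (asm) sets_restrict_space_iff) (use sets.sets_into_space[OF C] in auto)
  have spC: "space (restrict_space M ?C) = ?C"
    using sets.sets_into_space[OF C] by (auto simp: space_restrict_space)
  have "{x \<in> topspace X. \<exists>l>0. (ergodic_average m F a f x \<longlongrightarrow> l) at_top} = \<iota> -` ?P \<inter> space (borel_of X)"
    using lim_iff by (auto simp: spC)
  also have "\<dots> \<in> sets (borel_of X)" by (rule measurable_sets[OF m\<iota> P])
  finally show "{x \<in> topspace X. \<exists>l>0. (ergodic_average m F a f x \<longlongrightarrow> l) at_top} \<in> sets (borel_of X)" .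
  assume \<sigma>: "sets \<sigma> = sets (borel_of X)" "prob_space \<sigma>" "invariant_measure G a \<sigma>" "ergodic_measure G a \<sigma>"
  have sp\<sigma>: "space \<sigma> = topspace X" using sets_eq_imp_space_eq[OF \<sigma>(1)] by simp
  have m\<iota>\<sigma>: "\<iota> \<in> \<sigma> \<rightarrow>\<^sub>M M" using m\<iota> \<sigma>(1) by (simp cong: measurable_cong_sets)
  define \<sigma>' where "\<sigma>' = distr \<sigma> M \<iota>"
  have sets': "sets \<sigma>' = sets M" by (simp add: \<sigma>'_def)
  have prob': "prob_space \<sigma>'" unfolding \<sigma>'_def by (rule prob_space.prob_space_distr[OF \<sigma>(2) m\<iota>\<sigma>])
  have em': "emeasure \<sigma>' A = emeasure \<sigma> (\<iota> -` A \<inter> topspace X)" if "A \<in> sets M" for A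
    unfolding \<sigma>'_def using emeasure_distr[OF m\<iota>\<sigma> that] by (simp add: sp\<sigma>)
  have a'm: "a' g \<in> M \<rightarrow>\<^sub>M M" if "g \<in> carrier G" for g
    unfolding M_def by (rule continuous_map_measurable[OF action_continuous_element[OF act']]) (simp add: that topspace_eq)
  have inv': "invariant_measure G a' \<sigma>'"
    unfolding invariant_measure_def
  proof (intro ballI conjI)
    fix g assume g: "g \<in> carrier G"
    have ag: "a g \<in> \<sigma> \<rightarrow>\<^sub>M \<sigma>" "distr \<sigma> \<sigma> (a g) = \<sigma>" using \<sigma>(3) g by (auto simp: invariant_measure_def)
    show "a' g \<in> \<sigma>' \<rightarrow>\<^sub>M \<sigma>'" using a'm[OF g] sets' by (simp cong: measurable_cong_sets)
    have "distr \<sigma>' \<sigma>' (a' g) = distr \<sigma>' M (a' g)" by (rule distr_cong) (simp_all add: sets')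
    also have "\<dots> = distr \<sigma> M (a' g \<circ> \<iota>)" unfolding \<sigma>'_def by (rule distr_distr[OF a'm[OF g] m\<iota>\<sigma>])
    also have "\<dots> = distr \<sigma> M (\<iota> \<circ> a g)" by (rule distr_cong) (auto simp: sp\<sigma> a'\<iota>)
    also have "\<dots> = distr (distr \<sigma> \<sigma> (a g)) M \<iota>" by (rule distr_distr[OF m\<iota>\<sigma> ag(1), symmetric])
    also have "\<dots> = \<sigma>'" by (simp add: ag(2) \<sigma>'_def)
    finally show "distr \<sigma>' \<sigma>' (a' g) = \<sigma>'" .
  qed
  have pull: "invariant_set G a (\<iota> -` A \<inter> topspace X)" if A: "invariant_set G a' A" for A
  proof (rule invariant_setI[OF is_group actionD(1)[OF act]])
    fix h x assume h: "h \<in> carrier G" and x: "x \<in> \<iota> -` A \<inter> topspace X"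
    then have "a' h (\<iota> x) \<in> A" using A by (auto simp: invariant_set_def)
    then show "a h x \<in> \<iota> -` A \<inter> topspace X" using x a'\<iota>[of x h] act_simps(1)[OF h] by auto
  qed auto
  have pull_sets: "\<iota> -` A \<inter> topspace X \<in> sets \<sigma>" if "A \<in> sets M" for A
    using measurable_sets[OF m\<iota> that] \<sigma>(1) by simp
  have pull_compl: "\<iota> -` (space M - A) \<inter> topspace X = space \<sigma> - (\<iota> -` A \<inter> topspace X)" for A
    by (auto simp: spM sp\<sigma> Yr_def)
  have spM': "space \<sigma>' = space M" by (simp add: \<sigma>'_def)
  have erg': "ergodic_measure G a' \<sigma>'"
    unfolding ergodic_measure_def
  proof (intro ballI impI)
    fix A assume A: "A \<in> sets \<sigma>'" "invariant_set G a' A"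
    have AM: "A \<in> sets M" using A(1) sets' by simp
    have "emeasure \<sigma> (\<iota> -` A \<inter> topspace X) = 0 \<or> emeasure \<sigma> (space \<sigma> - (\<iota> -` A \<inter> topspace X)) = 0"
      using \<sigma>(4) pull_sets[OF AM] pull[OF A(2)] unfolding ergodic_measure_def by blast
    then show "emeasure \<sigma>' A = 0 \<or> emeasure \<sigma>' (space \<sigma>' - A) = 0"
      using em'[OF AM] em'[OF sets.compl_sets[OF AM]] by (simp add: spM' pull_compl)
  qed
  obtain E where E: "E \<in> sets M" "E \<subseteq> ?C" "invariant_set G a' E" "emeasure \<sigma>' (space M - E) = 0"
    "\<And>y. y \<in> E \<Longrightarrow> limit_average m F a' f' y = (LINT y|\<sigma>'. f' y)"
  proof -
    have "\<exists>E\<in>sets M. E \<subseteq> ?C \<and> invariant_set G a' E \<and> emeasure \<sigma>' (space M - E) = 0 \<and>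
        (\<forall>x\<in>E. limit_average m F a' f' x = (LINT y|\<sigma>'. f' y))"
      by (rule generic[THEN mp, OF sets', THEN mp, OF prob', THEN mp, OF inv', THEN mp, OF erg'])
    then obtain E where "E \<in> sets M" "E \<subseteq> ?C \<and> invariant_set G a' E \<and> emeasure \<sigma>' (space M - E) = 0 \<and>
        (\<forall>x\<in>E. limit_average m F a' f' x = (LINT y|\<sigma>'. f' y))" by (rule bexE)
    then show ?thesis by (intro that[of E]) simp_all
  qed
  have int: "(LINT y|\<sigma>'. f' y) = (LINT x|\<sigma>. f x)"
  proof -
    have "(LINT y|\<sigma>'. f' y) = (LINT x|\<sigma>. f' (\<iota> x))" unfolding \<sigma>'_def by (rule integral_distr[OF m\<iota>\<sigma> f'])
    also have "\<dots> = (LINT x|\<sigma>. f x)"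
      by (rule Bochner_Integration.integral_cong) (auto simp: f'_def sp\<sigma> \<kappa>\<iota>)
    finally show ?thesis .
  qed
  show "\<exists>E\<in>sets \<sigma>. invariant_set G a E \<and> emeasure \<sigma> (space \<sigma> - E) = 0 \<and>
        (\<forall>x\<in>E. (ergodic_average m F a f x \<longlongrightarrow> (LINT y|\<sigma>. f y)) at_top)"
  proof (intro bexI[of _ "\<iota> -` E \<inter> topspace X"] conjI ballI)
    show "emeasure \<sigma> (space \<sigma> - (\<iota> -` E \<inter> topspace X)) = 0"
      using em'[OF sets.compl_sets[OF E(1)]] E(4) by (simp add: pull_compl)
    fix x assume "x \<in> \<iota> -` E \<inter> topspace X"
    then show "(ergodic_average m F a f x \<longlongrightarrow> (LINT y|\<sigma>. f y)) at_top"
      using lim_iff[of x] E(2,5) int by auto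
  qed (use pull[OF E(3)] pull_sets[OF E(1)] in auto)
qed

section \<open>Lower bounds for the density and the almost sure statement\<close>

context commensurable_system
begin

text \<open>The set \<open>D\<close> is the union of the translates of \<open>Q\<close> by elements
  of \<open>L\<close>. If \<open>g \<in> F t\<close> moves \<open>y\<close> into \<open>D\<close>,
  then \<open>g = h \<otimes> a\<close> with \<open>h \<in> L\<close> and \<open>a\<close> a common
  return time in \<open>F (t + \<delta>)\<close>. The translates of \<open>L\<close> by such
  \<open>a\<close> cover the set of these \<open>g\<close>, so its Haar measure bounds the number of
  return times from below.\<close>

lemma lower_density_positive:
  assumes F: "\<And>t. t > 0 \<Longrightarrow> F t \<in> sets m \<and> compactin T (T closure_of F t) \<and> 0 < emeasure m (F t)"
    and \<delta>: "\<delta> > 0" and \<epsilon>: "\<epsilon> < 1" and outer: "\<And>t. t > \<tau> \<Longrightarrow> outer_part G V (F t) \<subseteq> F (t + \<delta>)"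
    and ratio: "ereal (1 - \<epsilon>) \<le> Liminf at_top (\<lambda>t. ereal (measure m (F (t - \<delta>)) / measure m (F t)))"
    and L: "compactin T L" "L \<subseteq> V" "emeasure m L > 0"
    and Q: "compactin XX Q" "Q \<subseteq> Pi\<^sub>E {1..r} Z"
    and D: "D = hit diag XX ((\<lambda>h. inv h) ` L) Q"
    and y: "y \<in> topspace XX"
    and lim: "(ergodic_average m F diag (indicator D) y \<longlongrightarrow> l) at_top" and l: "l > 0"
  shows "0 < lower_density m F (\<Inter>k\<in>{1..r}. hitting_set G (\<alpha> k) (Z k) (y k))"
proof -
  let ?A = "\<Inter>k\<in>{1..r}. hitting_set G (\<alpha> k) (Z k) (y k)"
  let ?N = "\<lambda>t. emeasure (count_space UNIV) (?A \<inter> F t)"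
  have LG: "L \<subseteq> carrier G" using compactin_subset_topspace[OF L(1)] topspace_eq by simp
  have FG: "F t \<subseteq> carrier G" if "t > 0" for t
    using sets.sets_into_space[of "F t" m] F[OF that] space_m by simp
  have Ffin: "emeasure m (F t) = ennreal (measure m (F t))" "measure m (F t) > 0" if t: "t > 0" for t
  proof -
    have "F t \<subseteq> T closure_of F t" using closure_of_subset[of "F t" T] FG[OF t] topspace_eq by simp
    then have "emeasure m (F t) \<le> emeasure m (T closure_of F t)"
      using F[OF t] compactin_sets_m by (intro emeasure_mono) auto
    also have "\<dots> < \<infinity>" using F[OF t] haar_compact_finite by simp
    finally have fin: "emeasure m (F t) < \<infinity>" .
    then show *: "emeasure m (F t) = ennreal (measure m (F t))" by (intro emeasure_eq_ennreal_measure) auto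
    show "measure m (F t) > 0" using F[OF t] unfolding * by simp
  qed
  have mL: "emeasure m L = ennreal (measure m L)"
    using haar_compact_finite[OF L(1)] by (intro emeasure_eq_ennreal_measure) auto
  then have mL0: "measure m L > 0" using L(3) by simp
  have clD: "closedin XX D"
    unfolding D by (rule closedin_hit[OF diag_act image_compactin[OF L(1) continuous_inv]
      compactin_imp_closedin[OF Hausdorff_XX Q(1)]])
  let ?S = "\<lambda>t. {g \<in> F t. diag g y \<in> D}"
  have S: "?S t \<in> sets m" if t: "t > 0" for t
  proof -
    have "continuous_map T (prod_topology T XX) (\<lambda>g. (g, y))" using y by (simp add: continuous_map_pairedI)
    from continuous_map_compose[OF this actionD(2)[OF diag_act]]
    have "continuous_map T XX (\<lambda>g. diag g y)" by (simp add: comp_def)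
    from closedin_continuous_map_preimage[OF this clD]
    have "{g \<in> topspace T. diag g y \<in> D} \<in> sets m" using closedin_borel_of sets_m by simp
    then have "F t \<inter> {g \<in> topspace T. diag g y \<in> D} \<in> sets m" using F[OF t] by auto
    also have "F t \<inter> {g \<in> topspace T. diag g y \<in> D} = ?S t" using FG[OF t] topspace_eq by auto
    finally show ?thesis .
  qed
  have average: "ergodic_average m F diag (indicator D) y t = measure m (?S t) / measure m (F t)" if t: "t > 0" for t
  proof -
    have "(LINT g:F t|m. indicator D (diag g y)) = (LINT g|m. indicator (?S t) g :: real)"
      unfolding set_lebesgue_integral_def
      by (rule Bochner_Integration.integral_cong) (auto simp: indicator_def)
    also have "\<dots> = measure m (?S t)" using sets.sets_into_space[OF S[OF t]] by (simp add: Int_absorb2)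
    finally show ?thesis by (simp add: ergodic_average_def)
  qed
  \<comment> \<open>If there are infinitely many return times the right-hand side is
    \<open>\<top>\<close>, since \<open>L\<close> has positive measure; otherwise finitely many
    right translates of \<open>L\<close> cover the set.\<close>
  have count: "emeasure m (?S t) \<le> ?N (t + \<delta>) * emeasure m L" if t: "t > 0" "t > \<tau>" for t
  proof (cases "finite (?A \<inter> F (t + \<delta>))")
    case False
    then have "?N (t + \<delta>) = \<top>" by (subst emeasure_count_space) auto
    then show ?thesis using L(3) by (simp add: ennreal_top_mult)
  next
    case True
    let ?R = "\<lambda>a. {x \<in> carrier G. x \<otimes> inv a \<in> L}"
    have AG: "a \<in> carrier G" if "a \<in> ?A \<inter> F (t + \<delta>)" for a using that r by (auto simp: hitting_set_def)
    have RS: "?R a \<in> sets m" if a: "a \<in> ?A \<inter> F (t + \<delta>)" for a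
      using closedin_continuous_map_preimage[OF continuous_map_right_mult[OF inv_closed[OF AG[OF a]]]
          compactin_imp_closedin[OF Hausdorff L(1)]] closedin_borel_of sets_m topspace_eq by simp
    have "?S t \<subseteq> (\<Union>a\<in>?A \<inter> F (t + \<delta>). ?R a)"
    proof
      fix g assume g: "g \<in> ?S t"
      have gG: "g \<in> carrier G" using g FG[OF t(1)] by auto
      obtain h where h: "h \<in> L" "diag (inv h) (diag g y) \<in> Q" using g unfolding D hit_def by auto
      have hG: "h \<in> carrier G" using h LG by auto
      let ?a = "inv h \<otimes> g"
      have aG: "?a \<in> carrier G" using gG hG by simp
      have "diag ?a y \<in> Q" using actionD(5)[OF diag_act, of "inv h" g y] h(2) hG gG y by simp
      then have "diag ?a y k \<in> Z k" if "k \<in> {1..r}" for k using Q(2) that PiE_mem by blast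
      then have "?a \<in> ?A" using diag_apply[OF y] aG by (auto simp: hitting_set_def)
      moreover have "?a \<in> outer_part G V (F t)"
        using g h L(2) by (auto simp: outer_part_def l_coset_def)
      then have "?a \<in> F (t + \<delta>)" using outer[OF t(2)] by auto
      moreover have "g \<otimes> inv ?a = h"
      proof -
        have "g \<otimes> inv ?a = g \<otimes> (inv g \<otimes> h)" using gG hG by (simp add: inv_mult_group)
        also have "\<dots> = h" using gG hG by (simp add: m_assoc[symmetric])
        finally show ?thesis .
      qed
      ultimately show "g \<in> (\<Union>a\<in>?A \<inter> F (t + \<delta>). ?R a)" using gG h(1) by (intro UN_I[of ?a]) auto
    qed
    then have "emeasure m (?S t) \<le> emeasure m (\<Union>a\<in>?A \<inter> F (t + \<delta>). ?R a)"
      using RS True by (intro emeasure_mono sets.finite_UN) auto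
    also have "\<dots> \<le> (\<Sum>a\<in>?A \<inter> F (t + \<delta>). emeasure m (?R a))"
      using RS True by (intro emeasure_subadditive_finite) auto
    also have "\<dots> = (\<Sum>a\<in>?A \<inter> F (t + \<delta>). emeasure m L)"
      by (intro sum.cong refl right_invariant inv_closed AG compactin_sets_m L(1))
    also have "\<dots> = ?N (t + \<delta>) * emeasure m L" using True by (subst emeasure_count_space) auto
    finally show ?thesis .
  qed
  \<comment> \<open>Half the limit times half the guaranteed ratio \<open>1 - \<epsilon>\<close>:
    the halves leave room for strict lower bounds that hold eventually. Division by
    \<open>measure m L\<close> turns the product into the bound for the density.\<close>
  define c where "c = l / 2 * ((1 - \<epsilon>) / 2)"
  have c: "c > 0" using l \<epsilon> by (simp add: c_def)
  have "\<forall>\<^sub>F t in at_top. l / 2 < ergodic_average m F diag (indicator D) y t"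
    using order_tendstoD(1)[OF lim, of "l / 2"] l by simp
  then obtain t1 where t1: "\<And>t. t \<ge> t1 \<Longrightarrow> l / 2 < ergodic_average m F diag (indicator D) y t"
    by (auto simp: eventually_at_top_linorder)
  have "ereal ((1 - \<epsilon>) / 2) < Liminf at_top (\<lambda>t. ereal (measure m (F (t - \<delta>)) / measure m (F t)))"
    by (rule less_le_trans[OF _ ratio]) (use \<epsilon> in simp)
  from less_LiminfD[OF this]
  obtain t2 where t2: "\<And>t. t \<ge> t2 \<Longrightarrow> (1 - \<epsilon>) / 2 < measure m (F (t - \<delta>)) / measure m (F t)"
    by (auto simp: eventually_at_top_linorder)
  \<comment> \<open>With \<open>s = t + \<delta>\<close>, the average is taken over
    \<open>F (s - \<delta>)\<close> and the count over \<open>F s\<close>, and \<open>ratio\<close>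
    compares the two volumes. The threshold keeps \<open>s - \<delta>\<close> positive, beyond
    \<open>\<tau>\<close> and past \<open>t1\<close>.\<close>
  have bound: "ennreal (c / measure m L) \<le> ?N s / emeasure m (F s)"
    if s: "s > \<delta> + \<bar>\<tau>\<bar> + \<bar>t1\<bar> + \<bar>t2\<bar>" for s
  proof -
    have pos: "s > 0" "s - \<delta> > 0" "s - \<delta> > \<tau>" "s - \<delta> \<ge> t1" "s \<ge> t2" using s \<delta> by auto
    have "l / 2 * measure m (F (s - \<delta>)) < measure m (?S (s - \<delta>))"
      using t1[OF pos(4)] Ffin(2)[OF pos(2)] unfolding average[OF pos(2)] by (simp add: pos_less_divide_eq)
    moreover have "(1 - \<epsilon>) / 2 * measure m (F s) < measure m (F (s - \<delta>))"
      using t2[OF pos(5)] Ffin(2)[OF pos(1)] by (simp add: pos_less_divide_eq)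
    then have "l / 2 * ((1 - \<epsilon>) / 2 * measure m (F s)) < l / 2 * measure m (F (s - \<delta>))"
      using l by (intro mult_strict_left_mono) auto
    ultimately have "c * measure m (F s) \<le> measure m (?S (s - \<delta>))"
      unfolding c_def mult.assoc by linarith
    then have "ennreal (c * measure m (F s)) \<le> emeasure m (?S (s - \<delta>))"
    proof -
      assume *: "c * measure m (F s) \<le> measure m (?S (s - \<delta>))"
      have "emeasure m (?S (s - \<delta>)) \<le> emeasure m (F (s - \<delta>))" using F[OF pos(2)] by (intro emeasure_mono) auto
      then have "emeasure m (?S (s - \<delta>)) \<noteq> \<top>" using Ffin(1)[OF pos(2)] by (auto simp: top_unique)
      then show ?thesis using * by (simp add: emeasure_eq_ennreal_measure ennreal_leI)
    qed
    also have "\<dots> \<le> ?N s * ennreal (measure m L)" using count[OF pos(2,3)] mL by simp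
    finally have key: "ennreal (c * measure m (F s)) \<le> ?N s * ennreal (measure m L)" .
    show ?thesis
    proof (cases "?N s" rule: ennreal_cases)
      case (real n)
      have "c * measure m (F s) \<le> n * measure m L"
        using key real(1) mL0 unfolding real(2) by (simp add: ennreal_mult[symmetric])
      then have "c / measure m L \<le> n / measure m (F s)"
        using mL0 Ffin(2)[OF pos(1)] by (simp add: field_simps)
      then show ?thesis
        unfolding real(2) Ffin(1)[OF pos(1)] using real(1) Ffin(2)[OF pos(1)]
        by (subst divide_ennreal) (auto intro: ennreal_leI)
    next
      case top
      show ?thesis unfolding top Ffin(1)[OF pos(1)] by (simp add: ennreal_top_divide)
    qed
  qed
  have "\<forall>\<^sub>F s in at_top. ennreal (c / measure m L) \<le> ?N s / emeasure m (F s)"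
    using bound by (auto intro: eventually_at_top_linorderI[of "\<delta> + \<bar>\<tau>\<bar> + \<bar>t1\<bar> + \<bar>t2\<bar> + 1"])
  then have "ennreal (c / measure m L) \<le> lower_density m F ?A"
    unfolding lower_density_def by (rule Liminf_bounded)
  moreover have "0 < ennreal (c / measure m L)" using c mL0 by simp
  ultimately show ?thesis by (rule less_le_trans[rotated])
qed

lemma exists_positive_average:
  assumes conv: "convenient_ergodicity G T m F"
    and K: "compactin XX K" "K \<subseteq> Pi\<^sub>E {1..r} Z" "emeasure (PiM {1..r} \<nu>) K > 0" "K \<subseteq> Q"
    and L: "openin T U" "\<one> \<in> U" "U \<subseteq> L"
    and D: "D = hit diag XX ((\<lambda>h. inv h) ` L) Q" "closedin XX D"
  shows "\<exists>x\<in>K. \<exists>l>0. (ergodic_average m F diag (indicator D) x \<longlongrightarrow> l) at_top"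
proof -
  let ?C = "orbit_of K"
  obtain \<sigma> where \<sigma>: "sets \<sigma> = sets (borel_of XX)" "finite_measure \<sigma>" "invariant_measure G diag \<sigma>"
    "emeasure \<sigma> ?C > 0"
    by (rule induced_measure[OF K(1-3)]) (rule that)
  have C: "?C \<in> sets (borel_of XX)" by (rule fsigma_in_borel_of[OF fsigma_orbit_of[OF K(1)]])
  obtain \<rho> where \<rho>: "sets \<rho> = sets (borel_of XX)" "prob_space \<rho>" "invariant_measure G diag \<rho>"
    "ergodic_measure G diag \<rho>" "emeasure \<rho> ?C > 0"
    by (rule ergodic_measure_exists[OF polish_XX diag_act \<sigma>(1-3) C[folded \<sigma>(1)] \<sigma>(4)]) (rule that)
  interpret \<rho>: prob_space \<rho> by (rule \<rho>(2))
  have sp\<rho>: "space \<rho> = topspace XX" using sets_eq_imp_space_eq[OF \<rho>(1)] by simp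
  have DS: "D \<in> sets \<rho>" using closedin_borel_of[OF D(2)] \<rho>(1) by simp
  have f: "(indicator D :: _ \<Rightarrow> real) \<in> borel_measurable (borel_of XX)"
    using DS \<rho>(1) by (intro borel_measurable_indicator) simp
  have bdd: "\<bar>indicator D x :: real\<bar> \<le> 1" for x by (simp add: indicator_def)
  obtain E where E: "E \<in> sets \<rho>" "invariant_set G diag E" "emeasure \<rho> (space \<rho> - E) = 0"
    "\<And>x. x \<in> E \<Longrightarrow> (ergodic_average m F diag (indicator D) x \<longlongrightarrow> (LINT y|\<rho>. indicator D y)) at_top"
    using convenient_ergodicityD(2)[OF conv polish_XX diag_act sets_m f bdd \<rho>(1-4)] by blast
  \<comment> \<open>The conull set \<open>E\<close> must meet the orbit, which has positive measure;
    as \<open>E\<close> is invariant, it then meets \<open>K\<close> itself.\<close>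
  have "\<not> ?C \<subseteq> space \<rho> - E"
  proof
    assume "?C \<subseteq> space \<rho> - E"
    then have "emeasure \<rho> ?C \<le> emeasure \<rho> (space \<rho> - E)" using E(1) by (intro emeasure_mono) auto
    then show False using \<rho>(5) E(3) by simp
  qed
  then obtain x where x: "x \<in> E" "x \<in> ?C" using sp\<rho> by (auto simp: hit_def)
  then obtain g where g: "g \<in> carrier G" "diag g x \<in> K" by (auto simp: hit_def)
  have "diag g x \<in> E" using E(2) g(1) x(1) unfolding invariant_set_def by blast
  then have lim: "(ergodic_average m F diag (indicator D) (diag g x) \<longlongrightarrow> measure \<rho> D) at_top"
    using E(4) sets.sets_into_space[OF DS] by (simp add: Int_absorb2)
  have "emeasure \<rho> D \<noteq> 0"
  proof
    assume D0: "emeasure \<rho> D = 0"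
    obtain \<gamma> :: "nat \<Rightarrow> 'g" where \<gamma>: "range \<gamma> \<subseteq> carrier G" "\<one> \<in> range \<gamma>"
      "\<And>i j. \<gamma> i \<otimes> \<gamma> j \<in> range \<gamma>" "\<And>U. openin T U \<Longrightarrow> U \<noteq> {} \<Longrightarrow> range \<gamma> \<inter> U \<noteq> {}"
      by (rule countable_dense_monoid) (rule that)
    have \<gamma>G: "\<gamma> j \<in> carrier G" for j using \<gamma>(1) by auto
    let ?P = "\<lambda>j. {x \<in> topspace XX. diag (\<gamma> j) x \<in> D}"
    have P: "?P j \<in> null_sets \<rho>" for j
    proof
      show "emeasure \<rho> (?P j) = 0" using emeasure_action_preimage[OF \<rho>(3,1) \<gamma>G DS] D0 by simp
      have "continuous_map XX XX (diag (\<gamma> j))"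
        by (rule action_continuous_element[OF diag_act]) (simp add: \<gamma>G topspace_eq)
      from closedin_continuous_map_preimage[OF this D(2)] show "?P j \<in> sets \<rho>"
        using closedin_borel_of \<rho>(1) by simp
    qed
    \<comment> \<open>If \<open>g\<close> moves \<open>x\<close> into \<open>K\<close>, then by
      density some \<open>\<gamma> j\<close> lies in the right translate of \<open>U\<close> by
      \<open>g\<close>. It moves \<open>x\<close> into a translate of \<open>K\<close> by an element
      of \<open>L\<close>, hence into \<open>D\<close>. So a null set \<open>D\<close> would make
      the whole orbit null.\<close>
    have "?C \<subseteq> (\<Union>j. ?P j)"
    proof
      fix x assume x: "x \<in> ?C"
      then obtain g where g: "g \<in> carrier G" "diag g x \<in> K" by (auto simp: hit_def)
      have xX: "x \<in> topspace XX" using x by (simp add: hit_def)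
      let ?O = "{y \<in> topspace T. y \<otimes> inv g \<in> U}"
      have "openin T ?O"
        by (rule openin_continuous_map_preimage[OF continuous_map_right_mult[OF inv_closed[OF g(1)]] L(1)])
      moreover have "g \<in> ?O" using g L(2) topspace_eq by simp
      ultimately have "range \<gamma> \<inter> ?O \<noteq> {}" using \<gamma>(4) by blast
      then obtain j where j: "\<gamma> j \<otimes> inv g \<in> U" by auto
      let ?h = "\<gamma> j \<otimes> inv g"
      have hG: "?h \<in> carrier G" using g \<gamma>G by simp
      have "inv ?h \<otimes> \<gamma> j = g" using g \<gamma>G by (simp add: inv_mult_group m_assoc)
      then have "diag (inv ?h) (diag (\<gamma> j) x) = diag g x"
        using actionD(5)[OF diag_act inv_closed[OF hG] \<gamma>G xX, of j] by simp
      then have "diag (inv ?h) (diag (\<gamma> j) x) \<in> Q" using g(2) K(4) by auto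
      moreover have "inv ?h \<in> (\<lambda>h. inv h) ` L" using j L(3) by auto
      moreover have "diag (\<gamma> j) x \<in> topspace XX" by (rule diag_closed[OF \<gamma>G xX])
      ultimately have "diag (\<gamma> j) x \<in> D" unfolding D(1) hit_def by blast
      then show "x \<in> (\<Union>j. ?P j)" using xX by auto
    qed
    then have "?C \<in> null_sets \<rho>"
      by (rule null_sets_subset[OF null_sets_UN[of ?P, OF P], rotated]) (use C \<rho>(1) in simp)
    then show False using \<rho>(5) by auto
  qed
  then have "measure \<rho> D > 0" by (simp add: \<rho>.emeasure_eq_measure zero_less_measure_iff)
  then show ?thesis using lim g(2) by blast
qed

lemma finite_PiM_\<nu>: "finite_measure (PiM {1..r} \<nu>)"
proof
  have "emeasure (PiM {1..r} \<nu>) (Pi\<^sub>E {1..r} (\<lambda>k. space (\<nu> k))) = (\<Prod>k\<in>{1..r}. emeasure (\<nu> k) (space (\<nu> k)))"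
    by (rule emeasure_PiM_on) (use finite_\<nu> in \<open>auto simp: finite_measure_def\<close>)
  also have "\<dots> = (\<Prod>k\<in>{1..r}. ennreal (measure (\<nu> k) (space (\<nu> k))))"
    by (intro prod.cong refl finite_measure.emeasure_eq_measure finite_\<nu>)
  also have "\<dots> = ennreal (\<Prod>k\<in>{1..r}. measure (\<nu> k) (space (\<nu> k)))" by (rule prod_ennreal) simp
  finally show "emeasure (PiM {1..r} \<nu>) (space (PiM {1..r} \<nu>)) \<noteq> \<infinity>" by (simp add: space_PiM)
qed

text \<open>The \<open>Z k\<close> are merely Borel, so their product is exhausted up to a null set
  by compact sets \<open>Q i\<close>, each with its own \<open>D i\<close>; the exceptional points
  are shown to be null inside each \<open>Q i\<close> separately.\<close>

theorem AE_lower_density_positive: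
  assumes conv: "convenient_sequence G T m F"
  shows "AE z in PiM {1..r} \<nu>. 0 < lower_density m F (\<Inter>k\<in>{1..r}. hitting_set G (\<alpha> k) (Z k) (z k))"
proof -
  have F: "F t \<in> sets m \<and> compactin T (T closure_of F t) \<and> 0 < emeasure m (F t)" if "t > 0" for t
    using conv that sets_m unfolding convenient_sequence_def by auto
  have erg: "convenient_ergodicity G T m F" using conv by (simp add: convenient_sequence_def)
  obtain V where V: "\<And>n. openin T (V n)" "\<And>n. \<one> \<in> V n" "convenient_growth G T m V F"
    using conv unfolding convenient_sequence_def by blast
  obtain \<delta> \<epsilon> \<tau> :: "nat \<Rightarrow> real" where g: "\<And>n. 0 < \<delta> n" "\<epsilon> \<longlonglongrightarrow> 0"
    "\<And>n t. t > \<tau> n \<Longrightarrow> outer_part G (V n) (F t) \<subseteq> F (t + \<delta> n)"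
    "\<And>n. ereal (1 - \<epsilon> n) \<le> Liminf at_top (\<lambda>t. ereal (measure m (F (t - \<delta> n)) / measure m (F t)))"
    using V(3) unfolding convenient_growth_def by blast
  \<comment> \<open>With such an index a positive fraction of the volume survives when the parameter
    drops by \<open>\<delta> n\<close>; its neighbourhood \<open>V n\<close> then bounds the size of
    \<open>L\<close>.\<close>
  obtain n where n: "\<epsilon> n < 1"
    using eventually_happens[OF order_tendstoD(2)[OF g(2) zero_less_one]] by auto
  obtain U L where L: "openin T U" "compactin T L" "\<one> \<in> U" "U \<subseteq> L" "L \<subseteq> V n"
    by (rule compact_nhd[OF V(1,2)]) (rule that)
  have "0 < emeasure m U" by (rule haar_open_pos[OF haar L(1)]) (use L(3) in auto)
  also have "\<dots> \<le> emeasure m L" using compactin_sets_m[OF L(2)] L(4) by (intro emeasure_mono)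
  finally have L0: "0 < emeasure m L" .
  define W where "W = Pi\<^sub>E {1..r} Z"
  have W: "W \<in> sets (borel_of XX)" unfolding sets_M[symmetric] W_def by (intro sets_PiM_I_finite Z_sets) auto
  have id: "(\<lambda>z. z) \<in> PiM {1..r} \<nu> \<rightarrow>\<^sub>M borel_of XX"
    using measurable_\<nu>_ident sets_M by (simp cong: measurable_cong_sets)
  \<comment> \<open>The product of the \<open>\<nu> k\<close> lives on the product of the
    \<open>Z k\<close>. Its image under the inclusion is a Borel measure on the Polish space
    \<open>XX\<close>, where compact inner regularity is available.\<close>
  define N where "N = distr (PiM {1..r} \<nu>) (borel_of XX) (\<lambda>z. z)"
  have sN: "sets N = sets (borel_of XX)" by (simp add: N_def)
  have fN: "finite_measure N" unfolding N_def by (rule finite_measure.finite_measure_distr[OF finite_PiM_\<nu> id])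
  have eN: "emeasure N A = emeasure (PiM {1..r} \<nu>) A" if "A \<in> sets N" "A \<subseteq> W" for A
  proof -
    have "emeasure N A = emeasure (PiM {1..r} \<nu>) ((\<lambda>z. z) -` A \<inter> space (PiM {1..r} \<nu>))"
      unfolding N_def by (rule emeasure_distr[OF id]) (use that sN in simp)
    also have "(\<lambda>z. z) -` A \<inter> space (PiM {1..r} \<nu>) = A" using that(2) unfolding space_PiM_\<nu> W_def by auto
    finally show ?thesis .
  qed
  obtain Q where Q: "\<And>i::nat. Q i \<subseteq> W" "\<And>i. compactin XX (Q i)" "emeasure N (W - (\<Union>i. Q i)) = 0"
    by (rule polish_compact_exhaustion[OF polish_XX sN fN W[folded sN]]) (rule that)
  have QN: "Q i \<in> sets N" for i using compactin_borel_of[OF Hausdorff_XX Q(2)] sN by simp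
  define D where "D i = hit diag XX ((\<lambda>h. inv h) ` L) (Q i)" for i
  have clD: "closedin XX (D i)" for i
    unfolding D_def by (rule closedin_hit[OF diag_act image_compactin[OF L(2) continuous_inv]
      compactin_imp_closedin[OF Hausdorff_XX Q(2)]])
  define R where "R i = {x \<in> topspace XX. \<exists>l>0. (ergodic_average m F diag (indicator (D i)) x \<longlongrightarrow> l) at_top}" for i
  have RN: "R i \<in> sets N" for i
    unfolding R_def sN
  proof (rule convenient_ergodicityD(1)[OF erg polish_XX diag_act sets_m])
    show "indicator (D i) \<in> borel_measurable (borel_of XX)"
      by (intro borel_measurable_indicator closedin_borel_of clD)
    show "\<bar>indicator (D i) x :: real\<bar> \<le> 1" for x by (simp add: indicator_def)
  qed
  have null: "Q i - R i \<in> null_sets N" for i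
  proof (rule ccontr)
    assume "Q i - R i \<notin> null_sets N"
    then have "emeasure N (Q i - R i) > 0" using QN RN by (auto simp: null_sets_def zero_less_iff_neq_zero)
    then obtain K where K: "K \<subseteq> Q i - R i" "compactin XX K" "emeasure N K > 0"
      by (rule polish_compact_subset[OF polish_XX sN fN sets.Diff[OF QN RN]]) (rule that)
    have KW: "K \<subseteq> W" "K \<subseteq> Q i" using K(1) Q(1) by auto
    have "K \<in> sets N" using compactin_borel_of[OF Hausdorff_XX K(2)] sN by simp
    then have "emeasure (PiM {1..r} \<nu>) K > 0" using K(3) eN KW by simp
    from exists_positive_average[OF erg K(2) KW(1)[unfolded W_def] this KW(2) L(1,3,4) D_def clD]
    obtain x l where x: "x \<in> K" "l > 0" "(ergodic_average m F diag (indicator (D i)) x \<longlongrightarrow> l) at_top" by auto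
    then have "x \<in> R i" using compactin_subset_topspace[OF K(2)] by (auto simp: R_def)
    then show False using x(1) K(1) by auto
  qed
  have "W - (\<Union>i. Q i) \<in> null_sets N" using Q(3) QN W sN by (intro null_setsI) auto
  moreover have "(\<Union>i. Q i - R i) \<in> null_sets N" by (rule null_sets_UN) (rule null)
  ultimately have "(W - (\<Union>i. Q i)) \<union> (\<Union>i. Q i - R i) \<in> null_sets N" by (rule null_sets.Un)
  from AE_not_in[OF this] have "AE z in PiM {1..r} \<nu>. z \<notin> (W - (\<Union>i. Q i)) \<union> (\<Union>i. Q i - R i)"
    unfolding N_def by (rule AE_distrD[OF id])
  then show ?thesis
  proof (rule AE_mp, intro AE_I2 impI)
    fix z assume z: "z \<in> space (PiM {1..r} \<nu>)" "z \<notin> (W - (\<Union>i. Q i)) \<union> (\<Union>i. Q i - R i)"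
    then obtain i where "z \<in> R i" unfolding space_PiM_\<nu> W_def by auto
    then obtain l where l: "z \<in> topspace XX" "l > 0"
      "(ergodic_average m F diag (indicator (D i)) z \<longlongrightarrow> l) at_top" by (auto simp: R_def)
    show "0 < lower_density m F (\<Inter>k\<in>{1..r}. hitting_set G (\<alpha> k) (Z k) (z k))"
      by (rule lower_density_positive[where F = F, OF F g(1) n g(3) g(4) L(2) L(5) L0 Q(2) Q(1)[unfolded W_def]
            D_def l(1) l(3) l(2)])
  qed
qed

end

theorem theorem1p11:
  fixes G :: "'g monoid" and T :: "'g topology" and m :: "'g measure"
    and r :: nat
    and X :: "nat \<Rightarrow> 's topology" and \<alpha> :: "nat \<Rightarrow> 'g \<Rightarrow> 's \<Rightarrow> 's"
    and Z :: "nat \<Rightarrow> 's set" and \<mu> \<nu> :: "nat \<Rightarrow> 's measure"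
  assumes "lcsc_group G T" and "unimodular G T" and "haar_measure G T m"
    and "r \<ge> 1"
    and "\<And>k. k \<in> {1..r} \<Longrightarrow> polish_space (X k)"
    and "\<And>k. k \<in> {1..r} \<Longrightarrow> jointly_continuous_action G T (X k) (\<alpha> k)"
    and "\<And>k. k \<in> {1..r} \<Longrightarrow> separated_cross_section G T (borel_of (X k)) (\<alpha> k) (Z k)"
    and "\<And>k. k \<in> {1..r} \<Longrightarrow> sets (\<mu> k) = sets (borel_of (X k))"
    and "\<And>k. k \<in> {1..r} \<Longrightarrow> prob_space (\<mu> k)"
    and "\<And>k. k \<in> {1..r} \<Longrightarrow> invariant_measure G (\<alpha> k) (\<mu> k)"
    and "\<And>k. k \<in> {1..r} \<Longrightarrow> transverse_measure G T m (\<alpha> k) (Z k) (\<mu> k) (\<nu> k)"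
    and "commensurable r G T X \<alpha> Z"
  shows "\<forall>F. convenient_sequence G T m F \<longrightarrow>
    (AE z in PiM {1..r} \<nu>.
       0 < lower_density m F (\<Inter>k\<in>{1..r}. hitting_set G (\<alpha> k) (Z k) (z k)))"
proof -
  have axioms: "commensurable_system_axioms G T m r X \<alpha> Z \<mu> \<nu>"
    by (rule commensurable_system_axioms.intro) (fact assms)+
  have "commensurable_system G T m r X \<alpha> Z \<mu> \<nu>"
    by (rule commensurable_system.intro[OF lcsc_group.haar_bi_invariant[OF assms(1,3,2)] axioms])
  from commensurable_system.AE_lower_density_positive[OF this] show ?thesis by (intro allI impI)
qed

end
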